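(* (Hashing inequality) For every density operator $\rho=\rho^{AB}$ on a finite-dimensional bipartite system $AB$, the one-way (forward) distillable entanglement satisfies $$D_\rightarrow(\rho)\ \ge\ H(\rho^B)-H(\rho^{AB}).$$
   Context: All Hilbert spaces are finite-dimensional; $\log$ is to base 2; $H(\sigma)=-\operatorname{Tr}\sigma\log\sigma$ is the von Neumann entropy and $\rho^B=\operatorname{Tr}_A\rho^{AB}$. (The right-hand side is the coherent information $I_c(A\,\rangle B)_\rho$.) A one-way entanglement distillation protocol on $n$ copies consists of a quantum instrument $\mathbf T=(T_\ell)_{\ell=1}^L$ for Alice, i.e. a finite collection of completely positive maps on operators on $A^{n}$ (the $n$-fold tensor power) which sum to a completely positive trace-preserving map, and for each $\ell$ a quantum operation (completely positive trace-preserving map) $R_\ell$ on operators on $B^n$ for Bob; the outputs are on $\mathbb C^M$ on each side. It is an $(n,\epsilon)$-protocol if it produces the maximally entangled state $|\Phi_M\rangle=\frac1{\sqrt M}\sum_{m=1}^M|m\rangle^A\otimes|m\rangle^B$ up to fidelity $1-\epsilon$: $$F\Bigl(\Phi_M,\sum_{\ell=1}^L(T_\ell\otimes R_\ell)(\rho^{\otimes n})\Bigr)\ge1-\epsilon,$$ where $F(\Phi_M,\sigma)=\langle\Phi_M|\sigma|\Phi_M\rangle$. A number $R$ is an achievable rate if for every $n$ there exist $(n,\epsilon)$-protocols with $\epsilon=\epsilon_n\to0$ and $\frac1n\log M\to R$ as $n\to\infty$. $D_\rightarrow(\rho):=\sup\{R:R\text{ achievable}\}$. *)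

theory Defs
  imports
    "HOL-Library.Extended_Real"
    "Jordan_Normal_Form.Schur_Decomposition"
begin

text \<open>
  The Hilbert space \<open>\<complex>\<^sup>d\<close> is represented by its dimension \<open>d\<close>, operators on it by
  \<open>carrier_mat d d\<close>. The basis vector \<open>|a\<rangle> \<otimes> |b\<rangle>\<close> of \<open>\<complex>\<^sup>d \<otimes> \<complex>\<^sup>e\<close> has index \<open>a * e + b\<close>.
\<close>

definition kron :: "complex mat \<Rightarrow> complex mat \<Rightarrow> complex mat" where
  "kron A B = mat (dim_row A * dim_row B) (dim_col A * dim_col B)
     (\<lambda>(i, j). A $$ (i div dim_row B, j div dim_col B) * B $$ (i mod dim_row B, j mod dim_col B))"

definition mat_unit :: "nat \<Rightarrow> nat \<Rightarrow> nat \<Rightarrow> complex mat" where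
  "mat_unit d a a' = mat d d (\<lambda>(i, j). if i = a \<and> j = a' then 1 else 0)"

definition mat_trace :: "complex mat \<Rightarrow> complex" where
  "mat_trace A = (\<Sum>i<dim_row A. A $$ (i, i))"

definition psd :: "nat \<Rightarrow> complex mat \<Rightarrow> bool" where
  "psd d A \<longleftrightarrow> A \<in> carrier_mat d d \<and> (\<forall>v \<in> carrier_vec d. (A *\<^sub>v v) \<bullet>c v \<ge> 0)"

definition density_operator :: "nat \<Rightarrow> complex mat \<Rightarrow> bool" where
  "density_operator d \<rho> \<longleftrightarrow> psd d \<rho> \<and> mat_trace \<rho> = 1"

definition partial_trace_A :: "nat \<Rightarrow> nat \<Rightarrow> complex mat \<Rightarrow> complex mat" where
  "partial_trace_A dA dB \<rho> = mat dB dB (\<lambda>(b, b'). \<Sum>a<dA. \<rho> $$ (a * dB + b, a * dB + b'))"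

definition unitary :: "nat \<Rightarrow> complex mat \<Rightarrow> bool" where
  "unitary d U \<longleftrightarrow> U \<in> carrier_mat d d \<and> mat_adjoint U * U = 1\<^sub>m d \<and> U * mat_adjoint U = 1\<^sub>m d"

definition real_diag :: "nat \<Rightarrow> (nat \<Rightarrow> real) \<Rightarrow> complex mat" where
  "real_diag d s = mat_diag d (\<lambda>i. complex_of_real (s i))"

text \<open>Functional calculus of Hermitian matrices: \<open>f (U diag(s) U\<^sup>*) = U diag(f \<circ> s) U\<^sup>*\<close>. The value
  does not depend on the diagonalization, see \<open>hermitian_fun_eq\<close> below.\<close>

definition hermitian_fun :: "(real \<Rightarrow> real) \<Rightarrow> complex mat \<Rightarrow> complex mat" where
  "hermitian_fun f A = (THE B. \<exists>U s. unitary (dim_row A) U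
     \<and> A = U * real_diag (dim_row A) s * mat_adjoint U
     \<and> B = U * real_diag (dim_row A) (f \<circ> s) * mat_adjoint U)"

text \<open>Since \<open>log 2 0 = 0\<close>, the usual convention \<open>0 log 0 = 0\<close> holds.\<close>

definition von_neumann_entropy :: "complex mat \<Rightarrow> real" where
  "von_neumann_entropy \<sigma> = - Re (mat_trace (\<sigma> * hermitian_fun (log 2) \<sigma>))"

definition linear_super :: "nat \<Rightarrow> nat \<Rightarrow> (complex mat \<Rightarrow> complex mat) \<Rightarrow> bool" where
  "linear_super d e T \<longleftrightarrow>
     (\<forall>X \<in> carrier_mat d d. T X \<in> carrier_mat e e) \<and>
     (\<forall>X \<in> carrier_mat d d. \<forall>Y \<in> carrier_mat d d. T (X + Y) = T X + T Y) \<and>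
     (\<forall>c. \<forall>X \<in> carrier_mat d d. T (c \<cdot>\<^sub>m X) = c \<cdot>\<^sub>m T X)"

text \<open>The linear extension of \<open>X \<otimes> Y \<mapsto> T X \<otimes> R Y\<close>, where \<open>T\<close> maps operators on \<open>\<complex>\<^sup>d\<close>
  to operators on \<open>\<complex>\<^sup>e\<close> and \<open>R\<close> maps operators on \<open>\<complex>\<^sup>d'\<close> to operators on \<open>\<complex>\<^sup>e'\<close>: the argument is
  expanded in the basis of products of matrix units.\<close>

definition super_tensor :: "nat \<Rightarrow> nat \<Rightarrow> nat \<Rightarrow> nat \<Rightarrow> (complex mat \<Rightarrow> complex mat) \<Rightarrow>
    (complex mat \<Rightarrow> complex mat) \<Rightarrow> complex mat \<Rightarrow> complex mat" where
  "super_tensor d e d' e' T R X = mat (e * e') (e * e') (\<lambda>(i, j).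
     \<Sum>a<d. \<Sum>a'<d. \<Sum>b<d'. \<Sum>b'<d'.
       X $$ (a * d' + b, a' * d' + b') * kron (T (mat_unit d a a')) (R (mat_unit d' b b')) $$ (i, j))"

definition completely_positive :: "nat \<Rightarrow> nat \<Rightarrow> (complex mat \<Rightarrow> complex mat) \<Rightarrow> bool" where
  "completely_positive d e T \<longleftrightarrow> linear_super d e T \<and>
     (\<forall>k X. psd (k * d) X \<longrightarrow> psd (k * e) (super_tensor k k d e (\<lambda>Y. Y) T X))"

definition trace_preserving :: "nat \<Rightarrow> (complex mat \<Rightarrow> complex mat) \<Rightarrow> bool" where
  "trace_preserving d T \<longleftrightarrow> (\<forall>X \<in> carrier_mat d d. mat_trace (T X) = mat_trace X)"

definition quantum_operation :: "nat \<Rightarrow> nat \<Rightarrow> (complex mat \<Rightarrow> complex mat) \<Rightarrow> bool" where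
  "quantum_operation d e T \<longleftrightarrow> completely_positive d e T \<and> trace_preserving d T"

definition mat_sum :: "nat \<Rightarrow> nat \<Rightarrow> (nat \<Rightarrow> complex mat) \<Rightarrow> complex mat" where
  "mat_sum d L A = mat d d (\<lambda>(i, j). \<Sum>l<L. A l $$ (i, j))"

definition instrument :: "nat \<Rightarrow> nat \<Rightarrow> nat \<Rightarrow> (nat \<Rightarrow> complex mat \<Rightarrow> complex mat) \<Rightarrow> bool" where
  "instrument d e L T \<longleftrightarrow> (\<forall>l<L. completely_positive d e (T l)) \<and>
     quantum_operation d e (\<lambda>X. mat_sum e L (\<lambda>l. T l X))"

text \<open>\<open>\<rho>\<^sup>\<otimes>\<^sup>n\<close> with the factors of \<open>(A \<otimes> B)\<^sup>\<otimes>\<^sup>n\<close> regrouped as \<open>A\<^sup>\<otimes>\<^sup>n \<otimes> B\<^sup>\<otimes>\<^sup>n\<close>. A basis vector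
  of \<open>A\<^sup>\<otimes>\<^sup>n\<close> has an index below \<open>dA ^ n\<close>, whose base-\<open>dA\<close> digit \<open>k\<close> is the basis index of the
  \<open>k\<close>-th copy; likewise for \<open>B\<close>.\<close>

definition digit :: "nat \<Rightarrow> nat \<Rightarrow> nat \<Rightarrow> nat" where
  "digit d k x = (x div d ^ k) mod d"

definition copy_index :: "nat \<Rightarrow> nat \<Rightarrow> nat \<Rightarrow> nat \<Rightarrow> nat \<Rightarrow> nat" where
  "copy_index dA dB n k i = digit dA k (i div dB ^ n) * dB + digit dB k (i mod dB ^ n)"

definition bipartite_power :: "nat \<Rightarrow> nat \<Rightarrow> nat \<Rightarrow> complex mat \<Rightarrow> complex mat" where
  "bipartite_power dA dB n \<rho> = mat (dA ^ n * dB ^ n) (dA ^ n * dB ^ n)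
     (\<lambda>(i, j). \<Prod>k<n. \<rho> $$ (copy_index dA dB n k i, copy_index dA dB n k j))"

definition max_entangled :: "nat \<Rightarrow> complex vec" where
  "max_entangled M =
     vec (M * M) (\<lambda>i. if i div M = i mod M then complex_of_real (1 / sqrt (real M)) else 0)"

text \<open>The inner product is real for positive semidefinite \<open>\<sigma>\<close>.\<close>

definition fidelity :: "complex vec \<Rightarrow> complex mat \<Rightarrow> real" where
  "fidelity \<phi> \<sigma> = Re ((\<sigma> *\<^sub>v \<phi>) \<bullet>c \<phi>)"

definition protocol_output :: "nat \<Rightarrow> nat \<Rightarrow> nat \<Rightarrow> nat \<Rightarrow> nat \<Rightarrow> (nat \<Rightarrow> complex mat \<Rightarrow> complex mat) \<Rightarrow>
    (nat \<Rightarrow> complex mat \<Rightarrow> complex mat) \<Rightarrow> complex mat \<Rightarrow> complex mat" where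
  "protocol_output dA dB n M L T R \<rho> = mat_sum (M * M) L
     (\<lambda>l. super_tensor (dA ^ n) M (dB ^ n) M (T l) (R l) (bipartite_power dA dB n \<rho>))"

definition one_way_protocol :: "nat \<Rightarrow> nat \<Rightarrow> complex mat \<Rightarrow> nat \<Rightarrow> real \<Rightarrow> nat \<Rightarrow> nat \<Rightarrow>
    (nat \<Rightarrow> complex mat \<Rightarrow> complex mat) \<Rightarrow> (nat \<Rightarrow> complex mat \<Rightarrow> complex mat) \<Rightarrow> bool" where
  "one_way_protocol dA dB \<rho> n \<epsilon> M L T R \<longleftrightarrow>
     instrument (dA ^ n) M L T \<and>
     (\<forall>l<L. quantum_operation (dB ^ n) M (R l)) \<and>
     fidelity (max_entangled M) (protocol_output dA dB n M L T R \<rho>) \<ge> 1 - \<epsilon>"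

definition achievable_rate :: "nat \<Rightarrow> nat \<Rightarrow> complex mat \<Rightarrow> real \<Rightarrow> bool" where
  "achievable_rate dA dB \<rho> r \<longleftrightarrow> (\<exists>(M :: nat \<Rightarrow> nat) (\<epsilon> :: nat \<Rightarrow> real).
     (\<forall>n\<ge>1. M n \<ge> 1 \<and> (\<exists>L T R. one_way_protocol dA dB \<rho> n (\<epsilon> n) (M n) L T R)) \<and>
     \<epsilon> \<longlonglongrightarrow> 0 \<and> (\<lambda>n. log 2 (real (M n)) / real n) \<longlonglongrightarrow> r)"

text \<open>The supremum is taken in the extended reals because on \<open>real\<close> the function \<open>Sup\<close> is
  meaningful only for nonempty sets that are bounded above.\<close>

definition distillable_entanglement :: "nat \<Rightarrow> nat \<Rightarrow> complex mat \<Rightarrow> ereal" where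
  "distillable_entanglement dA dB \<rho> = (SUP r \<in> {r. achievable_rate dA dB \<rho> r}. ereal r)"

lemma mat_adjoint_carrier: "A \<in> carrier_mat n m \<Longrightarrow> mat_adjoint A \<in> carrier_mat m n"
  unfolding mat_adjoint_def by auto

lemma hermitian_fun_unique:
  assumes U: "unitary n U" and V: "unitary n V"
    and eq: "U * real_diag n s * mat_adjoint U = V * real_diag n t * mat_adjoint V"
  shows "U * real_diag n (f \<circ> s) * mat_adjoint U = V * real_diag n (f \<circ> t) * mat_adjoint V"
proof -
  let ?U' = "mat_adjoint U" and ?V' = "mat_adjoint V"
  have c: "U \<in> carrier_mat n n" "V \<in> carrier_mat n n" "?U' \<in> carrier_mat n n" "?V' \<in> carrier_mat n n"
    using U V mat_adjoint_carrier unfolding unitary_def by auto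
  have d: "real_diag n x \<in> carrier_mat n n" for x unfolding real_diag_def by simp
  have iU: "?U' * U = 1\<^sub>m n" "U * ?U' = 1\<^sub>m n" and iV: "?V' * V = 1\<^sub>m n" "V * ?V' = 1\<^sub>m n"
    using U V unfolding unitary_def by auto
  define W where "W = ?V' * U"
  have W: "W \<in> carrier_mat n n" unfolding W_def using c by auto
  have *: "?V' * (U * real_diag n x * ?U') * U = W * real_diag n x" for x
  proof -
    have "?V' * (U * real_diag n x * ?U') * U = ?V' * U * real_diag n x * (?U' * U)"
      using c d[of x] by (simp add: assoc_mult_mat[where n\<^sub>1 = n and n\<^sub>2 = n and n\<^sub>3 = n and n\<^sub>4 = n])
    then show ?thesis using W d[of x] iU unfolding W_def by simp
  qed
  have **: "?V' * (V * real_diag n x * ?V') * U = real_diag n x * W" for x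
  proof -
    have "?V' * (V * real_diag n x * ?V') * U = (?V' * V) * (real_diag n x * (?V' * U))"
      using c d[of x] by (simp add: assoc_mult_mat[where n\<^sub>1 = n and n\<^sub>2 = n and n\<^sub>3 = n and n\<^sub>4 = n])
    then show ?thesis using W d[of x] iV unfolding W_def by simp
  qed
  have "W * real_diag n s = real_diag n t * W"
    using *[of s] **[of t] eq by simp
  then have m: "mat n n (\<lambda>(i, j). W $$ (i, j) * complex_of_real (s j)) =
      mat n n (\<lambda>(i, j). complex_of_real (t i) * W $$ (i, j))"
    unfolding real_diag_def mat_diag_mult_left[OF W] mat_diag_mult_right[OF W] .
  have e: "W $$ (i, j) * complex_of_real (s j) = complex_of_real (t i) * W $$ (i, j)"
    if "i < n" "j < n" for i j
    using arg_cong[OF m, of "\<lambda>X. X $$ (i, j)"] that by simp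
  have "W $$ (i, j) * complex_of_real (f (s j)) = complex_of_real (f (t i)) * W $$ (i, j)"
    if "i < n" "j < n" for i j
  proof (cases "W $$ (i, j) = 0")
    case False
    then have "s j = t i" using e[OF that] by simp
    then show ?thesis by simp
  qed simp
  then have "W * real_diag n (f \<circ> s) = real_diag n (f \<circ> t) * W"
    unfolding real_diag_def mat_diag_mult_left[OF W] mat_diag_mult_right[OF W]
    by (intro cong_mat) auto
  then have k: "V * (W * real_diag n (f \<circ> s)) * ?U' = V * (real_diag n (f \<circ> t) * W) * ?U'" by simp
  have "V * (W * real_diag n (f \<circ> s)) * ?U' = (V * ?V') * (U * real_diag n (f \<circ> s) * ?U')"
    unfolding W_def using c d[of "f \<circ> s"]
    by (simp add: assoc_mult_mat[where n\<^sub>1 = n and n\<^sub>2 = n and n\<^sub>3 = n and n\<^sub>4 = n])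
  moreover have "V * (real_diag n (f \<circ> t) * W) * ?U' = V * real_diag n (f \<circ> t) * ?V' * (U * ?U')"
    unfolding W_def using c d[of "f \<circ> t"]
    by (simp add: assoc_mult_mat[where n\<^sub>1 = n and n\<^sub>2 = n and n\<^sub>3 = n and n\<^sub>4 = n])
  moreover have "U * real_diag n (f \<circ> s) * ?U' \<in> carrier_mat n n"
    "V * real_diag n (f \<circ> t) * ?V' \<in> carrier_mat n n"
    using c d by auto
  ultimately show ?thesis
    using k unfolding iU iV by (metis left_mult_one_mat right_mult_one_mat)
qed

lemma hermitian_fun_eq:
  assumes U: "unitary n U" and A: "A = U * real_diag n s * mat_adjoint U"
  shows "hermitian_fun f A = U * real_diag n (f \<circ> s) * mat_adjoint U"
proof -
  have n: "dim_row A = n" using U unfolding A unitary_def by auto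
  show ?thesis
    unfolding hermitian_fun_def n
  proof (rule the_equality)
    show "\<exists>V t. unitary n V \<and> A = V * real_diag n t * mat_adjoint V
        \<and> U * real_diag n (f \<circ> s) * mat_adjoint U = V * real_diag n (f \<circ> t) * mat_adjoint V"
      using U A by blast
  next
    fix B
    assume "\<exists>V t. unitary n V \<and> A = V * real_diag n t * mat_adjoint V
        \<and> B = V * real_diag n (f \<circ> t) * mat_adjoint V"
    then obtain V t where V: "unitary n V" and AV: "A = V * real_diag n t * mat_adjoint V"
      and B: "B = V * real_diag n (f \<circ> t) * mat_adjoint V" by blast
    show "B = U * real_diag n (f \<circ> s) * mat_adjoint U"
      unfolding B using AV A by (intro hermitian_fun_unique[OF V U]) simp
  qed
qed

end

theory Submission
  imports Defs "Jordan_Normal_Form.Spectral_Radius"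
begin

text \<open>
  Alice uses the instrument whose Kraus operators \<open>K\<^sub>l\<close> have the entries \<open>v\<^sub>l(m, a) / sqrt (M L)\<close>, where
  \<open>v\<^sub>1, \<dots>, v\<^sub>L\<close> enumerates all matrices with entries in \<open>{1, \<i>, -1, -\<i>}\<close>. Since all outcomes belong to one
  instrument, the fidelity of the protocol is itself the average over random codes. Write
  \<open>\<rho>\<^sup>\<otimes>\<^sup>n = \<Sum>\<^sub>e p\<^sub>e |\<psi>\<^sub>e\<rangle>\<langle>\<psi>\<^sub>e|\<close>. Given \<open>l\<close>, Bob has to tell apart the vectors \<open>Y\<^sub>m\<^sub>,\<^sub>e\<close> obtained by
  contracting \<open>\<psi>\<^sub>e\<close> with row \<open>m\<close> of \<open>v\<^sub>l\<close>; with their Gram matrix \<open>G = Y\<^sup>*Y\<close> he applies the contraction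
  \<open>2 (1 + G)\<^sup>-\<^sup>1 Y\<^sup>*\<close>, which maps \<open>Y\<^sub>m\<^sub>,\<^sub>e\<close> approximately to \<open>|m\<rangle>|e\<rangle>\<close>, and discards \<open>e\<close>. As
  \<open>2x/(1+x) \<ge> (3x - x\<^sup>2)/2\<close>, the fidelity is controlled by the first two moments of \<open>G\<close>, which only
  involve the fourth moments of the phases. After truncation to typical \<open>e\<close> (there are at most
  \<open>2\<^sup>n\<^sup>(\<^sup>H\<^sup>(\<^sup>A\<^sup>B\<^sup>)\<^sup>+\<^sup>\<delta>\<^sup>)\<close>) and to typical eigenvectors of \<open>\<rho>\<^sup>B\<close> (with eigenvalue at most
  \<open>2\<^sup>-\<^sup>n\<^sup>(\<^sup>H\<^sup>(\<^sup>B\<^sup>)\<^sup>-\<^sup>\<delta>\<^sup>)\<close>) the error is at most \<open>3 \<epsilon> + M 2\<^sup>n\<^sup>(\<^sup>H\<^sup>(\<^sup>A\<^sup>B\<^sup>)\<^sup>-\<^sup>H\<^sup>(\<^sup>B\<^sup>)\<^sup>+\<^sup>2\<^sup>\<delta>\<^sup>)\<close>, where \<open>\<epsilon>\<close> is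
  the weight of the atypical part.
\<close>

section \<open>Diagonalization of Hermitian matrices\<close>

text \<open>The random construction aims at G = 1: the vectors of different pairs (m, e) would then
  be orthonormal and could be read out perfectly. G may be singular, and truncation even sets some
  vectors to zero, so the decoder must not rely on an inverse or an inverse root of G. The operator
  1 + G is always invertible, and 4x/(1+x)^2 <= 1 makes the decoder a contraction for every G. The
  quadratic (3x - x^2)/2 touches 2x/(1+x) to first order at x = 1, so a G near 1 loses nothing at
  leading order, and no power of G beyond the second has to be averaged. The factor 3 of the final
  error is its linear coefficient. The delicate point is that the decoder is designed for the
  truncated vectors but acts on the true state. It vanishes on the atypical eigenvectors of Bob, so
  for typical e true and truncated vectors give it the same amplitudes; for atypical e only the
  nonnegativity of the fidelity terms is used. A nonpositive coherent information lies outside this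
  argument and is covered by the rate 0, which is always achievable.\<close>

lemma mat_adjoint_dim [simp]: "dim_row (mat_adjoint A) = dim_col A" "dim_col (mat_adjoint A) = dim_row A"
  unfolding mat_adjoint_def by auto

lemma mat_adjoint_index [simp]:
  fixes A :: "complex mat"
  assumes "i < dim_col A" "j < dim_row A"
  shows "mat_adjoint A $$ (i, j) = cnj (A $$ (j, i))"
  using assms unfolding mat_adjoint_def by (simp add: mat_of_rows_index)

text \<open>Unitarity for bare coefficient functions, so that sums can be exchanged and digitwise
  products formed without matrix dimensions. Columns and rows are both recorded: columns serve
  Parseval and eigenvalues, rows serve the inversion of a change of basis.\<close>

definition unitary_coeffs :: "nat \<Rightarrow> (nat \<Rightarrow> nat \<Rightarrow> complex) \<Rightarrow> bool" where
  "unitary_coeffs n u \<longleftrightarrow>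
     (\<forall>i<n. \<forall>j<n. (\<Sum>k<n. cnj (u k i) * u k j) = (if i = j then 1 else 0)) \<and>
     (\<forall>i<n. \<forall>j<n. (\<Sum>k<n. u i k * cnj (u j k)) = (if i = j then 1 else 0))"

lemma mult_index_sum:
  assumes "A \<in> carrier_mat n m" "B \<in> carrier_mat m l" "i < n" "j < l"
  shows "(A * B) $$ (i, j) = (\<Sum>k<m. A $$ (i, k) * B $$ (k, j))"
  using assms by (auto simp: scalar_prod_def atLeast0LessThan)

lemma unitary_imp_coeffs:
  assumes U: "unitary n U"
  shows "unitary_coeffs n (\<lambda>i j. U $$ (i, j))"
proof -
  have c: "U \<in> carrier_mat n n" "mat_adjoint U \<in> carrier_mat n n"
    using U mat_adjoint_carrier unfolding unitary_def by auto
  have "(\<Sum>k<n. cnj (U $$ (k, i)) * U $$ (k, j)) = (if i = j then 1 else 0)" if "i < n" "j < n" for i j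
  proof -
    have "(mat_adjoint U * U) $$ (i, j) = (if i = j then 1 else 0)"
      using U that unfolding unitary_def by simp
    then show ?thesis
      using that c by (subst (asm) mult_index_sum[of _ n n _ n]) auto
  qed
  moreover have "(\<Sum>k<n. U $$ (i, k) * cnj (U $$ (j, k))) = (if i = j then 1 else 0)" if "i < n" "j < n" for i j
  proof -
    have "(U * mat_adjoint U) $$ (i, j) = (if i = j then 1 else 0)"
      using U that unfolding unitary_def by simp
    then show ?thesis
      using that c by (subst (asm) mult_index_sum[of _ n n _ n]) auto
  qed
  ultimately show ?thesis unfolding unitary_coeffs_def by blast
qed

lemma unitaryI_cols:
  assumes c: "U \<in> carrier_mat n n"
    and o: "\<And>i j. i < n \<Longrightarrow> j < n \<Longrightarrow> (\<Sum>k<n. cnj (U $$ (k, i)) * U $$ (k, j)) = (if i = j then 1 else 0)"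
  shows "unitary n U"
proof -
  have c': "mat_adjoint U \<in> carrier_mat n n" using c mat_adjoint_carrier by auto
  have "mat_adjoint U * U = 1\<^sub>m n"
  proof (rule eq_matI)
    fix i j assume "i < dim_row (1\<^sub>m n :: complex mat)" "j < dim_col (1\<^sub>m n :: complex mat)"
    then have ij: "i < n" "j < n" by auto
    show "(mat_adjoint U * U) $$ (i, j) = 1\<^sub>m n $$ (i, j)"
      using ij c o[OF ij] by (subst mult_index_sum[OF c' c]) auto
  qed (use c in auto)
  with mat_mult_left_right_inverse[OF c' c this] show ?thesis
    using c unfolding unitary_def by auto
qed

lemma diagonalization_index:
  assumes c: "U \<in> carrier_mat n n" and ij: "i < n" "j < n"
  shows "(U * real_diag n s * mat_adjoint U) $$ (i, j) =
    (\<Sum>k<n. complex_of_real (s k) * U $$ (i, k) * cnj (U $$ (j, k)))"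
proof -
  have c': "mat_adjoint U \<in> carrier_mat n n" using c mat_adjoint_carrier by auto
  have "U * real_diag n s = mat n n (\<lambda>(i, j). U $$ (i, j) * complex_of_real (s j))"
    unfolding real_diag_def by (rule mat_diag_mult_right[OF c])
  then show ?thesis
    using ij c by (subst mult_index_sum[OF _ c', of _ n]) (auto simp: mult_ac)
qed

text \<open>Complete \<open>v\<close> to a basis and orthogonalize. Gram-Schmidt leaves the first
  vector unchanged, so only the normalization alters it; this is the scalar
  \<open>c\<close>.\<close>

lemma unitary_first_column:
  assumes v: "v \<in> carrier_vec n" and v0: "v \<noteq> 0\<^sub>v n"
  shows "\<exists>U c. unitary n U \<and> col U 0 = (c :: complex) \<cdot>\<^sub>v v"
proof -
  interpret cof_vec_space n "TYPE(complex)" .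
  define b where "b = basis_completion v"
  define ws where "ws = gram_schmidt n b"
  from basis_completion[OF v v0, folded b_def]
  have span_b: "span (set b) = carrier_vec n" and dist_b: "distinct b"
    and indep: "\<not> lin_dep (set b)" and b: "set b \<subseteq> carrier_vec n" and hdb: "hd b = v"
    and len_b: "length b = n" by auto
  have n: "n \<noteq> 0" using v v0 by auto
  from hdb len_b n obtain vs where bv: "b = v # vs" by (cases b, auto)
  from gram_schmidt_result[OF b dist_b indep refl, folded ws_def]
  have ws: "set ws \<subseteq> carrier_vec n" "corthogonal ws" "length ws = n"
    by (auto simp: len_b)
  from gram_schmidt_hd[OF v, of vs, folded bv] have hdws: "hd ws = v" unfolding ws_def .
  have wc: "ws ! i \<in> carrier_vec n" if "i < n" for i using ws that by (auto simp: subset_iff)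
  define r where "r i = (\<Sum>k<n. (cmod (ws ! i $ k))\<^sup>2)" for i
  have sp: "ws ! i \<bullet>c ws ! j = (\<Sum>k<n. ws ! i $ k * cnj (ws ! j $ k))" if "i < n" "j < n" for i j
    using wc[OF that(1)] wc[OF that(2)] by (auto simp: scalar_prod_def atLeast0LessThan)
  have rr: "ws ! i \<bullet>c ws ! i = complex_of_real (r i)" if "i < n" for i
    unfolding sp[OF that that] r_def by (simp add: complex_mult_cnj cmod_def)
  have orth: "(ws ! i \<bullet>c ws ! j = 0) = (i \<noteq> j)" if "i < n" "j < n" for i j
    using corthogonalD[OF ws(2)] ws(3) that by auto
  have rpos: "r i > 0" if "i < n" for i
  proof -
    have "r i \<ge> 0" unfolding r_def by (intro sum_nonneg) auto
    moreover have "r i \<noteq> 0" using orth[OF that that] rr[OF that] by auto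
    ultimately show ?thesis by simp
  qed
  define U where "U = mat n n (\<lambda>(i, j). complex_of_real (1 / sqrt (r j)) * ws ! j $ i)"
  have U: "unitary n U"
  proof (rule unitaryI_cols)
    show "U \<in> carrier_mat n n" unfolding U_def by simp
    fix i j assume ij: "i < n" "j < n"
    have "(\<Sum>k<n. cnj (U $$ (k, i)) * U $$ (k, j)) =
      complex_of_real (1 / sqrt (r i) * (1 / sqrt (r j))) * (\<Sum>k<n. ws ! j $ k * cnj (ws ! i $ k))"
      unfolding sum_distrib_left by (rule sum.cong) (use ij in \<open>auto simp: U_def\<close>)
    also have "\<dots> = complex_of_real (1 / sqrt (r i) * (1 / sqrt (r j))) * (ws ! j \<bullet>c ws ! i)"
      using sp ij by simp
    also have "\<dots> = (if i = j then 1 else 0)"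
    proof (cases "i = j")
      case True
      have "1 / sqrt (r j) * (1 / sqrt (r j)) * r j = 1" using rpos[OF ij(2)] by (simp add: field_simps)
      then show ?thesis using True rr[OF ij(2)] by (metis of_real_1 of_real_mult)
    qed (use orth ij in auto)
    finally show "(\<Sum>k<n. cnj (U $$ (k, i)) * U $$ (k, j)) = (if i = j then 1 else 0)" .
  qed
  have "col U 0 = complex_of_real (1 / sqrt (r 0)) \<cdot>\<^sub>v v"
  proof -
    have "ws \<noteq> []" using ws(3) n by force
    then have "ws ! 0 = v" using hd_conv_nth hdws by metis
    then show ?thesis using n v by (intro eq_vecI) (auto simp: U_def)
  qed
  with U show ?thesis by (intro exI conjI)
qed

text \<open>Deflation by induction on the dimension: a unitary whose first column is an eigenvector
  splits off a 1 x 1 block, and the remaining block is again Hermitian.\<close>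

theorem hermitian_diagonalization:
  assumes "A \<in> carrier_mat n n"
    and "\<And>i j. i < n \<Longrightarrow> j < n \<Longrightarrow> A $$ (j, i) = cnj (A $$ (i, j))"
  shows "\<exists>U s. unitary n U \<and> A = U * real_diag n s * mat_adjoint U"
  using assms
proof (induction n arbitrary: A)
  case 0
  have "unitary 0 (1\<^sub>m 0)" by (rule unitaryI_cols) auto
  moreover have "A = 1\<^sub>m 0 * real_diag 0 (\<lambda>_. 0) * mat_adjoint (1\<^sub>m 0)"
    using 0 by (intro eq_matI) auto
  ultimately show ?case by blast
next
  case (Suc n)
  let ?N = "Suc n"
  note A = Suc.prems(1) and herm = Suc.prems(2)
  obtain e where "eigenvalue A e"
    using spectrum_non_empty[OF A] unfolding spectrum_def by auto
  then obtain v where v: "v \<in> carrier_vec ?N" "v \<noteq> 0\<^sub>v ?N" "A *\<^sub>v v = e \<cdot>\<^sub>v v"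
    using A unfolding eigenvalue_def eigenvector_def by auto
  obtain U c where U: "unitary ?N U" and col: "col U 0 = c \<cdot>\<^sub>v v"
    using unitary_first_column[OF v(1,2)] by blast
  let ?U' = "mat_adjoint U"
  have cU: "U \<in> carrier_mat ?N ?N" "?U' \<in> carrier_mat ?N ?N"
    using U mat_adjoint_carrier unfolding unitary_def by auto
  have iU: "?U' * U = 1\<^sub>m ?N" "U * ?U' = 1\<^sub>m ?N" using U unfolding unitary_def by auto
  define A' where "A' = ?U' * (A * U)"
  have cA': "A' \<in> carrier_mat ?N ?N" unfolding A'_def using cU A by auto
  have AA': "A = U * A' * ?U'"
  proof -
    have "U * A' * ?U' = (U * ?U') * A * (U * ?U')" unfolding A'_def
      using cU A by (simp add: assoc_mult_mat[where n\<^sub>1 = ?N and n\<^sub>2 = ?N and n\<^sub>3 = ?N and n\<^sub>4 = ?N])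
    then show ?thesis unfolding iU using A by simp
  qed
  have A'_index: "A' $$ (i, j) = (\<Sum>k<?N. \<Sum>l<?N. cnj (U $$ (k, i)) * A $$ (k, l) * U $$ (l, j))"
    if "i < ?N" "j < ?N" for i j
  proof -
    have "A' $$ (i, j) = (\<Sum>k<?N. ?U' $$ (i, k) * (A * U) $$ (k, j))"
      unfolding A'_def using mult_index_sum[OF cU(2) _ that, of "A * U"] A cU by simp
    also have "\<dots> = (\<Sum>k<?N. cnj (U $$ (k, i)) * (\<Sum>l<?N. A $$ (k, l) * U $$ (l, j)))"
      by (rule sum.cong[OF refl]) (use that cU mult_index_sum[OF A cU(1)] in auto)
    finally show ?thesis by (simp only: sum_distrib_left mult.assoc)
  qed
  have herm': "A' $$ (j, i) = cnj (A' $$ (i, j))" if ij: "i < ?N" "j < ?N" for i j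
  proof -
    have "cnj (A' $$ (i, j)) = (\<Sum>k<?N. \<Sum>l<?N. cnj (U $$ (l, j)) * A $$ (l, k) * U $$ (k, i))"
      unfolding A'_index[OF ij] cnj_sum
    proof (intro sum.cong refl)
      fix k l assume "k \<in> {..<?N}" "l \<in> {..<?N}"
      then have "cnj (A $$ (k, l)) = A $$ (l, k)" using herm[of k l] by simp
      then show "cnj (cnj (U $$ (k, i)) * A $$ (k, l) * U $$ (l, j)) = cnj (U $$ (l, j)) * A $$ (l, k) * U $$ (k, i)"
        by (simp add: mult_ac)
    qed
    also have "\<dots> = A' $$ (j, i)" unfolding A'_index[OF ij(2,1)] by (rule sum.swap)
    finally show ?thesis by simp
  qed
  have col0: "A' $$ (i, 0) = (if i = 0 then e else 0)" if i: "i < ?N" for i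
  proof -
    have "col (A * U) 0 = A *\<^sub>v col U 0" using cU A by (intro eq_vecI) auto
    also have "\<dots> = e \<cdot>\<^sub>v col U 0" unfolding col using v A
      by (simp add: mult_mat_vec smult_smult_assoc mult.commute)
    finally have 1: "col (A * U) 0 = e \<cdot>\<^sub>v col U 0" .
    have "A' $$ (i, 0) = row ?U' i \<bullet> col (A * U) 0" unfolding A'_def using cU A i by auto
    also have "\<dots> = e * (row ?U' i \<bullet> col U 0)" unfolding 1 using cU i by simp
    also have "row ?U' i \<bullet> col U 0 = (?U' * U) $$ (i, 0)" using cU i by auto
    finally show ?thesis unfolding iU using i by simp
  qed
  \<comment> \<open>Hermiticity carries the vanishing of the first column over to the first row; it
    also makes the eigenvalue \<open>e\<close> real.\<close>
  have row0: "A' $$ (0, j) = (if j = 0 then e else 0)" if "j < ?N" for j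
    using herm'[of j 0] col0[OF that] herm'[of 0 0] col0[of 0] that by (auto split: if_splits)
  have ereal: "e = complex_of_real (Re e)"
    using herm'[of 0 0] col0[of 0] by (simp add: complex_eq_iff)
  define A3 where "A3 = mat n n (\<lambda>(i, j). A' $$ (Suc i, Suc j))"
  have "\<exists>V s. unitary n V \<and> A3 = V * real_diag n s * mat_adjoint V"
  proof (rule Suc.IH)
    show "A3 $$ (j, i) = cnj (A3 $$ (i, j))" if "i < n" "j < n" for i j
      using herm'[of "Suc i" "Suc j"] that unfolding A3_def by simp
  qed (simp add: A3_def)
  then obtain V s where V: "unitary n V" and A3: "A3 = V * real_diag n s * mat_adjoint V" by blast
  have cV: "V \<in> carrier_mat n n" using V unfolding unitary_def by auto
  \<comment> \<open>\<open>W\<close> is the direct sum of the 1 x 1 identity and \<open>V\<close>,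
    so \<open>U * W\<close> diagonalizes \<open>A\<close>.\<close>
  define W where "W = mat ?N ?N (\<lambda>(i, j). case i of 0 \<Rightarrow> (if j = 0 then 1 else 0)
    | Suc i' \<Rightarrow> (case j of 0 \<Rightarrow> 0 | Suc j' \<Rightarrow> V $$ (i', j')))"
  define t where "t = case_nat (Re e) s"
  have cW: "W \<in> carrier_mat ?N ?N" unfolding W_def by simp
  have uW: "unitary ?N W"
  proof (rule unitaryI_cols[OF cW])
    fix i j assume "i < ?N" "j < ?N"
    then show "(\<Sum>k<?N. cnj (W $$ (k, i)) * W $$ (k, j)) = (if i = j then 1 else 0)"
      using unitary_imp_coeffs[OF V] unfolding sum.lessThan_Suc_shift W_def unitary_coeffs_def
      by (cases i; cases j) auto
  qed
  have A'W: "A' = W * real_diag ?N t * mat_adjoint W"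
  proof (rule eq_matI)
    fix i j assume "i < dim_row (W * real_diag ?N t * mat_adjoint W)"
      "j < dim_col (W * real_diag ?N t * mat_adjoint W)"
    then have ij: "i < ?N" "j < ?N" using cW by auto
    have "(\<Sum>k<?N. complex_of_real (t k) * W $$ (i, k) * cnj (W $$ (j, k))) = A' $$ (i, j)"
    proof (cases "i = 0 \<or> j = 0")
      case True
      then show ?thesis
        using ij col0[OF ij(1)] row0[OF ij(2)] ereal unfolding sum.lessThan_Suc_shift W_def t_def
        by (cases i; cases j) auto
    next
      case False
      then obtain i' j' where s: "i = Suc i'" "j = Suc j'" by (metis not0_implies_Suc)
      have "A' $$ (i, j) = A3 $$ (i', j')" using ij unfolding s A3_def by simp
      also have "\<dots> = (\<Sum>k<n. complex_of_real (s k) * V $$ (i', k) * cnj (V $$ (j', k)))"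
        unfolding A3 using diagonalization_index[OF cV] ij s by simp
      finally show ?thesis using ij unfolding sum.lessThan_Suc_shift W_def t_def s by simp
    qed
    then show "A' $$ (i, j) = (W * real_diag ?N t * mat_adjoint W) $$ (i, j)"
      unfolding diagonalization_index[OF cW ij] by simp
  qed (use cA' cW in auto)
  define Z where "Z = U * W"
  have cZ: "Z \<in> carrier_mat ?N ?N" unfolding Z_def using cU cW by simp
  have cW': "mat_adjoint W \<in> carrier_mat ?N ?N" using cW mat_adjoint_carrier by auto
  have adjZ: "mat_adjoint Z = mat_adjoint W * ?U'"
  proof (rule eq_matI)
    fix i j assume "i < dim_row (mat_adjoint W * ?U')" "j < dim_col (mat_adjoint W * ?U')"
    then have ij: "i < ?N" "j < ?N" using cW cU by auto
    have "mat_adjoint Z $$ (i, j) = cnj (\<Sum>k<?N. U $$ (j, k) * W $$ (k, i))"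
      using ij cZ mult_index_sum[OF cU(1) cW ij(2,1)] by (simp add: Z_def cU(1)[THEN carrier_matD(1)] cW[THEN carrier_matD(2)])
    also have "\<dots> = (\<Sum>k<?N. mat_adjoint W $$ (i, k) * ?U' $$ (k, j))"
      unfolding cnj_sum by (rule sum.cong[OF refl]) (use ij cU cW in \<open>auto simp: mult_ac\<close>)
    finally show "mat_adjoint Z $$ (i, j) = (mat_adjoint W * ?U') $$ (i, j)"
      unfolding mult_index_sum[OF cW' cU(2) ij] .
  qed (use cW cU in \<open>auto simp: Z_def\<close>)
  note assoc = assoc_mult_mat[where n\<^sub>1 = ?N and n\<^sub>2 = ?N and n\<^sub>3 = ?N and n\<^sub>4 = ?N]
  have "mat_adjoint Z * Z = mat_adjoint W * (?U' * U) * W"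
    unfolding adjZ unfolding Z_def using cU cW cW' by (simp add: assoc)
  then have "mat_adjoint Z * Z = 1\<^sub>m ?N" unfolding iU right_mult_one_mat[OF cW'] using uW unfolding unitary_def by simp
  moreover have "Z * mat_adjoint Z = U * (W * mat_adjoint W) * ?U'"
    unfolding adjZ unfolding Z_def using cU cW cW' by (simp add: assoc)
  then have "Z * mat_adjoint Z = 1\<^sub>m ?N" using iU right_mult_one_mat[OF cU(1)] uW unfolding unitary_def by simp
  ultimately have "unitary ?N Z" using cZ unfolding unitary_def by simp
  moreover have "A = Z * real_diag ?N t * mat_adjoint Z"
  proof -
    have D: "real_diag ?N t \<in> carrier_mat ?N ?N" unfolding real_diag_def by simp
    then have "real_diag ?N t * mat_adjoint W \<in> carrier_mat ?N ?N" using cW' by simp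
    then show ?thesis unfolding AA' A'W adjZ unfolding Z_def
      using cU cW cW' D by (simp add: assoc)
  qed
  ultimately show ?case by blast
qed

section \<open>Protocols in Kraus form\<close>

lemma sum_pairs_lessThan:
  fixes f :: "nat \<Rightarrow> 'a :: comm_monoid_add"
  shows "(\<Sum>i<m * n. f i) = (\<Sum>a<m. \<Sum>b<n. f (a * n + b))"
proof (cases "n = 0")
  case False
  then have "(\<Sum>i<m * n. f i) = (\<Sum>(a, b)\<in>{..<m} \<times> {..<n}. f (a * n + b))"
  proof (intro sum.reindex_bij_witness[of _ "\<lambda>(a, b). a * n + b" "\<lambda>i. (i div n, i mod n)"])
    fix i assume "i \<in> {..<m * n}"
    then show "(i div n, i mod n) \<in> {..<m} \<times> {..<n}"
      using False by (auto simp: less_mult_imp_div_less)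
  next
    fix p assume p: "p \<in> {..<m} \<times> {..<n}"
    obtain a b where "p = (a, b)" "a < m" "b < n" using p by auto
    moreover from this have "a * n + b < m * n"
      by (metis add.commute add_less_mono1 less_le_trans mult_Suc mult_le_mono1 Suc_leI)
    ultimately show "(case p of (a, b) \<Rightarrow> a * n + b) \<in> {..<m * n}" by simp
  qed (use False in auto)
  then show ?thesis by (simp add: sum.cartesian_product)
qed simp

lemma pair_index_less: "(a :: nat) < m \<Longrightarrow> b < n \<Longrightarrow> a * n + b < m * n"
  by (metis add.commute add_less_mono1 less_le_trans mult_Suc mult_le_mono1 Suc_leI)

lemma quadratic_form_index:
  assumes "A \<in> carrier_mat d d" "v \<in> carrier_vec d"
  shows "(A *\<^sub>v v) \<bullet>c v = (\<Sum>i<d. \<Sum>j<d. A $$ (i, j) * v $ j * cnj (v $ i))"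
  using assms by (simp add: scalar_prod_def atLeast0LessThan sum_distrib_right)

lemma psd_iff:
  "psd d A \<longleftrightarrow> A \<in> carrier_mat d d \<and> (\<forall>u. (\<Sum>i<d. \<Sum>j<d. A $$ (i, j) * u j * cnj (u i)) \<ge> 0)"
proof
  assume p: "psd d A"
  then have c: "A \<in> carrier_mat d d" unfolding psd_def by simp
  have "(\<Sum>i<d. \<Sum>j<d. A $$ (i, j) * u j * cnj (u i)) \<ge> 0" for u
  proof -
    have "(A *\<^sub>v vec d u) \<bullet>c vec d u \<ge> 0" using p unfolding psd_def by simp
    then show ?thesis using quadratic_form_index[OF c, of "vec d u"] by simp
  qed
  then show "A \<in> carrier_mat d d \<and> (\<forall>u. (\<Sum>i<d. \<Sum>j<d. A $$ (i, j) * u j * cnj (u i)) \<ge> 0)"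
    using c by simp
next
  assume a: "A \<in> carrier_mat d d \<and> (\<forall>u. (\<Sum>i<d. \<Sum>j<d. A $$ (i, j) * u j * cnj (u i)) \<ge> 0)"
  then show "psd d A" unfolding psd_def by (auto simp: quadratic_form_index)
qed

text \<open>The Kraus operators are the matrices \<open>K k\<close> for \<open>k\<close> in
  \<open>I\<close>. Keeping the index set separate lets a single branch \<open>{l}\<close> of an
  instrument and the sum \<open>{..<L}\<close> of all branches share one family
  \<open>K\<close>.\<close>

definition kraus_map :: "nat \<Rightarrow> nat \<Rightarrow> 'k set \<Rightarrow> ('k \<Rightarrow> nat \<Rightarrow> nat \<Rightarrow> complex) \<Rightarrow> complex mat \<Rightarrow> complex mat" where
  "kraus_map d e I K X = mat e e (\<lambda>(i, j). \<Sum>k\<in>I. \<Sum>a<d. \<Sum>b<d. K k i a * X $$ (a, b) * cnj (K k j b))"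

lemma kraus_map_mat_unit:
  assumes "i < e" "j < e" "a < d" "a' < d"
  shows "kraus_map d e I K (mat_unit d a a') $$ (i, j) = (\<Sum>k\<in>I. K k i a * cnj (K k j a'))"
proof -
  have "(\<Sum>x<d. \<Sum>y<d. K k i x * mat_unit d a a' $$ (x, y) * cnj (K k j y)) = K k i a * cnj (K k j a')" for k
  proof -
    have "(\<Sum>x<d. \<Sum>y<d. K k i x * mat_unit d a a' $$ (x, y) * cnj (K k j y)) =
      (\<Sum>x<d. \<Sum>y<d. if y = a' then (if x = a then K k i x * cnj (K k j y) else 0) else 0)"
      by (intro sum.cong refl) (auto simp: mat_unit_def)
    then show ?thesis using assms by simp
  qed
  then show ?thesis using assms unfolding kraus_map_def by simp
qed

lemma kraus_map_linear: "linear_super d e (kraus_map d e I K)"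
  unfolding linear_super_def
proof (intro conjI ballI allI)
  fix X Y :: "complex mat" and c assume X: "X \<in> carrier_mat d d" and Y: "Y \<in> carrier_mat d d"
  show "kraus_map d e I K (X + Y) = kraus_map d e I K X + kraus_map d e I K Y"
    using X Y by (intro eq_matI) (simp_all add: kraus_map_def ring_distribs sum.distrib)
  show "kraus_map d e I K (c \<cdot>\<^sub>m X) = c \<cdot>\<^sub>m kraus_map d e I K X"
    using X by (intro eq_matI) (simp_all add: kraus_map_def sum_distrib_left mult_ac)
qed (simp add: kraus_map_def)

lemma sum_distrib_product:
  fixes x :: "'a :: semiring_0"
  shows "x * (\<Sum>i\<in>A. g i) * (\<Sum>j\<in>B. h j) = (\<Sum>j\<in>B. \<Sum>i\<in>A. x * g i * h j)"
  unfolding sum_distrib_left unfolding sum_distrib_right ..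

lemma super_tensor_id_index:
  assumes ij: "i < k * e" "j < k * e"
    and T: "\<And>b b'. T (mat_unit d b b') \<in> carrier_mat e e"
  shows "super_tensor k k d e (\<lambda>Y. Y) T X $$ (i, j) =
    (\<Sum>b<d. \<Sum>b'<d. X $$ (i div e * d + b, j div e * d + b') * T (mat_unit d b b') $$ (i mod e, j mod e))"
proof -
  have e: "e > 0" using assms by (cases e) auto
  have ij': "i div e < k" "j div e < k" using ij by (auto simp: less_mult_imp_div_less)
  have kr: "kron (mat_unit k a a') (T (mat_unit d b b')) $$ (i, j) =
    (if a' = j div e then if a = i div e then T (mat_unit d b b') $$ (i mod e, j mod e) else 0 else 0)" for a a' b b'
    using ij ij' carrier_matD[OF T] by (simp add: kron_def) (simp add: mat_unit_def)
  have "super_tensor k k d e (\<lambda>Y. Y) T X $$ (i, j) =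
    (\<Sum>a<k. \<Sum>a'<k. if a' = j div e then (if a = i div e then
      (\<Sum>b<d. \<Sum>b'<d. X $$ (a * d + b, a' * d + b') * T (mat_unit d b b') $$ (i mod e, j mod e)) else 0) else 0)"
  proof -
    have "super_tensor k k d e (\<lambda>Y. Y) T X $$ (i, j) = (\<Sum>a<k. \<Sum>a'<k. \<Sum>b<d. \<Sum>b'<d.
       X $$ (a * d + b, a' * d + b') * kron (mat_unit k a a') (T (mat_unit d b b')) $$ (i, j))"
      unfolding super_tensor_def using ij by simp
    also have "\<dots> = (\<Sum>a<k. \<Sum>a'<k. if a' = j div e then (if a = i div e then
      (\<Sum>b<d. \<Sum>b'<d. X $$ (a * d + b, a' * d + b') * T (mat_unit d b b') $$ (i mod e, j mod e)) else 0) else 0)"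
      by (intro sum.cong refl) (auto simp: kr)
    finally show ?thesis .
  qed
  then show ?thesis using ij' by simp
qed

lemma kraus_map_completely_positive:
  assumes "finite I"
  shows "completely_positive d e (kraus_map d e I K)"
  unfolding completely_positive_def
proof (intro conjI allI impI kraus_map_linear)
  fix k X assume X: "psd (k * d) X"
  let ?S = "super_tensor k k d e (\<lambda>Y. Y) (kraus_map d e I K) X"
  have S: "?S $$ (i * e + m, j * e + m') =
    (\<Sum>\<kappa>\<in>I. \<Sum>b<d. \<Sum>b'<d. X $$ (i * d + b, j * d + b') * (K \<kappa> m b * cnj (K \<kappa> m' b')))"
    if "i < k" "j < k" "m < e" "m' < e" for i j m m'
  proof -
    have "?S $$ (i * e + m, j * e + m') =
      (\<Sum>b<d. \<Sum>b'<d. X $$ (i * d + b, j * d + b') * (\<Sum>\<kappa>\<in>I. K \<kappa> m b * cnj (K \<kappa> m' b')))"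
      using that pair_index_less[of i k m e] pair_index_less[of j k m' e]
      by (subst super_tensor_id_index) (auto simp: kraus_map_mat_unit intro!: sum.cong, simp add: kraus_map_def)
    also have "\<dots> = (\<Sum>b<d. \<Sum>b'<d. \<Sum>\<kappa>\<in>I. X $$ (i * d + b, j * d + b') * (K \<kappa> m b * cnj (K \<kappa> m' b')))"
      by (simp add: sum_distrib_left)
    also have "\<dots> = (\<Sum>\<kappa>\<in>I. \<Sum>b<d. \<Sum>b'<d. X $$ (i * d + b, j * d + b') * (K \<kappa> m b * cnj (K \<kappa> m' b')))"
      by (simp only: sum.swap[of _ I])
    finally show ?thesis .
  qed
  have "0 \<le> (\<Sum>i<k * e. \<Sum>j<k * e. ?S $$ (i, j) * u j * cnj (u i))" for u
  proof -
    define w where "w \<kappa> y = (\<Sum>m<e. cnj (K \<kappa> m (y mod d)) * u (y div d * e + m))" for \<kappa> y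
    have "(\<Sum>i<k * e. \<Sum>j<k * e. ?S $$ (i, j) * u j * cnj (u i)) =
      (\<Sum>i<k. \<Sum>m<e. \<Sum>j<k. \<Sum>m'<e. \<Sum>\<kappa>\<in>I. \<Sum>b<d. \<Sum>b'<d. X $$ (i * d + b, j * d + b') *
         (cnj (K \<kappa> m' b') * u (j * e + m')) * (K \<kappa> m b * cnj (u (i * e + m))))"
      unfolding sum_pairs_lessThan
      by (intro sum.cong refl) (simp add: S sum_distrib_right sum_distrib_left mult_ac)
    \<comment> \<open>Fixing the index sets orients each exchange of sums: rewriting terminates and
      brings both sides to the same order of summation.\<close>
    also have "\<dots> = (\<Sum>\<kappa>\<in>I. \<Sum>i<k. \<Sum>b<d. \<Sum>j<k. \<Sum>b'<d. \<Sum>m<e. \<Sum>m'<e. X $$ (i * d + b, j * d + b') *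
         (cnj (K \<kappa> m' b') * u (j * e + m')) * (K \<kappa> m b * cnj (u (i * e + m))))"
      by (simp only: sum.swap[of _ I] sum.swap[of _ "{..<d}" "{..<e}"] sum.swap[of _ "{..<k}" "{..<e}"]
          sum.swap[of _ "{..<d}" "{..<k}"])
    also have "\<dots> = (\<Sum>\<kappa>\<in>I. \<Sum>i<k * d. \<Sum>j<k * d. X $$ (i, j) * w \<kappa> j * cnj (w \<kappa> i))"
      unfolding sum_pairs_lessThan
    proof (intro sum.cong refl)
      fix \<kappa> i b j b' assume "b \<in> {..<d}" "b' \<in> {..<d}"
      then have "w \<kappa> (j * d + b') = (\<Sum>m'<e. cnj (K \<kappa> m' b') * u (j * e + m'))"
        "cnj (w \<kappa> (i * d + b)) = (\<Sum>m<e. K \<kappa> m b * cnj (u (i * e + m)))"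
        unfolding w_def by simp_all
      then show "(\<Sum>m<e. \<Sum>m'<e. X $$ (i * d + b, j * d + b') *
         (cnj (K \<kappa> m' b') * u (j * e + m')) * (K \<kappa> m b * cnj (u (i * e + m)))) =
         X $$ (i * d + b, j * d + b') * w \<kappa> (j * d + b') * cnj (w \<kappa> (i * d + b))"
        by (simp only: sum_distrib_product)
    qed
    also have "\<dots> \<ge> 0"
      using X unfolding psd_iff by (intro sum_nonneg[of I]) blast
    finally show ?thesis .
  qed
  then show "psd (k * e) ?S" unfolding psd_iff by (simp add: super_tensor_def)
qed

lemma kraus_map_trace_preserving:
  assumes "finite I"
    and tp: "\<And>a b. a < d \<Longrightarrow> b < d \<Longrightarrow> (\<Sum>k\<in>I. \<Sum>i<e. cnj (K k i a) * K k i b) = (if a = b then 1 else 0)"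
  shows "trace_preserving d (kraus_map d e I K)"
  unfolding trace_preserving_def
proof
  fix X :: "complex mat" assume X: "X \<in> carrier_mat d d"
  have "mat_trace (kraus_map d e I K X) =
    (\<Sum>i<e. \<Sum>k\<in>I. \<Sum>a<d. \<Sum>b<d. X $$ (a, b) * (cnj (K k i b) * K k i a))"
    unfolding mat_trace_def kraus_map_def by (simp add: mult_ac)
  also have "\<dots> = (\<Sum>a<d. \<Sum>b<d. \<Sum>k\<in>I. \<Sum>i<e. X $$ (a, b) * (cnj (K k i b) * K k i a))"
    by (simp only: sum.swap[of _ I "{..<e}"] sum.swap[of _ "{..<d}" I] sum.swap[of _ "{..<d}" "{..<e}"])
  also have "\<dots> = (\<Sum>a<d. \<Sum>b<d. if b = a then X $$ (a, b) else 0)"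
    by (intro sum.cong refl) (auto simp: sum_distrib_left[symmetric] tp)
  also have "\<dots> = mat_trace X" using X unfolding mat_trace_def by simp
  finally show "mat_trace (kraus_map d e I K X) = mat_trace X" .
qed

lemma kraus_map_quantum_operation:
  assumes "finite I"
    and "\<And>a b. a < d \<Longrightarrow> b < d \<Longrightarrow> (\<Sum>k\<in>I. \<Sum>i<e. cnj (K k i a) * K k i b) = (if a = b then 1 else 0)"
  shows "quantum_operation d e (kraus_map d e I K)"
  unfolding quantum_operation_def
  using kraus_map_completely_positive kraus_map_trace_preserving assms by blast

text \<open>One Kraus operator per outcome; the sum of the branches is again in Kraus form, with the
  outcomes as Kraus index.\<close>

lemma kraus_instrument:
  assumes tp: "\<And>a b. a < d \<Longrightarrow> b < d \<Longrightarrow> (\<Sum>l<L. \<Sum>i<e. cnj (K l i a) * K l i b) = (if a = b then 1 else 0)"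
  shows "instrument d e L (\<lambda>l. kraus_map d e {l} K)"
proof -
  have "mat_sum e L (\<lambda>l. kraus_map d e {l} K X) = kraus_map d e {..<L} K X" for X
    unfolding mat_sum_def kraus_map_def by (intro cong_mat) auto
  moreover have "quantum_operation d e (kraus_map d e {..<L} K)"
    by (rule kraus_map_quantum_operation) (use tp in auto)
  ultimately show ?thesis unfolding instrument_def by (simp add: kraus_map_completely_positive)
qed

lemma sum_product_triple:
  fixes f :: "'a \<Rightarrow> 'd :: comm_semiring_0"
  shows "(\<Sum>s\<in>S. f s) * ((\<Sum>k\<in>I. g k) * (\<Sum>j\<in>J. h j)) = (\<Sum>k\<in>I. \<Sum>j\<in>J. \<Sum>s\<in>S. f s * (g k * h j))"
  by (simp only: sum_distrib_left[symmetric] sum_distrib_right[symmetric])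

lemma sum_product_double:
  fixes x :: "'d :: comm_semiring_0"
  shows "x * (\<Sum>a\<in>A. \<Sum>b\<in>B. g a b) * (\<Sum>a'\<in>A'. \<Sum>b'\<in>B'. h a' b') =
    (\<Sum>a\<in>A. \<Sum>b\<in>B. \<Sum>a'\<in>A'. \<Sum>b'\<in>B'. x * g a b * h a' b')"
  by (simp only: sum_distrib_left[symmetric] sum_distrib_right[symmetric])

text \<open>Each pair of local Kraus operators sends the vector \<open>\<psi> s\<close> to the
  unnormalized vector with amplitudes sum of K C psi, so a mixture of rank-one terms stays such a
  mixture.\<close>

lemma super_tensor_kraus_index:
  assumes mem: "m1 < e" "m2 < e'" "m1' < e" "m2' < e'"
    and X: "\<And>a a' b b'. a < d \<Longrightarrow> a' < d \<Longrightarrow> b < d' \<Longrightarrow> b' < d' \<Longrightarrow>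
       X $$ (a * d' + b, a' * d' + b') = (\<Sum>s\<in>S. complex_of_real (p s) * \<psi> s a b * cnj (\<psi> s a' b'))"
  shows "super_tensor d e d' e' (kraus_map d e I K) (kraus_map d' e' J C) X $$ (m1 * e' + m2, m1' * e' + m2') =
    (\<Sum>k\<in>I. \<Sum>j\<in>J. \<Sum>s\<in>S. complex_of_real (p s) *
      (\<Sum>a<d. \<Sum>b<d'. K k m1 a * C j m2 b * \<psi> s a b) * cnj (\<Sum>a<d. \<Sum>b<d'. K k m1' a * C j m2' b * \<psi> s a b))"
proof -
  let ?t = "\<lambda>k j s a a' b b'. complex_of_real (p s) * (K k m1 a * C j m2 b * \<psi> s a b) * cnj (K k m1' a' * C j m2' b' * \<psi> s a' b')"
  have "super_tensor d e d' e' (kraus_map d e I K) (kraus_map d' e' J C) X $$ (m1 * e' + m2, m1' * e' + m2') =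
    (\<Sum>a<d. \<Sum>a'<d. \<Sum>b<d'. \<Sum>b'<d'. X $$ (a * d' + b, a' * d' + b') *
      ((\<Sum>k\<in>I. K k m1 a * cnj (K k m1' a')) * (\<Sum>j\<in>J. C j m2 b * cnj (C j m2' b'))))"
  proof -
    have dims: "dim_row (kraus_map d' e' J C Y) = e'" "dim_col (kraus_map d' e' J C Y) = e'"
      "dim_row (kraus_map d e I K Y) = e" "dim_col (kraus_map d e I K Y) = e" for Y
      unfolding kraus_map_def by auto
    show ?thesis unfolding super_tensor_def using mem pair_index_less[of m1 e m2 e'] pair_index_less[of m1' e m2' e']
      by (auto simp: kron_def dims kraus_map_mat_unit intro!: sum.cong)
  qed
  also have "\<dots> = (\<Sum>a<d. \<Sum>a'<d. \<Sum>b<d'. \<Sum>b'<d'. \<Sum>k\<in>I. \<Sum>j\<in>J. \<Sum>s\<in>S. ?t k j s a a' b b')"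
  proof (intro sum.cong refl)
    fix a a' b b' assume "a \<in> {..<d}" "a' \<in> {..<d}" "b \<in> {..<d'}" "b' \<in> {..<d'}"
    then have *: "X $$ (a * d' + b, a' * d' + b') = (\<Sum>s\<in>S. complex_of_real (p s) * \<psi> s a b * cnj (\<psi> s a' b'))"
      by (intro X) auto
    show "X $$ (a * d' + b, a' * d' + b') *
      ((\<Sum>k\<in>I. K k m1 a * cnj (K k m1' a')) * (\<Sum>j\<in>J. C j m2 b * cnj (C j m2' b'))) =
      (\<Sum>k\<in>I. \<Sum>j\<in>J. \<Sum>s\<in>S. ?t k j s a a' b b')"
      unfolding * sum_product_triple by (simp add: mult_ac)
  qed
  also have "\<dots> = (\<Sum>k\<in>I. \<Sum>j\<in>J. \<Sum>s\<in>S. \<Sum>a<d. \<Sum>a'<d. \<Sum>b<d'. \<Sum>b'<d'. ?t k j s a a' b b')"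
    by (simp only: sum.swap[of _ I "{..<d'}"] sum.swap[of _ J "{..<d'}"] sum.swap[of _ S "{..<d'}"]
       sum.swap[of _ I "{..<d}"] sum.swap[of _ J "{..<d}"] sum.swap[of _ S "{..<d}"])
  also have "\<dots> = (\<Sum>k\<in>I. \<Sum>j\<in>J. \<Sum>s\<in>S. \<Sum>a<d. \<Sum>b<d'. \<Sum>a'<d. \<Sum>b'<d'. ?t k j s a a' b b')"
    by (simp only: sum.swap[of _ "{..<d}" "{..<d'}"])
  also have "\<dots> = (\<Sum>k\<in>I. \<Sum>j\<in>J. \<Sum>s\<in>S. complex_of_real (p s) *
      (\<Sum>a<d. \<Sum>b<d'. K k m1 a * C j m2 b * \<psi> s a b) * cnj (\<Sum>a<d. \<Sum>b<d'. K k m1' a * C j m2' b * \<psi> s a b))"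
    unfolding cnj_sum sum_product_double ..
  finally show ?thesis .
qed

text \<open>The maximally entangled vector keeps only equal outputs of Alice and Bob, each with
  amplitude 1 / sqrt M. The fidelity is therefore a sum of squared moduli, from which terms may be
  dropped in a lower bound once \<open>p\<close> is nonnegative.\<close>

lemma kraus_protocol_fidelity:
  assumes X: "\<And>a a' b b'. a < dA ^ n \<Longrightarrow> a' < dA ^ n \<Longrightarrow> b < dB ^ n \<Longrightarrow> b' < dB ^ n \<Longrightarrow>
       bipartite_power dA dB n \<rho> $$ (a * dB ^ n + b, a' * dB ^ n + b') =
         (\<Sum>s\<in>S. complex_of_real (p s) * \<psi> s a b * cnj (\<psi> s a' b'))"
  shows "fidelity (max_entangled M) (protocol_output dA dB n M L (\<lambda>l. kraus_map (dA ^ n) M {l} K)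
      (\<lambda>l. kraus_map (dB ^ n) M (J l) (C l)) \<rho>) =
    (\<Sum>l<L. \<Sum>j\<in>J l. \<Sum>s\<in>S. p s * (cmod (\<Sum>m<M. \<Sum>a<dA ^ n. \<Sum>b<dB ^ n. K l m a * C l j m b * \<psi> s a b))\<^sup>2) / M"
proof -
  let ?O = "protocol_output dA dB n M L (\<lambda>l. kraus_map (dA ^ n) M {l} K) (\<lambda>l. kraus_map (dB ^ n) M (J l) (C l)) \<rho>"
  let ?\<Phi> = "max_entangled M"
  define z where "z l j s m m' = (\<Sum>a<dA ^ n. \<Sum>b<dB ^ n. K l m a * C l j m' b * \<psi> s a b)" for l j s m m'
  define r where "r = complex_of_real (1 / sqrt (real M))"
  have rr: "r * r = complex_of_real (1 / M)" unfolding r_def of_real_mult[symmetric] by simp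
  have O: "?O $$ (m * M + m2, m' * M + m2') = (\<Sum>l<L. \<Sum>j\<in>J l. \<Sum>s\<in>S. complex_of_real (p s) * z l j s m m2 * cnj (z l j s m' m2'))"
    if "m < M" "m' < M" "m2 < M" "m2' < M" for m m' m2 m2'
  proof -
    have "?O $$ (m * M + m2, m' * M + m2') = (\<Sum>l<L. super_tensor (dA ^ n) M (dB ^ n) M (kraus_map (dA ^ n) M {l} K)
      (kraus_map (dB ^ n) M (J l) (C l)) (bipartite_power dA dB n \<rho>) $$ (m * M + m2, m' * M + m2'))"
      unfolding protocol_output_def mat_sum_def using that pair_index_less[of m M m2 M] pair_index_less[of m' M m2' M] by simp
    also have "\<dots> = (\<Sum>l<L. \<Sum>k\<in>{l}. \<Sum>j\<in>J l. \<Sum>s\<in>S. complex_of_real (p s) *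
      (\<Sum>a<dA ^ n. \<Sum>b<dB ^ n. K k m a * C l j m2 b * \<psi> s a b) *
      cnj (\<Sum>a<dA ^ n. \<Sum>b<dB ^ n. K k m' a * C l j m2' b * \<psi> s a b))"
      using that by (intro sum.cong refl super_tensor_kraus_index X) auto
    finally show ?thesis unfolding z_def by simp
  qed
  have \<Phi>: "?\<Phi> $ (m * M + m2) = (if m2 = m then r else 0)" if "m < M" "m2 < M" for m m2
    unfolding max_entangled_def r_def using that pair_index_less[of m M m2 M] by simp
  have "(?O *\<^sub>v ?\<Phi>) \<bullet>c ?\<Phi> = (\<Sum>m<M. \<Sum>m2<M. \<Sum>m'<M. \<Sum>m2'<M. ?O $$ (m * M + m2, m' * M + m2') *
     ?\<Phi> $ (m' * M + m2') * cnj (?\<Phi> $ (m * M + m2)))"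
  proof -
    have "?O \<in> carrier_mat (M * M) (M * M)" "?\<Phi> \<in> carrier_vec (M * M)"
      unfolding protocol_output_def mat_sum_def max_entangled_def by auto
    from quadratic_form_index[OF this] show ?thesis unfolding sum_pairs_lessThan .
  qed
  also have "\<dots> = (\<Sum>m<M. \<Sum>m2<M. \<Sum>m'<M. \<Sum>m2'<M. if m2' = m' then (if m2 = m then
     r * r * ?O $$ (m * M + m2, m' * M + m2') else 0) else 0)"
    by (intro sum.cong refl) (auto simp: \<Phi> r_def)
  also have "\<dots> = (\<Sum>m<M. \<Sum>m2<M. if m2 = m then (\<Sum>m'<M. r * r * ?O $$ (m * M + m2, m' * M + m')) else 0)"
    by (intro sum.cong refl) auto
  also have "\<dots> = (\<Sum>m<M. \<Sum>m'<M. r * r * ?O $$ (m * M + m, m' * M + m'))"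
    by simp
  also have "\<dots> = complex_of_real (1 / M) * (\<Sum>m<M. \<Sum>m'<M. \<Sum>l<L. \<Sum>j\<in>J l. \<Sum>s\<in>S. complex_of_real (p s) * z l j s m m * cnj (z l j s m' m'))"
    unfolding rr by (simp add: O sum_distrib_left)
  also have "\<dots> = complex_of_real (1 / M) * (\<Sum>l<L. \<Sum>j\<in>J l. \<Sum>s\<in>S. \<Sum>m<M. \<Sum>m'<M. complex_of_real (p s) * z l j s m m * cnj (z l j s m' m'))"
    by (simp only: sum.swap[of _ "{..<L}" "{..<M}"] sum.swap[of _ "J _" "{..<M}"] sum.swap[of _ S "{..<M}"])
  also have "\<dots> = complex_of_real (1 / M) * (\<Sum>l<L. \<Sum>j\<in>J l. \<Sum>s\<in>S. complex_of_real (p s) * ((\<Sum>m<M. z l j s m m) * cnj (\<Sum>m<M. z l j s m m)))"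
    unfolding cnj_sum sum_product unfolding sum_distrib_left mult.assoc ..
  also have "\<dots> = complex_of_real ((\<Sum>l<L. \<Sum>j\<in>J l. \<Sum>s\<in>S. p s * (cmod (\<Sum>m<M. z l j s m m))\<^sup>2) / M)"
    by (simp only: complex_norm_square[symmetric] of_real_mult[symmetric] of_real_sum[symmetric] of_real_power[symmetric]) simp
  finally show ?thesis unfolding fidelity_def z_def by simp
qed

section \<open>Random phases\<close>

text \<open>The family is the complete list of functions into the fourth roots of unity. Multiplying
  one coordinate by the imaginary unit permutes the list, so every monomial that picks up a
  nontrivial factor sums to zero. Signs alone would not do: the pairing i = k, j = h would survive
  as well.\<close>

lemma phase_family_exists:
  fixes n :: nat
  shows "\<exists>(L :: nat) v. L > 0 \<and>
    (\<forall>i<n. \<forall>j<n. (\<Sum>l<L. cnj (v l i) * v l j) = (if i = j then of_nat L else 0)) \<and>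
    (\<forall>i<n. \<forall>j<n. \<forall>k<n. \<forall>h<n. (\<Sum>l<L. v l i * cnj (v l j) * (v l k * cnj (v l h))) =
        (if i = j \<and> k = h \<or> i = h \<and> k = j then of_nat L else (0 :: complex)))"
proof -
  define \<Omega> where "\<Omega> = PiE {..<n} (\<lambda>_. {1, \<i>, -1, -\<i>})"
  have fin: "finite \<Omega>" unfolding \<Omega>_def by (intro finite_PiE) auto
  have ne: "\<Omega> \<noteq> {}" unfolding \<Omega>_def by (auto simp: PiE_eq_empty_iff)
  have unit: "\<omega> i * cnj (\<omega> i) = 1" if "\<omega> \<in> \<Omega>" "i < n" for \<omega> i
  proof -
    have "\<omega> i \<in> {1, \<i>, -1, -\<i>}" using that unfolding \<Omega>_def PiE_def Pi_def by blast
    then show ?thesis by auto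
  qed
  \<comment> \<open>The factor gained by coordinate \<open>x\<close> when coordinate
    \<open>a\<close> is multiplied by the imaginary unit.\<close>
  define ph where "ph a x = (if x = a then \<i> else 1)" for a x :: nat
  have vanish: "(\<Sum>\<omega>\<in>\<Omega>. \<omega> i * cnj (\<omega> j) * (\<omega> k * cnj (\<omega> h))) = 0"
    if a: "a < n" and c: "ph a i * cnj (ph a j) * (ph a k * cnj (ph a h)) \<noteq> 1" for a i j k h
  proof -
    let ?F = "\<lambda>\<omega> :: nat \<Rightarrow> complex. \<omega> i * cnj (\<omega> j) * (\<omega> k * cnj (\<omega> h))"
    have "(\<Sum>\<omega>\<in>\<Omega>. ?F (\<omega>(a := \<i> * \<omega> a))) = (\<Sum>\<omega>\<in>\<Omega>. ?F \<omega>)"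
      by (rule sum.reindex_bij_witness[of _ "\<lambda>\<omega>. \<omega>(a := - \<i> * \<omega> a)" "\<lambda>\<omega>. \<omega>(a := \<i> * \<omega> a)"])
        (use a in \<open>auto simp: \<Omega>_def PiE_iff extensional_def fun_upd_def fun_eq_iff mult.assoc[symmetric]\<close>)
    moreover have "?F (\<omega>(a := \<i> * \<omega> a)) = ph a i * cnj (ph a j) * (ph a k * cnj (ph a h)) * ?F \<omega>" for \<omega>
      unfolding ph_def by simp
    ultimately have "ph a i * cnj (ph a j) * (ph a k * cnj (ph a h)) * (\<Sum>\<omega>\<in>\<Omega>. ?F \<omega>) = (\<Sum>\<omega>\<in>\<Omega>. ?F \<omega>)"
      by (simp only: sum_distrib_left)
    then show ?thesis using c by simp
  qed
  have moment4: "(\<Sum>\<omega>\<in>\<Omega>. \<omega> i * cnj (\<omega> j) * (\<omega> k * cnj (\<omega> h))) =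
      (if i = j \<and> k = h \<or> i = h \<and> k = j then of_nat (card \<Omega>) else 0)"
    if "i < n" "j < n" "k < n" "h < n" for i j k h
  proof (cases "i = j \<and> k = h \<or> i = h \<and> k = j")
    case True
    have "(\<Sum>\<omega>\<in>\<Omega>. \<omega> i * cnj (\<omega> j) * (\<omega> k * cnj (\<omega> h))) = (\<Sum>\<omega>\<in>\<Omega>. 1)"
    proof (rule sum.cong[OF refl])
      fix \<omega> assume w: "\<omega> \<in> \<Omega>"
      have "\<omega> i * cnj (\<omega> j) * (\<omega> k * cnj (\<omega> h)) = (\<omega> i * cnj (\<omega> i)) * (\<omega> k * cnj (\<omega> k))"
        using True by auto
      then show "\<omega> i * cnj (\<omega> j) * (\<omega> k * cnj (\<omega> h)) = 1" using unit[OF w] that by simp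
    qed
    then show ?thesis using True by simp
  next
    case False
    \<comment> \<open>If \<open>i\<close> equals \<open>j\<close> or \<open>h\<close>, these two
      cancel and \<open>k\<close> differs from the remaining conjugated index, so rotating
      coordinate \<open>k\<close> gives a nontrivial factor. Otherwise \<open>i\<close> occurs only
      unconjugated, and rotating it gives the imaginary unit or its square -1.\<close>
    have "(\<Sum>\<omega>\<in>\<Omega>. \<omega> i * cnj (\<omega> j) * (\<omega> k * cnj (\<omega> h))) = 0"
    proof (cases "i = j \<or> i = h")
      case True
      then show ?thesis using False that by (intro vanish[of k]) (auto simp: ph_def)
    next
      case F: False
      then show ?thesis using that by (intro vanish[of i]) (auto simp: ph_def complex_eq_iff)
    qed
    then show ?thesis using False by (simp only: if_False)
  qed
  have moment2: "(\<Sum>\<omega>\<in>\<Omega>. cnj (\<omega> i) * \<omega> j) = (if i = j then of_nat (card \<Omega>) else 0)"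
    if "i < n" "j < n" for i j
  proof -
    have "(\<Sum>\<omega>\<in>\<Omega>. cnj (\<omega> i) * \<omega> j) = (\<Sum>\<omega>\<in>\<Omega>. \<omega> j * cnj (\<omega> i) * (\<omega> i * cnj (\<omega> i)))"
      using unit that by (intro sum.cong refl) simp
    then show ?thesis using moment4[of j i i i] that by simp
  qed
  obtain e where e: "bij_betw e {0..<card \<Omega>} \<Omega>" using ex_bij_betw_nat_finite[OF fin] by blast
  have re: "(\<Sum>l<card \<Omega>. f (e l)) = (\<Sum>\<omega>\<in>\<Omega>. f \<omega>)" for f :: "(nat \<Rightarrow> complex) \<Rightarrow> complex"
    using sum.reindex_bij_betw[OF e, of f] by (simp add: atLeast0LessThan)
  show ?thesis
  proof (intro exI[of _ "card \<Omega>"] exI[of _ e] conjI allI impI)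
    show "card \<Omega> > 0" using fin ne by (simp add: card_gt_0_iff)
    fix i j k h assume "i < n" "j < n" "k < n" "h < n"
    then show "(\<Sum>l<card \<Omega>. e l i * cnj (e l j) * (e l k * cnj (e l h))) =
        (if i = j \<and> k = h \<or> i = h \<and> k = j then of_nat (card \<Omega>) else 0)"
      using re[of "\<lambda>\<omega>. \<omega> i * cnj (\<omega> j) * (\<omega> k * cnj (\<omega> h))"] moment4 by (simp only:)
  next
    fix i j assume "i < n" "j < n"
    then show "(\<Sum>l<card \<Omega>. cnj (e l i) * e l j) = (if i = j then of_nat (card \<Omega>) else 0)"
      using re[of "\<lambda>\<omega>. cnj (\<omega> i) * \<omega> j"] moment2 by (simp only:)
  qed
qed

lemma pair_index_inj:
  assumes "x < D" "x' < D"
  shows "(m * D + x = m' * D + x') \<longleftrightarrow> (m :: nat) = m' \<and> x = x'"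
proof
  assume eq: "m * D + x = m' * D + x'"
  have "(m * D + x) div D = m" "(m' * D + x') div D = m'" "(m * D + x) mod D = x" "(m' * D + x') mod D = x'"
    using assms by auto
  then show "m = m' \<and> x = x'" using eq by metis
qed simp

lemma random_bilinear_first_moment:
  fixes v :: "nat \<Rightarrow> nat \<Rightarrow> complex" and D L M m :: nat
  assumes v: "\<And>i j. i < M * D \<Longrightarrow> j < M * D \<Longrightarrow> (\<Sum>l<L. cnj (v l i) * v l j) = (if i = j then of_nat L else 0)"
    and m: "m < M"
  shows "(\<Sum>l<L. \<Sum>x<D. \<Sum>x'<D. cnj (v l (m * D + x)) * v l (m * D + x') * A x x') = of_nat L * (\<Sum>x<D. A x x)"
proof -
  have "(\<Sum>l<L. \<Sum>x<D. \<Sum>x'<D. cnj (v l (m * D + x)) * v l (m * D + x') * A x x') =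
    (\<Sum>x<D. \<Sum>x'<D. \<Sum>l<L. cnj (v l (m * D + x)) * v l (m * D + x') * A x x')"
    by (simp only: sum.swap[of _ "{..<D}" "{..<L}"])
  also have "\<dots> = (\<Sum>x<D. \<Sum>x'<D. if x' = x then of_nat L * A x x' else 0)"
  proof (intro sum.cong refl)
    fix x x' assume "x \<in> {..<D}" "x' \<in> {..<D}"
    then have "(\<Sum>l<L. cnj (v l (m * D + x)) * v l (m * D + x')) = (if x' = x then of_nat L else 0)"
      using v[of "m * D + x" "m * D + x'"] pair_index_less[OF m] by auto
    then show "(\<Sum>l<L. cnj (v l (m * D + x)) * v l (m * D + x') * A x x') = (if x' = x then of_nat L * A x x' else 0)"
      by (simp add: sum_distrib_right[symmetric])
  qed
  finally show ?thesis by (simp add: sum_distrib_left)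
qed

lemma sum_product_sums:
  fixes g :: "'a \<Rightarrow> 'b \<Rightarrow> 'd :: comm_semiring_0"
  shows "(\<Sum>a\<in>A. \<Sum>b\<in>B. g a b) * (\<Sum>a'\<in>A'. \<Sum>b'\<in>B'. h a' b') =
    (\<Sum>a\<in>A. \<Sum>b\<in>B. \<Sum>a'\<in>A'. \<Sum>b'\<in>B'. g a b * h a' b')"
  by (simp only: sum_distrib_left[symmetric] sum_distrib_right[symmetric])

lemma sum_move_inside:
  fixes g :: "'l \<Rightarrow> 'a \<Rightarrow> 'b \<Rightarrow> 'c \<Rightarrow> 'e \<Rightarrow> 'd :: semiring_0"
  shows "(\<Sum>l\<in>L. \<Sum>i\<in>A. \<Sum>j\<in>B. \<Sum>k\<in>C. \<Sum>h\<in>E. g l i j k h * f i j k h) =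
   (\<Sum>i\<in>A. \<Sum>j\<in>B. \<Sum>k\<in>C. \<Sum>h\<in>E. (\<Sum>l\<in>L. g l i j k h) * f i j k h)"
  proof -
  have "(\<Sum>l\<in>L. \<Sum>i\<in>A. \<Sum>j\<in>B. \<Sum>k\<in>C. \<Sum>h\<in>E. g l i j k h * f i j k h) =
      (\<Sum>i\<in>A. \<Sum>l\<in>L. \<Sum>j\<in>B. \<Sum>k\<in>C. \<Sum>h\<in>E. g l i j k h * f i j k h)"
    by (rule sum.swap)
  also have "\<dots> = (\<Sum>i\<in>A. \<Sum>j\<in>B. \<Sum>l\<in>L. \<Sum>k\<in>C. \<Sum>h\<in>E. g l i j k h * f i j k h)"
    by (rule sum.cong[OF refl], rule sum.swap)
  also have "\<dots> = (\<Sum>i\<in>A. \<Sum>j\<in>B. \<Sum>k\<in>C. \<Sum>l\<in>L. \<Sum>h\<in>E. g l i j k h * f i j k h)"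
    by (rule sum.cong[OF refl], rule sum.cong[OF refl], rule sum.swap)
  also have "\<dots> = (\<Sum>i\<in>A. \<Sum>j\<in>B. \<Sum>k\<in>C. \<Sum>h\<in>E. \<Sum>l\<in>L. g l i j k h * f i j k h)"
    by (rule sum.cong[OF refl], rule sum.cong[OF refl], rule sum.cong[OF refl], rule sum.swap)
  finally show ?thesis unfolding sum_distrib_right .
qed

text \<open>Of the phase pairings, one contributes the Hilbert-Schmidt norm of \<open>A\<close>; the
  other needs both rows to agree and contributes the squared modulus of the trace. The overlap of
  the two pairings enters with a minus sign and is dropped, hence only an inequality.\<close>

lemma random_bilinear_second_moment:
  fixes v :: "nat \<Rightarrow> nat \<Rightarrow> complex" and D L M m m' :: nat
  assumes v: "\<And>i j k h. i < M * D \<Longrightarrow> j < M * D \<Longrightarrow> k < M * D \<Longrightarrow> h < M * D \<Longrightarrow>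
      (\<Sum>l<L. v l i * cnj (v l j) * (v l k * cnj (v l h))) =
        (if i = j \<and> k = h \<or> i = h \<and> k = j then of_nat L else 0)"
    and m: "m < M" "m' < M"
  shows "(\<Sum>l<L. (cmod (\<Sum>x<D. \<Sum>x'<D. cnj (v l (m * D + x)) * v l (m' * D + x') * A x x'))\<^sup>2) \<le>
    L * ((\<Sum>x<D. \<Sum>x'<D. (cmod (A x x'))\<^sup>2) + (if m = m' then (cmod (\<Sum>x<D. A x x))\<^sup>2 else 0))"
proof -
  have sq: "complex_of_real ((cmod z)\<^sup>2) = z * cnj z" for z by (rule complex_norm_square)
  let ?W = "\<lambda>l. \<Sum>x<D. \<Sum>x'<D. cnj (v l (m * D + x)) * v l (m' * D + x') * A x x'"
  define a where "a x x' z z' = A x x' * cnj (A z z')" for x x' z z'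
  define g where "g l x x' z z' =
    v l (m' * D + x') * cnj (v l (m * D + x)) * (v l (m * D + z) * cnj (v l (m' * D + z')))" for l x x' z z'
  have "complex_of_real (\<Sum>l<L. (cmod (?W l))\<^sup>2) = (\<Sum>l<L. \<Sum>x<D. \<Sum>x'<D. \<Sum>z<D. \<Sum>z'<D. g l x x' z z' * a x x' z z')"
    unfolding of_real_sum sq cnj_sum unfolding sum_product_sums g_def a_def by (simp add: mult_ac)
  also have "\<dots> = (\<Sum>x<D. \<Sum>x'<D. \<Sum>z<D. \<Sum>z'<D. (\<Sum>l<L. g l x x' z z') * a x x' z z')"
    by (rule sum_move_inside)
  \<comment> \<open>Inclusion and exclusion for the disjunction of the two pairings.\<close>
  also have "\<dots> = (\<Sum>x<D. \<Sum>x'<D. \<Sum>z<D. \<Sum>z'<D.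
      of_nat L * (if z' = x' then if z = x then a x x' z z' else 0 else 0)
    + (if m = m' then of_nat L * (if x' = x then if z' = z then a x x' z z' else 0 else 0) else 0)
    - (if m = m' then of_nat L * (if x' = x then if z' = z then if z = x then a x x' z z' else 0 else 0 else 0) else 0))"
  proof (intro sum.cong refl)
    fix x x' z z' assume "x \<in> {..<D}" "x' \<in> {..<D}" "z \<in> {..<D}" "z' \<in> {..<D}"
    then have x: "x < D" "x' < D" "z < D" "z' < D" by simp_all
    note less = pair_index_less[OF m(1) x(1)] pair_index_less[OF m(1) x(3)]
      pair_index_less[OF m(2) x(2)] pair_index_less[OF m(2) x(4)]
    have *: "(\<Sum>l<L. g l x x' z z') = (if (m' = m \<and> x' = x) \<and> m = m' \<and> z = z' \<or>
        (m' = m' \<and> x' = z') \<and> m = m \<and> z = x then of_nat L else 0)"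
      unfolding g_def v[OF less(3,1,2,4)] pair_index_inj[OF x(2,1)] pair_index_inj[OF x(3,4)]
        pair_index_inj[OF x(2,4)] pair_index_inj[OF x(3,1)] ..
    show "(\<Sum>l<L. g l x x' z z') * a x x' z z' =
       of_nat L * (if z' = x' then if z = x then a x x' z z' else 0 else 0)
    + (if m = m' then of_nat L * (if x' = x then if z' = z then a x x' z z' else 0 else 0) else 0)
    - (if m = m' then of_nat L * (if x' = x then if z' = z then if z = x then a x x' z z' else 0 else 0 else 0) else 0)"
      unfolding * by (cases "m = m'"; cases "x' = x"; cases "z' = z"; cases "z = x") simp_all
  qed
  also have "\<dots> = of_nat L * (\<Sum>x<D. \<Sum>x'<D. \<Sum>z<D. \<Sum>z'<D. if z' = x' then if z = x then a x x' z z' else 0 else 0)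
    + (if m = m' then of_nat L * (\<Sum>x<D. \<Sum>x'<D. \<Sum>z<D. \<Sum>z'<D. if x' = x then if z' = z then a x x' z z' else 0 else 0) else 0)
    - (if m = m' then of_nat L * (\<Sum>x<D. \<Sum>x'<D. \<Sum>z<D. \<Sum>z'<D. if x' = x then if z' = z then if z = x then a x x' z z' else 0 else 0 else 0) else 0)"
    by (cases "m = m'") (simp_all only: sum.distrib sum_subtractf sum_distrib_left simp_thms if_True if_False sum.neutral_const)
  also have "(\<Sum>x<D. \<Sum>x'<D. \<Sum>z<D. \<Sum>z'<D. if z' = x' then if z = x then a x x' z z' else 0 else 0) =
      complex_of_real (\<Sum>x<D. \<Sum>x'<D. (cmod (A x x'))\<^sup>2)"
    unfolding of_real_sum sq a_def by (intro sum.cong refl) simp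
  also have "(\<Sum>x<D. \<Sum>x'<D. \<Sum>z<D. \<Sum>z'<D. if x' = x then if z' = z then a x x' z z' else 0 else 0) =
      complex_of_real ((cmod (\<Sum>x<D. A x x))\<^sup>2)"
  proof -
    have "(\<Sum>x<D. \<Sum>x'<D. \<Sum>z<D. \<Sum>z'<D. if x' = x then if z' = z then a x x' z z' else 0 else 0) =
      (\<Sum>x<D. \<Sum>x'<D. if x' = x then \<Sum>z<D. a x x' z z else 0)"
      by (intro sum.cong refl) auto
    then show ?thesis unfolding sq cnj_sum sum_product a_def by simp
  qed
  also have "(\<Sum>x<D. \<Sum>x'<D. \<Sum>z<D. \<Sum>z'<D. if x' = x then if z' = z then if z = x then a x x' z z' else 0 else 0 else 0) =
      complex_of_real (\<Sum>x<D. (cmod (A x x))\<^sup>2)"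
  proof -
    have "(\<Sum>x<D. \<Sum>x'<D. \<Sum>z<D. \<Sum>z'<D. if x' = x then if z' = z then if z = x then a x x' z z' else 0 else 0 else 0) =
      (\<Sum>x<D. \<Sum>x'<D. if x' = x then a x x' x x else 0)"
      by (intro sum.cong refl) auto
    then show ?thesis unfolding of_real_sum sq a_def by simp
  qed
  finally have "complex_of_real (\<Sum>l<L. (cmod (?W l))\<^sup>2) = complex_of_real (L * (\<Sum>x<D. \<Sum>x'<D. (cmod (A x x'))\<^sup>2)
    + (if m = m' then L * (cmod (\<Sum>x<D. A x x))\<^sup>2 else 0) - (if m = m' then L * (\<Sum>x<D. (cmod (A x x))\<^sup>2) else 0))"
    by (simp split: if_splits)
  then have "(\<Sum>l<L. (cmod (?W l))\<^sup>2) = L * (\<Sum>x<D. \<Sum>x'<D. (cmod (A x x'))\<^sup>2)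
    + (if m = m' then L * (cmod (\<Sum>x<D. A x x))\<^sup>2 else 0) - (if m = m' then L * (\<Sum>x<D. (cmod (A x x))\<^sup>2) else 0)"
    by (simp only: of_real_eq_iff)
  also have "\<dots> \<le> L * ((\<Sum>x<D. \<Sum>x'<D. (cmod (A x x'))\<^sup>2) + (if m = m' then (cmod (\<Sum>x<D. A x x))\<^sup>2 else 0))"
    by (auto simp: distrib_left intro!: mult_nonneg_nonneg sum_nonneg)
  finally show ?thesis .
qed

section \<open>The decoder\<close>

lemma sum_rotate:
  "(\<Sum>i\<in>A. \<Sum>j\<in>B. \<Sum>k\<in>C. f i j k) = (\<Sum>k\<in>C. \<Sum>i\<in>A. \<Sum>j\<in>B. f i j k)"
proof -
  have "(\<Sum>i\<in>A. \<Sum>j\<in>B. \<Sum>k\<in>C. f i j k) = (\<Sum>i\<in>A. \<Sum>k\<in>C. \<Sum>j\<in>B. f i j k)"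
    by (rule sum.cong[OF refl], rule sum.swap)
  also have "\<dots> = (\<Sum>k\<in>C. \<Sum>i\<in>A. \<Sum>j\<in>B. f i j k)" by (rule sum.swap)
  finally show ?thesis .
qed

lemma kernel_diagonalization:
  assumes "\<And>i j. i < n \<Longrightarrow> j < n \<Longrightarrow> S j i = cnj (S i j)"
  shows "\<exists>V s. unitary_coeffs n V \<and>
    (\<forall>i<n. \<forall>j<n. S i j = (\<Sum>k<n. complex_of_real (s k) * V i k * cnj (V j k)))"
proof -
  let ?A = "mat n n (\<lambda>(i, j). S i j)"
  have "\<exists>U s. unitary n U \<and> ?A = U * real_diag n s * mat_adjoint U"
  proof (rule hermitian_diagonalization[OF mat_carrier])
    fix i j assume ij: "i < n" "j < n"
    then show "?A $$ (j, i) = cnj (?A $$ (i, j))"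
      using assms[OF ij] by (simp only: index_mat split)
  qed
  then obtain U s where U: "unitary n U" and A: "?A = U * real_diag n s * mat_adjoint U"
    by (elim exE conjE)
  have c: "U \<in> carrier_mat n n" using U unfolding unitary_def by simp
  have "S i j = (\<Sum>k<n. complex_of_real (s k) * U $$ (i, k) * cnj (U $$ (j, k)))" if "i < n" "j < n" for i j
  proof -
    have "S i j = ?A $$ (i, j)" using that by simp
    then show ?thesis unfolding A diagonalization_index[OF c that] .
  qed
  with unitary_imp_coeffs[OF U] show ?thesis
    by (intro exI[of _ "\<lambda>i j. U $$ (i, j)"] exI[of _ s] conjI allI impI)
qed

text \<open>Expand the squared norm of \<open>u\<close> minus the combination of the orthogonal
  vectors \<open>Z k\<close> with coefficients \<open>\<alpha> k\<close> times their inner products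
  with \<open>u\<close>. The free weights allow two uses: weight 1 with \<open>s\<close> = 1 is
  Bessel's inequality, and weight 2 / (1 + \<open>s\<close>) is the contraction property of the
  decoder.\<close>

lemma orthogonal_bessel:
  fixes Z :: "'b \<Rightarrow> 'k \<Rightarrow> complex"
  assumes fin: "finite K"
    and orth: "\<And>k k'. k \<in> K \<Longrightarrow> k' \<in> K \<Longrightarrow>
      (\<Sum>b\<in>B. cnj (Z b k) * Z b k') = (if k = k' then complex_of_real (s k) else 0)"
  shows "(\<Sum>k\<in>K. (2 * \<alpha> k - (\<alpha> k)\<^sup>2 * s k) * (cmod (\<Sum>b\<in>B. cnj (Z b k) * u b))\<^sup>2) \<le> (\<Sum>b\<in>B. (cmod (u b))\<^sup>2)"
proof -
  define c where "c k = (\<Sum>b\<in>B. cnj (Z b k) * u b)" for k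
  define a where "a k = complex_of_real (\<alpha> k) * c k" for k
  define w where "w b = (\<Sum>k\<in>K. a k * Z b k)" for b
  have sq: "complex_of_real ((cmod z)\<^sup>2) = z * cnj z" for z by (rule complex_norm_square)
  have uw: "(\<Sum>b\<in>B. cnj (w b) * u b) = (\<Sum>k\<in>K. complex_of_real (\<alpha> k * (cmod (c k))\<^sup>2))"
  proof -
    have "(\<Sum>b\<in>B. cnj (w b) * u b) = (\<Sum>k\<in>K. cnj (a k) * (\<Sum>b\<in>B. cnj (Z b k) * u b))"
      unfolding w_def cnj_sum sum_distrib_right sum_distrib_left by (subst sum.swap) (simp add: mult_ac)
    also have "\<dots> = (\<Sum>k\<in>K. complex_of_real (\<alpha> k * (cmod (c k))\<^sup>2))"
      unfolding c_def[symmetric] a_def of_real_mult sq by (intro sum.cong refl) (simp add: mult_ac)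
    finally show ?thesis .
  qed
  have ww: "(\<Sum>b\<in>B. cnj (w b) * w b) = (\<Sum>k\<in>K. complex_of_real ((\<alpha> k)\<^sup>2 * s k * (cmod (c k))\<^sup>2))"
  proof -
    have "(\<Sum>b\<in>B. cnj (w b) * w b) = (\<Sum>b\<in>B. \<Sum>k\<in>K. \<Sum>k'\<in>K. cnj (a k) * a k' * (cnj (Z b k) * Z b k'))"
      unfolding w_def cnj_sum sum_product by (simp add: mult_ac)
    also have "\<dots> = (\<Sum>k\<in>K. \<Sum>k'\<in>K. \<Sum>b\<in>B. cnj (a k) * a k' * (cnj (Z b k) * Z b k'))"
      by (subst sum.swap, rule sum.cong[OF refl], rule sum.swap)
    also have "\<dots> = (\<Sum>k\<in>K. \<Sum>k'\<in>K. if k' = k then cnj (a k) * a k' * complex_of_real (s k) else 0)"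
      by (intro sum.cong refl) (auto simp: sum_distrib_left[symmetric] orth)
    also have "\<dots> = (\<Sum>k\<in>K. complex_of_real ((\<alpha> k)\<^sup>2 * s k * (cmod (c k))\<^sup>2))"
      unfolding of_real_mult sq using fin by (intro sum.cong refl) (simp add: a_def power2_eq_square mult_ac)
    finally show ?thesis .
  qed
  have pt: "(cmod (u b - w b))\<^sup>2 = (cmod (u b))\<^sup>2 - 2 * Re (cnj (w b) * u b) + Re (cnj (w b) * w b)" for b
    unfolding cmod_power2 by (simp add: power2_eq_square algebra_simps)
  have "0 \<le> (\<Sum>b\<in>B. (cmod (u b - w b))\<^sup>2)" by (intro sum_nonneg) simp
  also have "\<dots> = (\<Sum>b\<in>B. (cmod (u b))\<^sup>2) - 2 * Re (\<Sum>b\<in>B. cnj (w b) * u b) + Re (\<Sum>b\<in>B. cnj (w b) * w b)"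
    unfolding pt by (simp add: sum.distrib sum_subtractf sum_distrib_left)
  also have "\<dots> = (\<Sum>b\<in>B. (cmod (u b))\<^sup>2) - (\<Sum>k\<in>K. (2 * \<alpha> k - (\<alpha> k)\<^sup>2 * s k) * (cmod (c k))\<^sup>2)"
    unfolding uw ww of_real_sum[symmetric] Re_complex_of_real
    by (simp add: sum_distrib_left sum_subtractf algebra_simps)
  finally show ?thesis unfolding c_def by simp
qed

lemma unitary_coeffs_parseval:
  assumes "unitary_coeffs n V"
  shows "(\<Sum>i<n. (cmod (\<Sum>k<n. V i k * t k))\<^sup>2) = (\<Sum>k<n. (cmod (t k))\<^sup>2)"
proof -
  have sq: "complex_of_real ((cmod z)\<^sup>2) = cnj z * z" for z unfolding complex_norm_square by (rule mult.commute)
  have "complex_of_real (\<Sum>i<n. (cmod (\<Sum>k<n. V i k * t k))\<^sup>2) =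
    (\<Sum>i<n. \<Sum>k<n. \<Sum>k'<n. cnj (t k) * t k' * (cnj (V i k) * V i k'))"
    unfolding of_real_sum sq cnj_sum sum_product by (simp add: mult_ac)
  also have "\<dots> = (\<Sum>k<n. \<Sum>k'<n. \<Sum>i<n. cnj (t k) * t k' * (cnj (V i k) * V i k'))"
    by (subst sum.swap, rule sum.cong[OF refl], rule sum.swap)
  also have "\<dots> = (\<Sum>k<n. \<Sum>k'<n. if k' = k then cnj (t k) * t k' else 0)"
    using assms unfolding unitary_coeffs_def
    by (intro sum.cong refl) (auto simp: sum_distrib_left[symmetric])
  also have "\<dots> = complex_of_real (\<Sum>k<n. (cmod (t k))\<^sup>2)"
    unfolding of_real_sum sq by simp
  finally show ?thesis unfolding of_real_eq_iff .
qed

lemma kernel_eigenvalue: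
  fixes S :: "nat \<Rightarrow> nat \<Rightarrow> complex"
  assumes V: "unitary_coeffs n V"
    and S: "\<And>i j. i < n \<Longrightarrow> j < n \<Longrightarrow> S i j = (\<Sum>k<n. complex_of_real (s k) * V i k * cnj (V j k))"
    and hk: "h < n" "h' < n"
  shows "(\<Sum>i<n. \<Sum>j<n. S i j * V j h' * cnj (V i h)) = (if h = h' then complex_of_real (s h) else 0)"
proof -
  have "(\<Sum>i<n. \<Sum>j<n. S i j * V j h' * cnj (V i h)) =
      (\<Sum>i<n. \<Sum>j<n. \<Sum>k<n. complex_of_real (s k) * (cnj (V i h) * V i k) * (cnj (V j k) * V j h'))"
    by (intro sum.cong refl) (simp add: S sum_distrib_right sum_distrib_left mult_ac)
  also have "\<dots> = (\<Sum>k<n. \<Sum>i<n. \<Sum>j<n. complex_of_real (s k) * (cnj (V i h) * V i k) * (cnj (V j k) * V j h'))"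
    by (rule sum_rotate)
  also have "\<dots> = (\<Sum>k<n. complex_of_real (s k) * (\<Sum>i<n. cnj (V i h) * V i k) * (\<Sum>j<n. cnj (V j k) * V j h'))"
    unfolding sum_distrib_left unfolding sum_distrib_right by (subst sum.swap) simp
  also have "\<dots> = (\<Sum>k<n. if k = h then (if h = h' then complex_of_real (s k) else 0) else 0)"
    using V hk unfolding unitary_coeffs_def by (intro sum.cong refl) auto
  finally show ?thesis using hk by simp
qed

text \<open>\<open>Q\<close> is diag(sqrt s) V^* for a spectral decomposition V diag(s) V^* of the
  kernel.\<close>

lemma psd_kernel_factorization:
  fixes S :: "nat \<Rightarrow> nat \<Rightarrow> complex"
  assumes herm: "\<And>i j. i < n \<Longrightarrow> j < n \<Longrightarrow> S j i = cnj (S i j)"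
    and pos: "\<And>u. 0 \<le> Re (\<Sum>i<n. \<Sum>j<n. S i j * u j * cnj (u i))"
  shows "\<exists>Q. \<forall>i<n. \<forall>j<n. S i j = (\<Sum>k<n. cnj (Q k i) * Q k j)"
proof -
  have "\<exists>V s. unitary_coeffs n V \<and>
    (\<forall>i<n. \<forall>j<n. S i j = (\<Sum>k<n. complex_of_real (s k) * V i k * cnj (V j k)))"
    by (rule kernel_diagonalization, rule herm)
  then obtain V s where V: "unitary_coeffs n V"
    and S: "\<And>i j. i < n \<Longrightarrow> j < n \<Longrightarrow> S i j = (\<Sum>k<n. complex_of_real (s k) * V i k * cnj (V j k))"
    by (elim exE conjE) simp
  have s: "s h \<ge> 0" if h: "h < n" for h
  proof -
    have "(\<Sum>i<n. \<Sum>j<n. S i j * V j h * cnj (V i h)) = complex_of_real (s h)"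
      using kernel_eigenvalue[OF V S h h] by simp
    then show ?thesis using pos[of "\<lambda>j. V j h"] by simp
  qed
  show ?thesis
  proof (intro exI[of _ "\<lambda>k i. complex_of_real (sqrt (s k)) * cnj (V i k)"] allI impI)
    fix i j assume ij: "i < n" "j < n"
    have "complex_of_real (s k) = complex_of_real (sqrt (s k)) * complex_of_real (sqrt (s k))" if "k < n" for k
      using s[OF that] unfolding of_real_mult[symmetric] by simp
    then show "S i j = (\<Sum>k<n. cnj (complex_of_real (sqrt (s k)) * cnj (V i k)) * (complex_of_real (sqrt (s k)) * cnj (V j k)))"
      unfolding S[OF ij] by (intro sum.cong refl) simp
  qed
qed

text \<open>The witness is 2 (1 + G)^(-1) Y^*, written in an eigenbasis of the Gram matrix
  \<open>G\<close>; no independence or normalization of the columns of \<open>Y\<close> is required.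
  The second clause later allows truncated vectors to be replaced by true ones, and the third
  compares the diagonal of 2 G (1 + G)^(-1) with that of (3 G - G^2) / 2.\<close>

lemma contraction_decoder:
  fixes Y :: "nat \<Rightarrow> nat \<Rightarrow> complex" and B N :: nat
  defines "G \<equiv> \<lambda>i j. \<Sum>b<B. cnj (Y b i) * Y b j"
  shows "\<exists>C. (\<forall>u. (\<Sum>i<N. (cmod (\<Sum>b<B. C i b * u b))\<^sup>2) \<le> (\<Sum>b<B. (cmod (u b))\<^sup>2)) \<and>
    (\<forall>i b. (\<forall>j<N. Y b j = 0) \<longrightarrow> C i b = 0) \<and>
    (\<forall>i<N. Re (\<Sum>b<B. C i b * Y b i) \<ge> (3 * Re (G i i) - (\<Sum>j<N. (cmod (G i j))\<^sup>2)) / 2)"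
proof -
  have herm: "G j i = cnj (G i j)" for i j unfolding G_def by (simp add: mult.commute)
  have "\<exists>V s. unitary_coeffs N V \<and>
    (\<forall>i<N. \<forall>j<N. G i j = (\<Sum>k<N. complex_of_real (s k) * V i k * cnj (V j k)))"
    by (rule kernel_diagonalization, rule herm)
  then obtain V s where V: "unitary_coeffs N V"
    and G: "\<And>i j. i < N \<Longrightarrow> j < N \<Longrightarrow> G i j = (\<Sum>k<N. complex_of_real (s k) * V i k * cnj (V j k))"
    by (elim exE conjE) simp
  note Vc = V[unfolded unitary_coeffs_def, THEN conjunct1, rule_format]
  note Vr = V[unfolded unitary_coeffs_def, THEN conjunct2, rule_format]
  \<comment> \<open>The columns of Y V are orthogonal, with the eigenvalues \<open>s\<close> of
    \<open>G\<close> as squared norms.\<close>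
  define Z where "Z b k = (\<Sum>i<N. Y b i * V i k)" for b k
  have YZ: "Y b i = (\<Sum>k<N. Z b k * cnj (V i k))" if i: "i < N" for b i
  proof -
    have "(\<Sum>k<N. Z b k * cnj (V i k)) = (\<Sum>j<N. \<Sum>k<N. Y b j * (V j k * cnj (V i k)))"
      unfolding Z_def sum_distrib_right by (subst sum.swap) (simp add: mult_ac)
    also have "\<dots> = (\<Sum>j<N. if j = i then Y b j else 0)"
      using Vr i by (intro sum.cong refl) (auto simp: sum_distrib_left[symmetric])
    finally show ?thesis using i by simp
  qed
  have ZY: "(\<Sum>b<B. cnj (Z b k) * Y b i) = complex_of_real (s k) * cnj (V i k)" if k: "k < N" and i: "i < N" for k i
  proof -
    have "(\<Sum>b<B. cnj (Z b k) * Y b i) = (\<Sum>j<N. cnj (V j k) * G j i)"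
      unfolding Z_def G_def cnj_sum sum_distrib_right sum_distrib_left by (subst sum.swap) (simp add: mult_ac)
    also have "\<dots> = (\<Sum>j<N. \<Sum>k'<N. complex_of_real (s k') * cnj (V i k') * (cnj (V j k) * V j k'))"
      using i by (intro sum.cong refl) (simp add: G sum_distrib_left mult_ac)
    also have "\<dots> = (\<Sum>k'<N. \<Sum>j<N. complex_of_real (s k') * cnj (V i k') * (cnj (V j k) * V j k'))"
      by (rule sum.swap)
    also have "\<dots> = (\<Sum>k'<N. if k' = k then complex_of_real (s k') * cnj (V i k') else 0)"
      using Vc k by (intro sum.cong refl) (auto simp: sum_distrib_left[symmetric])
    finally show ?thesis using k by simp
  qed
  have ZZ: "(\<Sum>b<B. cnj (Z b k) * Z b k') = (if k = k' then complex_of_real (s k) else 0)"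
    if k: "k < N" "k' < N" for k k'
  proof -
    have "(\<Sum>b<B. cnj (Z b k) * Z b k') = (\<Sum>i<N. (\<Sum>b<B. cnj (Z b k) * Y b i) * V i k')"
      unfolding Z_def[of _ k'] sum_distrib_right sum_distrib_left by (subst sum.swap) (simp add: mult_ac)
    also have "\<dots> = complex_of_real (s k) * (\<Sum>i<N. cnj (V i k) * V i k')"
      using k unfolding sum_distrib_left by (intro sum.cong refl) (simp add: ZY mult.assoc)
    finally show ?thesis using Vc[of k k'] k by simp
  qed
  have s0: "s k \<ge> 0" if k: "k < N" for k
  proof -
    have "complex_of_real (s k) = (\<Sum>b<B. complex_of_real ((cmod (Z b k))\<^sup>2))"
      unfolding complex_norm_square using ZZ[OF k k] by (simp add: mult.commute)
    then have "s k = (\<Sum>b<B. (cmod (Z b k))\<^sup>2)" unfolding of_real_sum[symmetric] of_real_eq_iff .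
    then show ?thesis by (simp add: sum_nonneg)
  qed
  \<comment> \<open>Since alpha (1 + s) = 2, the weight 2 alpha - alpha^2 s in
    \<open>orthogonal_bessel\<close> is exactly alpha^2.\<close>
  define \<alpha> where "\<alpha> k = 2 / (1 + s k)" for k
  define C where "C i b = (\<Sum>k<N. V i k * (complex_of_real (\<alpha> k) * cnj (Z b k)))" for i b
  show ?thesis
  proof (intro exI[of _ C] conjI allI impI)
    fix u :: "nat \<Rightarrow> complex"
    have "(\<Sum>b<B. C i b * u b) = (\<Sum>k<N. V i k * (complex_of_real (\<alpha> k) * (\<Sum>b<B. cnj (Z b k) * u b)))" for i
      unfolding C_def sum_distrib_right sum_distrib_left by (subst sum.swap) (simp add: mult_ac)
    then have "(\<Sum>i<N. (cmod (\<Sum>b<B. C i b * u b))\<^sup>2) =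
      (\<Sum>k<N. (cmod (complex_of_real (\<alpha> k) * (\<Sum>b<B. cnj (Z b k) * u b)))\<^sup>2)"
      using unitary_coeffs_parseval[OF V] by simp
    also have "\<dots> = (\<Sum>k<N. (2 * \<alpha> k - (\<alpha> k)\<^sup>2 * s k) * (cmod (\<Sum>b<B. cnj (Z b k) * u b))\<^sup>2)"
    proof (intro sum.cong refl)
      fix k assume "k \<in> {..<N}"
      then have "1 + s k \<noteq> 0" using s0[of k] by simp
      then have "\<alpha> k * (1 + s k) = 2" by (rule iffD1[OF nonzero_eq_divide_eq]) (rule \<alpha>_def)
      then have "2 * \<alpha> k - (\<alpha> k)\<^sup>2 * s k = \<alpha> k * (1 + s k) * \<alpha> k - (\<alpha> k)\<^sup>2 * s k" by simp
      also have "\<dots> = (\<alpha> k)\<^sup>2" by (simp add: power2_eq_square algebra_simps)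
      finally have "2 * \<alpha> k - (\<alpha> k)\<^sup>2 * s k = (\<alpha> k)\<^sup>2" .
      then show "(cmod (complex_of_real (\<alpha> k) * (\<Sum>b<B. cnj (Z b k) * u b)))\<^sup>2 =
        (2 * \<alpha> k - (\<alpha> k)\<^sup>2 * s k) * (cmod (\<Sum>b<B. cnj (Z b k) * u b))\<^sup>2"
        by (simp add: norm_mult power_mult_distrib)
    qed
    also have "\<dots> \<le> (\<Sum>b<B. (cmod (u b))\<^sup>2)"
      by (rule orthogonal_bessel) (use ZZ in auto)
    finally show "(\<Sum>i<N. (cmod (\<Sum>b<B. C i b * u b))\<^sup>2) \<le> (\<Sum>b<B. (cmod (u b))\<^sup>2)" .
  next
    fix i b assume "\<forall>j<N. Y b j = 0"
    then show "C i b = 0" unfolding C_def Z_def by simp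
  next
    fix i assume i: "i < N"
    have sq: "complex_of_real ((cmod z)\<^sup>2) = z * cnj z" for z by (rule complex_norm_square)
    have "(\<Sum>b<B. C i b * Y b i) = (\<Sum>k<N. complex_of_real (\<alpha> k) * V i k * (\<Sum>b<B. cnj (Z b k) * Y b i))"
      unfolding C_def sum_distrib_right sum_distrib_left by (subst sum.swap) (simp add: mult_ac)
    also have "\<dots> = complex_of_real (\<Sum>k<N. \<alpha> k * s k * (cmod (V i k))\<^sup>2)"
      unfolding of_real_sum of_real_mult sq using i by (intro sum.cong refl) (simp add: ZY mult.assoc mult.left_commute)
    finally have CY: "Re (\<Sum>b<B. C i b * Y b i) = (\<Sum>k<N. \<alpha> k * s k * (cmod (V i k))\<^sup>2)" by simp
    have "G i i = complex_of_real (\<Sum>k<N. s k * (cmod (V i k))\<^sup>2)"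
      unfolding of_real_sum of_real_mult sq using G[OF i i] by (simp add: mult_ac)
    then have Gii: "Re (G i i) = (\<Sum>k<N. s k * (cmod (V i k))\<^sup>2)" by simp
    have "(\<Sum>j<N. (cmod (G i j))\<^sup>2) = (\<Sum>j<N. (cmod (\<Sum>k<N. V j k * (complex_of_real (s k) * cnj (V i k))))\<^sup>2)"
    proof (intro sum.cong refl)
      fix j assume "j \<in> {..<N}"
      then have "cnj (G i j) = (\<Sum>k<N. V j k * (complex_of_real (s k) * cnj (V i k)))"
        unfolding G[OF i] by (simp add: mult_ac G i)
      then show "(cmod (G i j))\<^sup>2 = (cmod (\<Sum>k<N. V j k * (complex_of_real (s k) * cnj (V i k))))\<^sup>2"
        by (metis complex_mod_cnj)
    qed
    also have "\<dots> = (\<Sum>k<N. (s k)\<^sup>2 * (cmod (V i k))\<^sup>2)"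
      unfolding unitary_coeffs_parseval[OF V] by (simp add: norm_mult power_mult_distrib)
    finally have GG: "(\<Sum>j<N. (cmod (G i j))\<^sup>2) = (\<Sum>k<N. (s k)\<^sup>2 * (cmod (V i k))\<^sup>2)" .
    have "(3 * Re (G i i) - (\<Sum>j<N. (cmod (G i j))\<^sup>2)) / 2 = (\<Sum>k<N. (3 * s k - (s k)\<^sup>2) / 2 * (cmod (V i k))\<^sup>2)"
      unfolding Gii GG by (simp add: sum_distrib_left sum_subtractf[symmetric] sum_divide_distrib algebra_simps diff_divide_distrib)
    also have "\<dots> \<le> (\<Sum>k<N. \<alpha> k * s k * (cmod (V i k))\<^sup>2)"
    proof (intro sum_mono mult_right_mono)
      fix k assume "k \<in> {..<N}"
      then have s: "s k \<ge> 0" using s0 by simp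
      \<comment> \<open>The double zero at s = 1 reflects the tangency of the quadratic bound at the
        ideal eigenvalue 1.\<close>
      have "\<alpha> k * s k - (3 * s k - (s k)\<^sup>2) / 2 = s k * (s k - 1)\<^sup>2 / (2 * (1 + s k))"
        using s unfolding \<alpha>_def by (simp add: field_simps power2_eq_square)
      also have "\<dots> \<ge> 0" using s by simp
      finally show "(3 * s k - (s k)\<^sup>2) / 2 \<le> \<alpha> k * s k" by simp
    qed simp
    finally show "Re (\<Sum>b<B. C i b * Y b i) \<ge> (3 * Re (G i i) - (\<Sum>j<N. (cmod (G i j))\<^sup>2)) / 2"
      unfolding CY .
  qed
qed

text \<open>The form of 1 - C^* C is nonnegative for a contraction; a factorization Q^* Q of it
  completes \<open>C\<close> to an isometry.\<close>

lemma contraction_complement: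
  fixes C :: "nat \<Rightarrow> nat \<Rightarrow> complex" and B N :: nat
  assumes "\<And>u. (\<Sum>i<N. (cmod (\<Sum>b<B. C i b * u b))\<^sup>2) \<le> (\<Sum>b<B. (cmod (u b))\<^sup>2)"
  shows "\<exists>Q. \<forall>b<B. \<forall>b'<B.
    (\<Sum>i<N. cnj (C i b) * C i b') + (\<Sum>k<B. cnj (Q k b) * Q k b') = (if b = b' then 1 else 0)"
proof -
  define S where "S b b' = (if b = b' then 1 else 0) - (\<Sum>i<N. cnj (C i b) * C i b')" for b b'
  have herm: "S j i = cnj (S i j)" for i j unfolding S_def by (simp add: mult.commute)
  have pos: "0 \<le> Re (\<Sum>b<B. \<Sum>b'<B. S b b' * u b' * cnj (u b))" for u
  proof -
    have sq: "complex_of_real ((cmod z)\<^sup>2) = cnj z * z" for z unfolding complex_norm_square by (rule mult.commute)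
    have "(\<Sum>b<B. \<Sum>b'<B. S b b' * u b' * cnj (u b)) =
      (\<Sum>b<B. \<Sum>b'<B. (if b' = b then u b' * cnj (u b) else 0)) -
      (\<Sum>b<B. \<Sum>b'<B. \<Sum>i<N. cnj (C i b * u b) * (C i b' * u b'))"
      unfolding S_def sum_subtractf[symmetric]
      by (intro sum.cong refl) (auto simp: algebra_simps sum_distrib_left sum_distrib_right)
    also have "(\<Sum>b<B. \<Sum>b'<B. \<Sum>i<N. cnj (C i b * u b) * (C i b' * u b')) =
      (\<Sum>i<N. \<Sum>b<B. \<Sum>b'<B. cnj (C i b * u b) * (C i b' * u b'))"
      by (rule sum_rotate)
    also have "\<dots> = complex_of_real (\<Sum>i<N. (cmod (\<Sum>b<B. C i b * u b))\<^sup>2)"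
      unfolding of_real_sum sq cnj_sum sum_product ..
    also have "(\<Sum>b<B. \<Sum>b'<B. (if b' = b then u b' * cnj (u b) else 0)) = complex_of_real (\<Sum>b<B. (cmod (u b))\<^sup>2)"
      unfolding of_real_sum sq by (simp add: mult.commute)
    finally show ?thesis using assms[of u] by simp
  qed
  have "\<exists>Q. \<forall>i<B. \<forall>j<B. S i j = (\<Sum>k<B. cnj (Q k i) * Q k j)"
    by (rule psd_kernel_factorization, rule herm, rule pos)
  then obtain Q where Q: "\<And>i j. i < B \<Longrightarrow> j < B \<Longrightarrow> S i j = (\<Sum>k<B. cnj (Q k i) * Q k j)"
    by (elim exE) simp
  show ?thesis
  proof (intro exI[of _ Q] allI impI)
    fix b b' assume "b < B" "b' < B"
    from Q[OF this] show "(\<Sum>i<N. cnj (C i b) * C i b') + (\<Sum>k<B. cnj (Q k b) * Q k b') = (if b = b' then 1 else 0)"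
      unfolding S_def by (simp add: diff_eq_eq add.commute)
  qed
qed

lemma sum_lessThan_add:
  fixes f :: "nat \<Rightarrow> 'a :: comm_monoid_add"
  shows "(\<Sum>k<a + b. f k) = (\<Sum>k<a. f k) + (\<Sum>k<b. f (a + k))"
  by (induction b) (simp_all add: add.assoc)

text \<open>Turns the contraction into a channel for Bob. Its row index m * F + f is the pair of the
  kept output \<open>m\<close> and the discarded label \<open>f\<close>, so \<open>f\<close> becomes
  a Kraus index. \<open>D\<close> acts on coordinates in the basis \<open>\<beta>\<close>,
  \<open>C\<close> on the standard ones; \<open>D\<close> stays in the conclusion because the
  fidelity estimate is made in the basis \<open>\<beta>\<close>.\<close>

lemma decoder_channel:
  fixes Y :: "nat \<Rightarrow> nat \<Rightarrow> complex" and B M F :: nat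
  defines "G \<equiv> \<lambda>i j. \<Sum>b<B. cnj (Y b i) * Y b j"
  assumes \<beta>: "unitary_coeffs B \<beta>" and M: "M > 0"
  shows "\<exists>C D.
    (\<forall>y<B. \<forall>y'<B. (\<Sum>k<F + B. \<Sum>m<M. cnj (C k m y) * C k m y') = (if y = y' then 1 else 0)) \<and>
    (\<forall>f<F. \<forall>m<M. \<forall>y. C f m y = (\<Sum>b<B. D (m * F + f) b * cnj (\<beta> y b))) \<and>
    (\<forall>i b. (\<forall>j<M * F. Y b j = 0) \<longrightarrow> D i b = 0) \<and>
    (\<forall>i<M * F. Re (\<Sum>b<B. D i b * Y b i) \<ge> (3 * Re (G i i) - (\<Sum>j<M * F. (cmod (G i j))\<^sup>2)) / 2)"
proof -
  obtain D where D: "\<forall>u. (\<Sum>i<M * F. (cmod (\<Sum>b<B. D i b * u b))\<^sup>2) \<le> (\<Sum>b<B. (cmod (u b))\<^sup>2)"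
    and D0: "\<forall>i b. (\<forall>j<M * F. Y b j = 0) \<longrightarrow> D i b = 0"
    and Dd: "\<forall>i<M * F. Re (\<Sum>b<B. D i b * Y b i) \<ge> (3 * Re (G i i) - (\<Sum>j<M * F. (cmod (G i j))\<^sup>2)) / 2"
    using contraction_decoder[where B = B and Y = Y and N = "M * F"] unfolding G_def
    by (elim exE conjE)
  have "\<exists>Q. \<forall>b<B. \<forall>b'<B.
    (\<Sum>i<M * F. cnj (D i b) * D i b') + (\<Sum>k<B. cnj (Q k b) * Q k b') = (if b = b' then 1 else 0)"
    by (rule contraction_complement, rule D[rule_format])
  then obtain Q where Q: "\<forall>b<B. \<forall>b'<B.
    (\<Sum>i<M * F. cnj (D i b) * D i b') + (\<Sum>k<B. cnj (Q k b) * Q k b') = (if b = b' then 1 else 0)"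
    by (elim exE)
  \<comment> \<open>Kraus indices below \<open>F\<close> are the discarded labels. The remaining
    \<open>B\<close> operators complete the map to a trace-preserving one and send everything to the
    output 0, which exists because \<open>M\<close> is positive.\<close>
  define E where "E k m b = (if k < F then D (m * F + k) b else if m = 0 then Q (k - F) b else 0)" for k m b
  define C where "C k m y = (\<Sum>b<B. E k m b * cnj (\<beta> y b))" for k m y
  have E: "(\<Sum>k<F + B. \<Sum>m<M. cnj (E k m b) * E k m b') = (if b = b' then 1 else 0)" if "b < B" "b' < B" for b b'
  proof -
    have "(\<Sum>k<F + B. \<Sum>m<M. cnj (E k m b) * E k m b') =
      (\<Sum>k<F. \<Sum>m<M. cnj (E k m b) * E k m b') + (\<Sum>k<B. \<Sum>m<M. cnj (E (F + k) m b) * E (F + k) m b')"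
      by (rule sum_lessThan_add)
    also have "(\<Sum>k<F. \<Sum>m<M. cnj (E k m b) * E k m b') = (\<Sum>i<M * F. cnj (D i b) * D i b')"
      unfolding sum_pairs_lessThan E_def by (subst sum.swap) simp
    also have "(\<Sum>k<B. \<Sum>m<M. cnj (E (F + k) m b) * E (F + k) m b') = (\<Sum>k<B. cnj (Q k b) * Q k b')"
    proof (rule sum.cong[OF refl])
      fix k
      have "(\<Sum>m<M. cnj (E (F + k) m b) * E (F + k) m b') = (\<Sum>m<M. if m = 0 then cnj (Q k b) * Q k b' else 0)"
        by (intro sum.cong refl) (auto simp: E_def)
      then show "(\<Sum>m<M. cnj (E (F + k) m b) * E (F + k) m b') = cnj (Q k b) * Q k b'" using M by simp
    qed
    finally show ?thesis using Q[rule_format, OF that] by simp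
  qed
  have "(\<Sum>k<F + B. \<Sum>m<M. cnj (C k m y) * C k m y') = (if y = y' then 1 else 0)" if y: "y < B" "y' < B" for y y'
  proof -
    have "(\<Sum>k<F + B. \<Sum>m<M. cnj (C k m y) * C k m y') =
      (\<Sum>k<F + B. \<Sum>m<M. \<Sum>b<B. \<Sum>b'<B. \<beta> y b * cnj (\<beta> y' b') * (cnj (E k m b) * E k m b'))"
      unfolding C_def cnj_sum sum_product by (simp add: mult_ac)
    also have "\<dots> = (\<Sum>b<B. \<Sum>b'<B. \<Sum>k<F + B. \<Sum>m<M. \<beta> y b * cnj (\<beta> y' b') * (cnj (E k m b) * E k m b'))"
      by (simp only: sum.swap[of _ "{..<B}" "{..<M}"] sum.swap[of _ "{..<B}" "{..<F + B}"])
    also have "\<dots> = (\<Sum>b<B. \<Sum>b'<B. if b' = b then \<beta> y b * cnj (\<beta> y' b') else 0)"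
      by (intro sum.cong refl) (auto simp: sum_distrib_left[symmetric] E)
    also have "\<dots> = (\<Sum>b<B. \<beta> y b * cnj (\<beta> y' b))" by simp
    finally show ?thesis using \<beta> y unfolding unitary_coeffs_def by simp
  qed
  moreover have "C f m y = (\<Sum>b<B. D (m * F + f) b * cnj (\<beta> y b))" if "f < F" for f m y
    unfolding C_def E_def using that by simp
  ultimately show ?thesis using D0 Dd by (intro exI[of _ C] exI[of _ D] conjI allI impI) simp_all
qed

section \<open>One-shot bound\<close>

text \<open>\<open>c s\<close> is the vector \<open>\<psi> s\<close> with Bob's part in the basis
  \<open>\<beta>\<close>, cut down to \<open>TE\<close> and \<open>TB\<close>. The assumption
  \<open>weight\<close> makes the Gram matrix diagonal nearly 1 on average, \<open>bessel\<close>
  bounds the trace part of its second moment, and \<open>overlap\<close> measures collisions of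
  Bob's vectors, which each of the \<open>M\<close> rows can cause.\<close>

lemma one_shot_protocol:
  fixes dA dB n M F :: nat and \<rho> :: "complex mat" and \<psi> :: "nat \<Rightarrow> nat \<Rightarrow> nat \<Rightarrow> complex"
    and \<beta> :: "nat \<Rightarrow> nat \<Rightarrow> complex" and p :: "nat \<Rightarrow> real" and TE TB :: "nat set" and \<epsilon> \<eta> :: real
  defines "c \<equiv> \<lambda>s a b. if s \<in> TE \<and> b \<in> TB then \<Sum>y<dB ^ n. cnj (\<beta> y b) * \<psi> s a y else 0"
  assumes M: "M > 0"
    and X: "\<And>a a' b b'. a < dA ^ n \<Longrightarrow> a' < dA ^ n \<Longrightarrow> b < dB ^ n \<Longrightarrow> b' < dB ^ n \<Longrightarrow>
       bipartite_power dA dB n \<rho> $$ (a * dB ^ n + b, a' * dB ^ n + b') =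
         (\<Sum>s<F. complex_of_real (p s) * \<psi> s a b * cnj (\<psi> s a' b'))"
    and \<beta>: "unitary_coeffs (dB ^ n) \<beta>"
    and p0: "\<And>s. s < F \<Longrightarrow> p s \<ge> 0" and p1: "(\<Sum>s<F. p s) = 1"
    and weight: "(\<Sum>s<F. p s * (\<Sum>a<dA ^ n. \<Sum>b<dB ^ n. (cmod (c s a b))\<^sup>2)) \<ge> 1 - \<epsilon>"
    and bessel: "\<And>s. s < F \<Longrightarrow> (\<Sum>s'<F. (cmod (\<Sum>a<dA ^ n. \<Sum>b<dB ^ n. cnj (c s a b) * c s' a b))\<^sup>2) \<le> 1"
    and overlap: "(\<Sum>s<F. p s * (\<Sum>s'<F. \<Sum>x<dA ^ n. \<Sum>x'<dA ^ n.
        (cmod (\<Sum>b<dB ^ n. cnj (c s x b) * c s' x' b))\<^sup>2)) \<le> \<eta>"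
  shows "\<exists>L T R. one_way_protocol dA dB \<rho> n (3 * \<epsilon> + M * \<eta>) M L T R"
proof -
  define D where "D = dA ^ n"
  define B where "B = dB ^ n"
  note DB = D_def[symmetric] B_def[symmetric]
  note X = X[unfolded DB] and \<beta> = \<beta>[unfolded DB] and weight = weight[unfolded DB]
    and bessel = bessel[unfolded DB] and overlap = overlap[unfolded DB]
  obtain L :: nat and v where L: "L > 0"
    and v2: "\<forall>i<M * D. \<forall>j<M * D. (\<Sum>l<L. cnj (v l i) * v l j) = (if i = j then of_nat L else 0)"
    and v4: "\<forall>i<M * D. \<forall>j<M * D. \<forall>k<M * D. \<forall>h<M * D.
      (\<Sum>l<L. v l i * cnj (v l j) * (v l k * cnj (v l h))) =
        (if i = j \<and> k = h \<or> i = h \<and> k = j then of_nat L else (0 :: complex))"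
    using phase_family_exists[of "M * D"] by (elim exE conjE)
  \<comment> \<open>Alice's factor 1 / sqrt (M L) is left out: the average of the squared norm over
    \<open>l\<close> is then that of \<open>c s\<close>, ideally 1, the scale at which the decoder
    works. The factor returns in \<open>zq\<close>.\<close>
  define Y where "Y l b i = (\<Sum>x<D. v l (i div F * D + x) * c (i mod F) x b)" for l b i
  define G where "G l i j = (\<Sum>b<B. cnj (Y l b i) * Y l b j)" for l i j
  \<comment> \<open>The guarantees of \<open>decoder_channel\<close> for outcome \<open>l\<close>,
    named so that decoders can be chosen as functions of \<open>l\<close>.\<close>
  define P where "P l C E \<longleftrightarrow>
    (\<forall>y<B. \<forall>y'<B. (\<Sum>k<F + B. \<Sum>m<M. cnj (C k m y) * C k m y') = (if y = y' then 1 else 0)) \<and>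
    (\<forall>f<F. \<forall>m<M. \<forall>y. C f m y = (\<Sum>b<B. E (m * F + f) b * cnj (\<beta> y b))) \<and>
    (\<forall>i b. (\<forall>j<M * F. Y l b j = 0) \<longrightarrow> E i b = 0) \<and>
    (\<forall>i<M * F. Re (\<Sum>b<B. E i b * Y l b i) \<ge> (3 * Re (G l i i) - (\<Sum>j<M * F. (cmod (G l i j))\<^sup>2)) / 2)"
    for l and C :: "nat \<Rightarrow> nat \<Rightarrow> nat \<Rightarrow> complex" and E :: "nat \<Rightarrow> nat \<Rightarrow> complex"
  have "\<forall>l. \<exists>C E. P l C E"
    unfolding P_def G_def using decoder_channel[OF \<beta> M] by (intro allI)
  then obtain C where "\<forall>l. \<exists>E. P l (C l) E" using choice[of "\<lambda>l C. \<exists>E. P l C E"] by blast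
  then obtain E where P: "P l (C l) (E l)" for l using choice[of "\<lambda>l E. P l (C l) E"] by blast
  \<comment> \<open>For each input the squared entries are summed over \<open>M\<close> rows and
    \<open>L\<close> outcomes; this fixes the normalization.\<close>
  define K where "K l m a = complex_of_real (1 / sqrt (M * L)) * v l (m * D + a)" for l m a
  have KK: "complex_of_real (1 / sqrt (M * L)) * complex_of_real (1 / sqrt (M * L)) = complex_of_real (1 / (M * L))"
    unfolding of_real_mult[symmetric] using M L by (simp add: real_sqrt_mult[symmetric])
  have Ktp: "(\<Sum>l<L. \<Sum>i<M. cnj (K l i a) * K l i b) = (if a = b then 1 else 0)" if ab: "a < D" "b < D" for a b
  proof -
    have "(\<Sum>l<L. \<Sum>i<M. cnj (K l i a) * K l i b) =
      (\<Sum>l<L. \<Sum>i<M. complex_of_real (1 / (M * L)) * (cnj (v l (i * D + a)) * v l (i * D + b)))"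
      unfolding K_def KK[symmetric] by (simp add: mult_ac)
    also have "\<dots> = (\<Sum>i<M. complex_of_real (1 / (M * L)) * (\<Sum>l<L. cnj (v l (i * D + a)) * v l (i * D + b)))"
      unfolding sum_distrib_left by (rule sum.swap)
    also have "\<dots> = (\<Sum>i<M. complex_of_real (1 / (M * L)) * (if a = b then of_nat L else 0))"
    proof (intro sum.cong refl)
      fix i assume "i \<in> {..<M}"
      then show "complex_of_real (1 / (M * L)) * (\<Sum>l<L. cnj (v l (i * D + a)) * v l (i * D + b)) =
        complex_of_real (1 / (M * L)) * (if a = b then of_nat L else 0)"
        using v2 pair_index_less[of i M _ D] ab by (simp add: pair_index_inj)
    qed
    finally show ?thesis using M L by simp
  qed
  define T where "T l = kraus_map (dA ^ n) M {l} K" for l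
  define R where "R l = kraus_map (dB ^ n) M {..<F + B} (C l)" for l
  have "instrument (dA ^ n) M L T"
    unfolding T_def using Ktp unfolding D_def by (rule kraus_instrument)
  moreover have "quantum_operation (dB ^ n) M (R l)" for l
    unfolding R_def using P[of l] unfolding P_def B_def by (intro kraus_map_quantum_operation) auto
  moreover have "fidelity (max_entangled M) (protocol_output dA dB n M L T R \<rho>) \<ge> 1 - (3 * \<epsilon> + M * \<eta>)"
  proof -
    define z where "z l j s = (\<Sum>m<M. \<Sum>a<D. \<Sum>b<B. K l m a * C l j m b * \<psi> s a b)" for l j s
    define A where "A s s' x x' = (\<Sum>b<B. cnj (c s x b) * c s' x' b)" for s s' x x'
    define q where "q l m s = (\<Sum>b<B. E l (m * F + s) b * Y l b (m * F + s))" for l m s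
    have fid: "fidelity (max_entangled M) (protocol_output dA dB n M L T R \<rho>) =
      (\<Sum>l<L. \<Sum>j<F + B. \<Sum>s<F. p s * (cmod (z l j s))\<^sup>2) / M"
      unfolding T_def R_def z_def D_def B_def
      by (rule kraus_protocol_fidelity, rule X[unfolded D_def B_def])
    have Yi: "Y l b (m * F + s) = (\<Sum>x<D. v l (m * D + x) * c s x b)" if "s < F" for l b m s
      unfolding Y_def using that by simp
    \<comment> \<open>Bob's Kraus operator with index \<open>s\<close> is the event that he
      identifies the label \<open>s\<close> correctly. Outside \<open>TE\<close> the vectors
      \<open>Y\<close> vanish and the bound is trivial.\<close>
    have zq: "(cmod (z l s s))\<^sup>2 \<ge> (cmod (\<Sum>m<M. q l m s))\<^sup>2 / (M * L)" if s: "s < F" for l s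
    proof (cases "s \<in> TE")
      case False
      have "q l m s = 0" for m unfolding q_def Yi[OF s] c_def using False by simp
      then show ?thesis by simp
    next
      case True
      \<comment> \<open>All vectors \<open>Y\<close> vanish at \<open>b\<close> outside
        \<open>TB\<close>, hence so does the decoder. This is why the full coefficients of
        \<open>\<psi> s\<close> may be replaced by the truncated \<open>c s\<close> below.\<close>
      have E0: "E l i b = 0" if "b \<notin> TB" for i b
        using P[of l] that unfolding P_def Y_def c_def by simp
      have "z l s s = (\<Sum>m<M. complex_of_real (1 / sqrt (M * L)) * q l m s)"
        unfolding z_def
      proof (rule sum.cong[OF refl])
        fix m assume "m \<in> {..<M}"
        then have C: "C l s m y = (\<Sum>b<B. E l (m * F + s) b * cnj (\<beta> y b))" for y
          using P[of l] s unfolding P_def by simp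
        have "(\<Sum>a<D. \<Sum>y<B. K l m a * C l s m y * \<psi> s a y) =
          (\<Sum>a<D. \<Sum>y<B. \<Sum>b<B. E l (m * F + s) b * (K l m a * (cnj (\<beta> y b) * \<psi> s a y)))"
          unfolding C by (simp add: sum_distrib_left sum_distrib_right mult_ac)
        also have "\<dots> = (\<Sum>b<B. \<Sum>a<D. \<Sum>y<B. E l (m * F + s) b * (K l m a * (cnj (\<beta> y b) * \<psi> s a y)))"
          by (rule sum_rotate)
        also have "\<dots> = (\<Sum>b<B. \<Sum>a<D. E l (m * F + s) b * (K l m a * c s a b))"
        proof (intro sum.cong refl)
          fix b a
          have "(\<Sum>y<B. E l (m * F + s) b * (K l m a * (cnj (\<beta> y b) * \<psi> s a y))) =
            E l (m * F + s) b * (K l m a * (\<Sum>y<B. cnj (\<beta> y b) * \<psi> s a y))"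
            by (simp only: sum_distrib_left)
          also have "\<dots> = E l (m * F + s) b * (K l m a * c s a b)"
            using E0 True by (cases "b \<in> TB") (simp_all add: c_def B_def)
          finally show "(\<Sum>y<B. E l (m * F + s) b * (K l m a * (cnj (\<beta> y b) * \<psi> s a y))) =
            E l (m * F + s) b * (K l m a * c s a b)" .
        qed
        also have "\<dots> = complex_of_real (1 / sqrt (M * L)) * q l m s"
          unfolding q_def Yi[OF s] K_def sum_distrib_left by (simp add: mult_ac)
        finally show "(\<Sum>a<D. \<Sum>y<B. K l m a * C l s m y * \<psi> s a y) = complex_of_real (1 / sqrt (M * L)) * q l m s" .
      qed
      also have "\<dots> = complex_of_real (1 / sqrt (M * L)) * (\<Sum>m<M. q l m s)" by (simp only: sum_distrib_left)
      finally have "(cmod (z l s s))\<^sup>2 = (1 / sqrt (M * L))\<^sup>2 * (cmod (\<Sum>m<M. q l m s))\<^sup>2"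
        by (simp only: norm_mult power_mult_distrib norm_of_real power2_abs)
      also have "(1 / sqrt (M * L))\<^sup>2 = 1 / (M * L)" by (simp add: power_divide del: of_nat_mult)
      finally show ?thesis by simp
    qed
    have Gi: "G l (m * F + s) (m' * F + s') =
      (\<Sum>x<D. \<Sum>x'<D. cnj (v l (m * D + x)) * v l (m' * D + x') * A s s' x x')" if s: "s < F" "s' < F" for l m m' s s'
    proof -
      have "G l (m * F + s) (m' * F + s') =
        (\<Sum>b<B. \<Sum>x<D. \<Sum>x'<D. cnj (v l (m * D + x)) * v l (m' * D + x') * (cnj (c s x b) * c s' x' b))"
        unfolding G_def Yi[OF s(1)] Yi[OF s(2)] cnj_sum sum_product by (simp add: mult_ac)
      also have "\<dots> = (\<Sum>x<D. \<Sum>x'<D. \<Sum>b<B. cnj (v l (m * D + x)) * v l (m' * D + x') * (cnj (c s x b) * c s' x' b))"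
        by (rule sum_rotate[symmetric])
      finally show ?thesis unfolding A_def sum_distrib_left .
    qed
    define g where "g s = (\<Sum>a<D. \<Sum>b<B. (cmod (c s a b))\<^sup>2)" for s
    define N where "N s s' = (\<Sum>x<D. \<Sum>x'<D. (cmod (A s s' x x'))\<^sup>2)" for s s'
    define t where "t s s' = (cmod (\<Sum>x<D. A s s' x x))\<^sup>2" for s s'
    have G1: "(\<Sum>l<L. Re (G l (m * F + s) (m * F + s))) = L * g s" if "m < M" "s < F" for m s
    proof -
      have "(\<Sum>l<L. G l (m * F + s) (m * F + s)) = of_nat L * (\<Sum>x<D. A s s x x)"
        unfolding Gi[OF that(2,2)] by (rule random_bilinear_first_moment) (use v2 that in auto)
      also have "(\<Sum>x<D. A s s x x) = complex_of_real (g s)"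
        unfolding A_def g_def of_real_sum complex_norm_square by (simp add: mult.commute)
      finally have "Re (\<Sum>l<L. G l (m * F + s) (m * F + s)) = L * g s" by simp
      then show ?thesis by simp
    qed
    \<comment> \<open>The trace terms \<open>t s s'\<close> occur only in the row m' = m, and
      \<open>bessel\<close> bounds their sum over s' by 1. The collision terms \<open>N\<close>
      occur once in each of the \<open>M\<close> rows.\<close>
    have G2: "(\<Sum>l<L. \<Sum>j<M * F. (cmod (G l (m * F + s) j))\<^sup>2) \<le> L * (M * (\<Sum>s'<F. N s s') + 1)"
      if m: "m < M" and s: "s < F" for m s
    proof -
      have "(\<Sum>l<L. \<Sum>j<M * F. (cmod (G l (m * F + s) j))\<^sup>2) =
        (\<Sum>m'<M. \<Sum>s'<F. \<Sum>l<L. (cmod (G l (m * F + s) (m' * F + s')))\<^sup>2)"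
        unfolding sum_pairs_lessThan by (rule sum_rotate[symmetric])
      also have "\<dots> \<le> (\<Sum>m'<M. \<Sum>s'<F. L * (N s s' + (if m = m' then t s s' else 0)))"
      proof (intro sum_mono)
        fix m' s' assume "m' \<in> {..<M}" "s' \<in> {..<F}"
        then have ms: "m' < M" "s' < F" by auto
        show "(\<Sum>l<L. (cmod (G l (m * F + s) (m' * F + s')))\<^sup>2) \<le> L * (N s s' + (if m = m' then t s s' else 0))"
          unfolding Gi[OF s ms(2)] N_def t_def
          by (rule random_bilinear_second_moment) (use v4 m ms in auto)
      qed
      also have "\<dots> = L * (M * (\<Sum>s'<F. N s s') + (\<Sum>s'<F. t s s'))"
      proof -
        have inner: "(\<Sum>s'<F. L * (N s s' + (if m = m' then t s s' else 0))) =
          L * ((\<Sum>s'<F. N s s') + (if m' = m then (\<Sum>s'<F. t s s') else 0))" for m'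
          by (cases "m' = m") (simp_all add: sum_distrib_left[symmetric] sum.distrib)
        show ?thesis unfolding inner unfolding sum_distrib_left[symmetric] using m by (simp add: sum.distrib)
      qed
      also have "\<dots> \<le> L * (M * (\<Sum>s'<F. N s s') + 1)"
        using bessel[OF s] L unfolding t_def A_def by (intro mult_left_mono add_left_mono) auto
      finally show ?thesis .
    qed
    \<comment> \<open>Of the 2 that is subtracted, one unit is the trace part of \<open>G2\<close>,
      the other comes from the linear bound 2 Re w - 1 on the squared modulus of w.\<close>
    have "1 - (3 * \<epsilon> + M * \<eta>) \<le> (\<Sum>s<F. p s * (3 * g s - M * (\<Sum>s'<F. N s s') - 2))"
    proof -
      have "(\<Sum>s<F. p s * (3 * g s - M * (\<Sum>s'<F. N s s') - 2)) =
        3 * (\<Sum>s<F. p s * g s) - M * (\<Sum>s<F. p s * (\<Sum>s'<F. N s s')) - 2 * (\<Sum>s<F. p s)"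
        by (simp add: sum_subtractf sum_distrib_left algebra_simps)
      moreover have "(\<Sum>s<F. p s * (\<Sum>s'<F. N s s')) \<le> \<eta>" using overlap unfolding N_def A_def .
      then have "M * (\<Sum>s<F. p s * (\<Sum>s'<F. N s s')) \<le> M * \<eta>" by (intro mult_left_mono) auto
      moreover have "(\<Sum>s<F. p s * g s) \<ge> 1 - \<epsilon>" using weight unfolding g_def .
      ultimately show ?thesis using p1 by simp
    qed
    also have "\<dots> \<le> (\<Sum>s<F. p s * ((\<Sum>l<L. \<Sum>m<M.
        3 * Re (G l (m * F + s) (m * F + s)) - (\<Sum>j<M * F. (cmod (G l (m * F + s) j))\<^sup>2)) / (L * M) - 1))"
    proof (intro sum_mono mult_left_mono)
      fix s assume "s \<in> {..<F}"
      then have s: "s < F" by simp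
      show "p s \<ge> 0" using p0[OF s] .
      have "L * M * (3 * g s - M * (\<Sum>s'<F. N s s') - 1) = (\<Sum>m<M. 3 * (L * g s) - L * (M * (\<Sum>s'<F. N s s') + 1))"
        by (simp add: algebra_simps)
      also have "\<dots> \<le> (\<Sum>m<M. 3 * (\<Sum>l<L. Re (G l (m * F + s) (m * F + s))) - (\<Sum>l<L. \<Sum>j<M * F. (cmod (G l (m * F + s) j))\<^sup>2))"
        using G1[OF _ s] G2[OF _ s] by (intro sum_mono diff_mono) auto
      also have "\<dots> = (\<Sum>l<L. \<Sum>m<M. 3 * Re (G l (m * F + s) (m * F + s)) - (\<Sum>j<M * F. (cmod (G l (m * F + s) j))\<^sup>2))"
        unfolding sum_distrib_left sum_subtractf[symmetric] by (rule sum.swap)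
      finally have le: "(3 * g s - M * (\<Sum>s'<F. N s s') - 1) * (L * M) \<le>
        (\<Sum>l<L. \<Sum>m<M. 3 * Re (G l (m * F + s) (m * F + s)) - (\<Sum>j<M * F. (cmod (G l (m * F + s) j))\<^sup>2))"
        by (simp add: mult.commute)
      have "(0 :: real) < L * M" using L M by simp
      from le[folded pos_le_divide_eq[OF this]]
      show "3 * g s - M * (\<Sum>s'<F. N s s') - 2 \<le> (\<Sum>l<L. \<Sum>m<M.
        3 * Re (G l (m * F + s) (m * F + s)) - (\<Sum>j<M * F. (cmod (G l (m * F + s) j))\<^sup>2)) / (L * M) - 1"
        by simp
    qed
    also have "\<dots> \<le> (\<Sum>s<F. p s * ((\<Sum>l<L. (cmod (z l s s))\<^sup>2) / M))"
    proof (intro sum_mono mult_left_mono)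
      fix s assume "s \<in> {..<F}"
      then have s: "s < F" by simp
      show "p s \<ge> 0" using p0[OF s] .
      have *: "(\<Sum>m<M. 3 * Re (G l (m * F + s) (m * F + s)) - (\<Sum>j<M * F. (cmod (G l (m * F + s) j))\<^sup>2)) / (L * M) - 1 / L
        \<le> (cmod (z l s s))\<^sup>2 / M" for l
      proof -
        \<comment> \<open>\<open>w\<close> is the decoding amplitude averaged over the outputs and
          should be near 1. Nonnegativity of |w - 1|^2 replaces the quadratic fidelity by 2 Re w -
          1, which the decoder bound controls.\<close>
        define w where "w = (\<Sum>m<M. q l m s) / M"
        have "(\<Sum>m<M. 3 * Re (G l (m * F + s) (m * F + s)) - (\<Sum>j<M * F. (cmod (G l (m * F + s) j))\<^sup>2)) \<le> (\<Sum>m<M. 2 * Re (q l m s))"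
        proof (rule sum_mono)
          fix m assume "m \<in> {..<M}"
          then have "m * F + s < M * F" using pair_index_less[of m M s F] s by simp
          then show "3 * Re (G l (m * F + s) (m * F + s)) - (\<Sum>j<M * F. (cmod (G l (m * F + s) j))\<^sup>2) \<le> 2 * Re (q l m s)"
            using P[of l] unfolding P_def q_def by (auto dest!: spec[of _ "m * F + s"])
        qed
        also have "\<dots> = M * (2 * Re w)" using M unfolding w_def sum_distrib_left[symmetric] by simp
        finally have "(\<Sum>m<M. 3 * Re (G l (m * F + s) (m * F + s)) - (\<Sum>j<M * F. (cmod (G l (m * F + s) j))\<^sup>2)) / (L * M) - 1 / L
          \<le> M * (2 * Re w) / (L * M) - 1 / L"
          using L M by (intro diff_right_mono divide_right_mono) auto
        also have "\<dots> = (2 * Re w - 1) / L" using M by (simp add: diff_divide_distrib)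
        also have "\<dots> \<le> (cmod w)\<^sup>2 / L"
        proof (rule divide_right_mono)
          have "0 \<le> (Re w - 1)\<^sup>2 + (Im w)\<^sup>2" by simp
          then show "2 * Re w - 1 \<le> (cmod w)\<^sup>2" by (simp add: cmod_power2 power2_diff)
        qed simp
        also have "\<dots> = (cmod (\<Sum>m<M. q l m s))\<^sup>2 / (M * L) / M"
          unfolding w_def by (simp add: norm_divide power_divide power2_eq_square mult_ac)
        also have "\<dots> \<le> (cmod (z l s s))\<^sup>2 / M" using zq[OF s, of l] by (intro divide_right_mono) auto
        finally show ?thesis .
      qed
      have "(\<Sum>l<L. \<Sum>m<M. 3 * Re (G l (m * F + s) (m * F + s)) - (\<Sum>j<M * F. (cmod (G l (m * F + s) j))\<^sup>2)) / (L * M) - 1 =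
        (\<Sum>l<L. (\<Sum>m<M. 3 * Re (G l (m * F + s) (m * F + s)) - (\<Sum>j<M * F. (cmod (G l (m * F + s) j))\<^sup>2)) / (L * M) - 1 / L)"
        unfolding sum_subtractf[of _ "\<lambda>_. 1 / real L"] sum_divide_distrib using L by simp
      also have "\<dots> \<le> (\<Sum>l<L. (cmod (z l s s))\<^sup>2 / M)" by (rule sum_mono, rule *)
      finally show "(\<Sum>l<L. \<Sum>m<M. 3 * Re (G l (m * F + s) (m * F + s)) - (\<Sum>j<M * F. (cmod (G l (m * F + s) j))\<^sup>2)) / (L * M) - 1
        \<le> (\<Sum>l<L. (cmod (z l s s))\<^sup>2) / M" unfolding sum_divide_distrib .
    qed
    also have "\<dots> = (\<Sum>l<L. \<Sum>s<F. p s * (cmod (z l s s))\<^sup>2) / M"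
    proof -
      have "(\<Sum>s<F. p s * ((\<Sum>l<L. (cmod (z l s s))\<^sup>2) / M)) = (\<Sum>s<F. \<Sum>l<L. p s * (cmod (z l s s))\<^sup>2) / M"
        by (simp add: sum_distrib_left sum_divide_distrib)
      then show ?thesis by (subst sum.swap)
    qed
    also have "\<dots> \<le> (\<Sum>l<L. \<Sum>j<F + B. \<Sum>s<F. p s * (cmod (z l j s))\<^sup>2) / M"
    proof (intro divide_right_mono sum_mono)
      fix l
      \<comment> \<open>All contributions are nonnegative, so only those where Kraus index and true
        label agree are kept.\<close>
      have "(\<Sum>s<F. p s * (cmod (z l s s))\<^sup>2) \<le> (\<Sum>j<F. \<Sum>s<F. p s * (cmod (z l j s))\<^sup>2)"
      proof (rule sum_mono)
        fix j assume "j \<in> {..<F}"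
        then show "p j * (cmod (z l j j))\<^sup>2 \<le> (\<Sum>s<F. p s * (cmod (z l j s))\<^sup>2)"
          using p0 by (intro member_le_sum[of j "{..<F}" "\<lambda>s. p s * (cmod (z l j s))\<^sup>2"]) auto
      qed
      also have "\<dots> \<le> (\<Sum>j<F + B. \<Sum>s<F. p s * (cmod (z l j s))\<^sup>2)"
        using p0 by (intro sum_mono2 sum_nonneg mult_nonneg_nonneg) auto
      finally show "(\<Sum>s<F. p s * (cmod (z l s s))\<^sup>2) \<le> (\<Sum>j<F + B. \<Sum>s<F. p s * (cmod (z l j s))\<^sup>2)" .
    qed simp
    finally show ?thesis unfolding fid .
  qed
  ultimately show ?thesis unfolding one_way_protocol_def by blast
qed

text \<open>These are the three inputs of the one-shot bound. The lost weight obeys a union bound;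
  orthonormality of the uncut vectors gives Bessel; and the collision sum is small because the
  averaged state of Bob is diag(\<open>q\<close>), which is at most \<open>\<mu>\<close> on
  \<open>TB\<close>, while only \<open>card TE\<close> labels remain.\<close>

lemma truncation_bounds:
  fixes c0 :: "nat \<Rightarrow> nat \<Rightarrow> nat \<Rightarrow> complex" and p q :: "nat \<Rightarrow> real" and TE TB :: "nat set" and F D B :: nat
  defines "c \<equiv> \<lambda>s a b. if s \<in> TE \<and> b \<in> TB then c0 s a b else 0"
  assumes TE: "TE \<subseteq> {..<F}" and TB: "TB \<subseteq> {..<B}"
    and p0: "\<And>s. s < F \<Longrightarrow> p s \<ge> 0" and p1: "(\<Sum>s<F. p s) = 1"
    and orth: "\<And>s s'. s < F \<Longrightarrow> s' < F \<Longrightarrow>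
      (\<Sum>a<D. \<Sum>b<B. cnj (c0 s a b) * c0 s' a b) = (if s = s' then 1 else 0)"
    and marg: "\<And>b b'. b < B \<Longrightarrow> b' < B \<Longrightarrow>
      (\<Sum>s<F. complex_of_real (p s) * (\<Sum>a<D. c0 s a b * cnj (c0 s a b'))) = (if b = b' then complex_of_real (q b) else 0)"
    and mu0: "\<mu> \<ge> 0" and qmax: "\<And>b. b \<in> TB \<Longrightarrow> q b \<le> \<mu>"
  shows "(\<Sum>s<F. p s * (\<Sum>a<D. \<Sum>b<B. (cmod (c s a b))\<^sup>2)) \<ge> 1 - ((\<Sum>s\<in>{..<F} - TE. p s) + (\<Sum>b\<in>{..<B} - TB. q b))"
    and "s < F \<Longrightarrow> (\<Sum>s'<F. (cmod (\<Sum>a<D. \<Sum>b<B. cnj (c s a b) * c s' a b))\<^sup>2) \<le> 1"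
    and "(\<Sum>s<F. p s * (\<Sum>s'<F. \<Sum>x<D. \<Sum>x'<D. (cmod (\<Sum>b<B. cnj (c s x b) * c s' x' b))\<^sup>2)) \<le> \<mu> * card TE"
proof -
  have sq: "complex_of_real ((cmod z)\<^sup>2) = cnj z * z" for z
    unfolding complex_norm_square by (rule mult.commute)
  have norm0: "(\<Sum>a<D. \<Sum>b<B. (cmod (c0 s a b))\<^sup>2) = 1" if "s < F" for s
  proof -
    have "complex_of_real (\<Sum>a<D. \<Sum>b<B. (cmod (c0 s a b))\<^sup>2) = complex_of_real 1"
      unfolding of_real_sum sq using orth[OF that that] by simp
    then show ?thesis unfolding of_real_eq_iff .
  qed
  have margq: "(\<Sum>s<F. p s * (\<Sum>a<D. (cmod (c0 s a b))\<^sup>2)) = q b" if "b < B" for b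
  proof -
    have "complex_of_real (\<Sum>s<F. p s * (\<Sum>a<D. (cmod (c0 s a b))\<^sup>2)) = complex_of_real (q b)"
      unfolding of_real_sum of_real_mult complex_norm_square using marg[OF that that] by simp
    then show ?thesis unfolding of_real_eq_iff .
  qed
  show "(\<Sum>s<F. p s * (\<Sum>a<D. \<Sum>b<B. (cmod (c s a b))\<^sup>2)) \<ge> 1 - ((\<Sum>s\<in>{..<F} - TE. p s) + (\<Sum>b\<in>{..<B} - TB. q b))"
  proof -
    let ?f = "\<lambda>s a b. (cmod (c0 s a b))\<^sup>2"
    have "1 = (\<Sum>s<F. p s * (\<Sum>a<D. \<Sum>b<B. ?f s a b))" using norm0 p1 by simp
    \<comment> \<open>Union bound: a coefficient is lost only if its \<open>s\<close> leaves
      \<open>TE\<close> or its \<open>b\<close> leaves \<open>TB\<close>.\<close>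
    also have "\<dots> \<le> (\<Sum>s<F. p s * ((\<Sum>a<D. \<Sum>b<B. (cmod (c s a b))\<^sup>2) + (\<Sum>a<D. \<Sum>b<B. if s \<in> TE then 0 else ?f s a b)
        + (\<Sum>a<D. \<Sum>b<B. if b \<in> TB then 0 else ?f s a b)))"
      unfolding sum.distrib[symmetric] using p0
      by (intro sum_mono mult_left_mono) (auto simp: c_def)
    also have "\<dots> = (\<Sum>s<F. p s * (\<Sum>a<D. \<Sum>b<B. (cmod (c s a b))\<^sup>2))
        + (\<Sum>s<F. p s * (\<Sum>a<D. \<Sum>b<B. if s \<in> TE then 0 else ?f s a b))
        + (\<Sum>s<F. p s * (\<Sum>a<D. \<Sum>b<B. if b \<in> TB then 0 else ?f s a b))"
      by (simp only: distrib_left sum.distrib)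
    also have "(\<Sum>s<F. p s * (\<Sum>a<D. \<Sum>b<B. if s \<in> TE then 0 else ?f s a b)) = (\<Sum>s\<in>{..<F} - TE. p s)"
    proof -
      have "(\<Sum>s<F. p s * (\<Sum>a<D. \<Sum>b<B. if s \<in> TE then 0 else ?f s a b)) = (\<Sum>s<F. if s \<in> TE then 0 else p s)"
        by (intro sum.cong refl) (auto simp: norm0)
      also have "\<dots> = (\<Sum>s\<in>{..<F} - TE. p s)"
        by (rule sum.mono_neutral_cong_right) auto
      finally show ?thesis .
    qed
    also have "(\<Sum>s<F. p s * (\<Sum>a<D. \<Sum>b<B. if b \<in> TB then 0 else ?f s a b)) = (\<Sum>b\<in>{..<B} - TB. q b)"
    proof -
      have "(\<Sum>s<F. p s * (\<Sum>a<D. \<Sum>b<B. if b \<in> TB then 0 else ?f s a b)) =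
        (\<Sum>s<F. \<Sum>a<D. \<Sum>b<B. if b \<in> TB then 0 else p s * ?f s a b)"
        unfolding sum_distrib_left by (intro sum.cong refl) auto
      also have "\<dots> = (\<Sum>b<B. \<Sum>s<F. \<Sum>a<D. if b \<in> TB then 0 else p s * ?f s a b)" by (rule sum_rotate)
      also have "\<dots> = (\<Sum>b<B. if b \<in> TB then 0 else q b)"
        by (intro sum.cong refl) (auto simp: margq[symmetric] sum_distrib_left)
      also have "\<dots> = (\<Sum>b\<in>{..<B} - TB. q b)"
        by (rule sum.mono_neutral_cong_right) auto
      finally show ?thesis .
    qed
    finally show ?thesis by simp
  qed
  show "(\<Sum>s'<F. (cmod (\<Sum>a<D. \<Sum>b<B. cnj (c s a b) * c s' a b))\<^sup>2) \<le> 1" if s: "s < F"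
  proof -
    have pair: "(\<Sum>a<D. \<Sum>b<B. h a b) = (\<Sum>ab\<in>{..<D} \<times> {..<B}. h (fst ab) (snd ab))" for h :: "nat \<Rightarrow> nat \<Rightarrow> 'x :: comm_monoid_add"
      by (simp add: sum.cartesian_product split_def)
    have "(\<Sum>s'<F. (cmod (\<Sum>a<D. \<Sum>b<B. cnj (c s a b) * c s' a b))\<^sup>2) =
      (\<Sum>s'<F. if s' \<in> TE then (cmod (\<Sum>a<D. \<Sum>b<B. cnj (c0 s' a b) * c s a b))\<^sup>2 else 0)"
    proof (intro sum.cong refl)
      fix s'
      have "cnj (\<Sum>a<D. \<Sum>b<B. cnj (c s a b) * c s' a b) = (if s' \<in> TE then (\<Sum>a<D. \<Sum>b<B. cnj (c0 s' a b) * c s a b) else 0)"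
        unfolding cnj_sum c_def by (auto intro!: sum.cong simp: mult.commute)
      then have "cmod (\<Sum>a<D. \<Sum>b<B. cnj (c s a b) * c s' a b) = cmod (if s' \<in> TE then (\<Sum>a<D. \<Sum>b<B. cnj (c0 s' a b) * c s a b) else 0)"
        by (simp only: complex_mod_cnj[symmetric, of "\<Sum>a<D. \<Sum>b<B. cnj (c s a b) * c s' a b"])
      then show "(cmod (\<Sum>a<D. \<Sum>b<B. cnj (c s a b) * c s' a b))\<^sup>2 =
        (if s' \<in> TE then (cmod (\<Sum>a<D. \<Sum>b<B. cnj (c0 s' a b) * c s a b))\<^sup>2 else 0)"
        by simp
    qed
    also have "\<dots> = (\<Sum>s'\<in>TE. (cmod (\<Sum>a<D. \<Sum>b<B. cnj (c0 s' a b) * c s a b))\<^sup>2)"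
      using TE by (intro sum.mono_neutral_cong_right) auto
    \<comment> \<open>Written in the shape of \<open>orthogonal_bessel\<close> with all weights and
      squared norms equal to 1.\<close>
    also have "\<dots> = (\<Sum>s'\<in>TE. (2 * 1 - 1\<^sup>2 * 1) * (cmod (\<Sum>ab\<in>{..<D} \<times> {..<B}. cnj (c0 s' (fst ab) (snd ab)) * c s (fst ab) (snd ab)))\<^sup>2)"
      unfolding pair by simp
    also have "\<dots> \<le> (\<Sum>ab\<in>{..<D} \<times> {..<B}. (cmod (c s (fst ab) (snd ab)))\<^sup>2)"
    proof (rule orthogonal_bessel)
      show "finite TE" using TE finite_subset by blast
      fix k k' assume "k \<in> TE" "k' \<in> TE"
      then have "k < F" "k' < F" using TE by auto
      then show "(\<Sum>ab\<in>{..<D} \<times> {..<B}. cnj (c0 k (fst ab) (snd ab)) * c0 k' (fst ab) (snd ab)) = (if k = k' then complex_of_real 1 else 0)"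
        using orth[of k k', unfolded pair] by simp
    qed
    also have "\<dots> = (\<Sum>a<D. \<Sum>b<B. (cmod (c s a b))\<^sup>2)" unfolding pair ..
    also have "\<dots> \<le> (\<Sum>a<D. \<Sum>b<B. (cmod (c0 s a b))\<^sup>2)"
      by (intro sum_mono) (auto simp: c_def)
    also have "\<dots> = 1" by (rule norm0[OF s])
    finally show ?thesis .
  qed
  \<comment> \<open>With s' and x' fixed, the sum over \<open>s\<close> and \<open>x\<close> is the
    quadratic form of Bob's averaged state at one vector supported on \<open>TB\<close>. Dropping
    the cut of \<open>s\<close> to \<open>TE\<close> only enlarges it and makes the form
    diag(\<open>q\<close>).\<close>
  have key: "(\<Sum>s<F. p s * (\<Sum>x<D. (cmod (\<Sum>b<B. cnj (c s x b) * c s' x' b))\<^sup>2)) \<le> \<mu> * (\<Sum>b<B. (cmod (c0 s' x' b))\<^sup>2)"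
    if s': "s' \<in> TE" for s' x'
  proof -
    define w where "w b = (if b \<in> TB then c0 s' x' b else 0)" for b
    have "(\<Sum>s<F. p s * (\<Sum>x<D. (cmod (\<Sum>b<B. cnj (c s x b) * c s' x' b))\<^sup>2)) \<le>
      (\<Sum>s<F. p s * (\<Sum>x<D. (cmod (\<Sum>b<B. cnj (c0 s x b) * w b))\<^sup>2))"
    proof (intro sum_mono mult_left_mono)
      fix s x
      show "(cmod (\<Sum>b<B. cnj (c s x b) * c s' x' b))\<^sup>2 \<le> (cmod (\<Sum>b<B. cnj (c0 s x b) * w b))\<^sup>2"
      proof (cases "s \<in> TE")
        case True
        then have "cnj (c s x b) * c s' x' b = cnj (c0 s x b) * w b" for b
          using s' unfolding c_def w_def by simp
        then show ?thesis by simp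
      qed (simp add: c_def)
    qed (use p0 in auto)
    also have "\<dots> = (\<Sum>b\<in>TB. q b * (cmod (c0 s' x' b))\<^sup>2)"
    proof -
      have "complex_of_real (\<Sum>s<F. p s * (\<Sum>x<D. (cmod (\<Sum>b<B. cnj (c0 s x b) * w b))\<^sup>2)) =
        (\<Sum>s<F. complex_of_real (p s) * (\<Sum>x<D. \<Sum>b<B. \<Sum>b'<B. (c0 s x b * cnj (c0 s x b')) * (cnj (w b) * w b')))"
        unfolding of_real_sum of_real_mult sq cnj_sum sum_product by (simp add: mult_ac)
      also have "\<dots> = (\<Sum>s<F. \<Sum>b<B. \<Sum>b'<B. complex_of_real (p s) * (\<Sum>x<D. c0 s x b * cnj (c0 s x b')) * (cnj (w b) * w b'))"
      proof (rule sum.cong[OF refl])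
        fix s
        have "(\<Sum>x<D. \<Sum>b<B. \<Sum>b'<B. (c0 s x b * cnj (c0 s x b')) * (cnj (w b) * w b')) =
          (\<Sum>b<B. \<Sum>b'<B. \<Sum>x<D. (c0 s x b * cnj (c0 s x b')) * (cnj (w b) * w b'))"
          by (rule sum_rotate[symmetric])
        then show "complex_of_real (p s) * (\<Sum>x<D. \<Sum>b<B. \<Sum>b'<B. (c0 s x b * cnj (c0 s x b')) * (cnj (w b) * w b')) =
          (\<Sum>b<B. \<Sum>b'<B. complex_of_real (p s) * (\<Sum>x<D. c0 s x b * cnj (c0 s x b')) * (cnj (w b) * w b'))"
          by (simp only: sum_distrib_left sum_distrib_right mult.assoc)
      qed
      also have "\<dots> = (\<Sum>b<B. \<Sum>b'<B. \<Sum>s<F. complex_of_real (p s) * (\<Sum>x<D. c0 s x b * cnj (c0 s x b')) * (cnj (w b) * w b'))"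
        by (rule sum_rotate[symmetric])
      also have "\<dots> = (\<Sum>b<B. \<Sum>b'<B. if b' = b then complex_of_real (q b) * (cnj (w b) * w b') else 0)"
        by (intro sum.cong refl) (auto simp: sum_distrib_right[symmetric] marg)
      also have "\<dots> = complex_of_real (\<Sum>b<B. q b * (cmod (w b))\<^sup>2)"
        unfolding of_real_sum of_real_mult sq by simp
      finally have "(\<Sum>s<F. p s * (\<Sum>x<D. (cmod (\<Sum>b<B. cnj (c0 s x b) * w b))\<^sup>2)) = (\<Sum>b<B. q b * (cmod (w b))\<^sup>2)"
        unfolding of_real_eq_iff .
      also have "\<dots> = (\<Sum>b\<in>TB. q b * (cmod (c0 s' x' b))\<^sup>2)"
        using TB by (intro sum.mono_neutral_cong_right) (auto simp: w_def)
      finally show ?thesis .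
    qed
    also have "\<dots> \<le> (\<Sum>b\<in>TB. \<mu> * (cmod (c0 s' x' b))\<^sup>2)"
      using qmax by (intro sum_mono mult_right_mono) auto
    also have "\<dots> \<le> (\<Sum>b<B. \<mu> * (cmod (c0 s' x' b))\<^sup>2)"
      using TB mu0 by (intro sum_mono2) auto
    finally show ?thesis by (simp only: sum_distrib_left)
  qed
  have "(\<Sum>s<F. p s * (\<Sum>s'<F. \<Sum>x<D. \<Sum>x'<D. (cmod (\<Sum>b<B. cnj (c s x b) * c s' x' b))\<^sup>2)) =
    (\<Sum>s<F. \<Sum>s'<F. \<Sum>x'<D. p s * (\<Sum>x<D. (cmod (\<Sum>b<B. cnj (c s x b) * c s' x' b))\<^sup>2))"
    unfolding sum_distrib_left by (rule sum.cong[OF refl], rule sum.cong[OF refl], rule sum.swap)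
  also have "\<dots> = (\<Sum>s'<F. \<Sum>x'<D. \<Sum>s<F. p s * (\<Sum>x<D. (cmod (\<Sum>b<B. cnj (c s x b) * c s' x' b))\<^sup>2))"
    by (rule sum_rotate[symmetric])
  also have "\<dots> = (\<Sum>s'\<in>TE. \<Sum>x'<D. \<Sum>s<F. p s * (\<Sum>x<D. (cmod (\<Sum>b<B. cnj (c s x b) * c s' x' b))\<^sup>2))"
    using TE by (intro sum.mono_neutral_right) (auto simp: c_def)
  also have "\<dots> \<le> (\<Sum>s'\<in>TE. \<Sum>x'<D. \<mu> * (\<Sum>b<B. (cmod (c0 s' x' b))\<^sup>2))"
    by (intro sum_mono key)
  also have "\<dots> = (\<Sum>s'\<in>TE. \<mu>)"
  proof (rule sum.cong[OF refl])
    fix s' assume "s' \<in> TE"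
    then have "s' < F" using TE by auto
    then show "(\<Sum>x'<D. \<mu> * (\<Sum>b<B. (cmod (c0 s' x' b))\<^sup>2)) = \<mu>"
      using norm0[of s'] by (simp add: sum_distrib_left[symmetric])
  qed
  also have "\<dots> = \<mu> * card TE" by simp
  finally show "(\<Sum>s<F. p s * (\<Sum>s'<F. \<Sum>x<D. \<Sum>x'<D. (cmod (\<Sum>b<B. cnj (c s x b) * c s' x' b))\<^sup>2)) \<le> \<mu> * card TE" .
qed

section \<open>Typicality\<close>

lemma digit_low:
  assumes "k < n" shows "digit d k (a * d ^ n + y) = digit d k y"
proof (cases "d = 0")
  case False
  obtain m where n: "n = k + Suc m" using assms less_iff_Suc_add by auto
  have eq: "a * d ^ n + y = y + d ^ k * (d * (a * d ^ m))" unfolding n by (simp add: power_add mult_ac)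
  then have "(a * d ^ n + y) div d ^ k = y div d ^ k + d * (a * d ^ m)"
    unfolding eq using False by (subst div_mult_self2) simp_all
  then show ?thesis unfolding digit_def by simp
qed (use assms in \<open>auto simp: digit_def power_0_left\<close>)

lemma digit_top:
  assumes "y < d ^ n" "a < d" shows "digit d n (a * d ^ n + y) = a"
  using assms unfolding digit_def by simp

text \<open>Base-\<open>d\<close> digits identify the numbers below d^n with words of length n, so
  this is the distributive law. All facts about independent copies are reduced to it.\<close>

lemma sum_prod_digits:
  fixes f :: "nat \<Rightarrow> nat \<Rightarrow> 'a :: comm_semiring_1"
  shows "(\<Sum>x<d ^ n. \<Prod>k<n. f k (digit d k x)) = (\<Prod>k<n. \<Sum>a<d. f k a)"
proof (induction n)
  case (Suc n)
  have "(\<Sum>x<d ^ Suc n. \<Prod>k<Suc n. f k (digit d k x)) =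
    (\<Sum>a<d. \<Sum>y<d ^ n. \<Prod>k<Suc n. f k (digit d k (a * d ^ n + y)))"
    unfolding power_Suc sum_pairs_lessThan ..
  also have "\<dots> = (\<Sum>a<d. \<Sum>y<d ^ n. (\<Prod>k<n. f k (digit d k y)) * f n a)"
    by (intro sum.cong refl) (simp add: digit_low digit_top)
  also have "\<dots> = (\<Sum>y<d ^ n. \<Prod>k<n. f k (digit d k y)) * (\<Sum>a<d. f n a)"
    unfolding sum_product by (rule sum.swap)
  finally show ?case using Suc by simp
qed simp

lemma sum_prod_digits_pair:
  fixes f :: "nat \<Rightarrow> nat \<Rightarrow> nat \<Rightarrow> 'a :: comm_semiring_1"
  shows "(\<Sum>x<d ^ n. \<Sum>y<e ^ n. \<Prod>k<n. f k (digit d k x) (digit e k y)) = (\<Prod>k<n. \<Sum>a<d. \<Sum>b<e. f k a b)"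
proof -
  have "(\<Sum>y<e ^ n. \<Prod>k<n. f k (digit d k x) (digit e k y)) = (\<Prod>k<n. \<Sum>b<e. f k (digit d k x) b)" for x
    by (rule sum_prod_digits)
  then show ?thesis by (simp only: sum_prod_digits[where f = "\<lambda>k a. \<Sum>b<e. f k a b"])
qed

lemma digit_less: "x < d ^ n \<Longrightarrow> k < n \<Longrightarrow> digit d k x < d"
  unfolding digit_def by (cases "d = 0") (auto simp: power_0_left split: if_splits)

lemma digits_eq_iff:
  assumes "x < d ^ n" "y < d ^ n"
  shows "(\<forall>k<n. digit d k x = digit d k y) \<longleftrightarrow> x = y"
  using assms
proof (induction n arbitrary: x y)
  case (Suc n)
  have d: "d > 0" using Suc.prems by (cases d) auto
  then have p: "d ^ n > 0" by simp
  have low: "digit d k (z mod d ^ n) = digit d k z" if "k < n" for k z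
    using digit_low[OF that, of d "z div d ^ n" "z mod d ^ n"] by (simp only: div_mult_mod_eq)
  have top: "digit d n z = z div d ^ n" if "z < d ^ Suc n" for z
    using that unfolding digit_def by (simp add: less_mult_imp_div_less)
  show ?case
  proof
    assume eq: "\<forall>k<Suc n. digit d k x = digit d k y"
    have "x mod d ^ n = y mod d ^ n"
      using Suc.IH[of "x mod d ^ n" "y mod d ^ n"] p eq low by simp
    moreover have "x div d ^ n = y div d ^ n" using eq top[OF Suc.prems(1)] top[OF Suc.prems(2)] by simp
    ultimately show "x = y" by (metis div_mult_mod_eq)
  qed simp
qed auto

lemma prod_digits_delta:
  assumes "x < d ^ n" "y < d ^ n"
  shows "(\<Prod>k<n. if digit d k x = digit d k y then g k else 0) = (if x = y then \<Prod>k<n. g k else (0 :: complex))"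
proof (cases "x = y")
  case False
  then obtain k where "k < n" "digit d k x \<noteq> digit d k y" using digits_eq_iff[OF assms] by blast
  then have "(\<Prod>k<n. if digit d k x = digit d k y then g k else 0) = 0" by (intro prod_zero) auto
  then show ?thesis using False by simp
qed simp

text \<open>As a function of \<open>s\<close> the moment equals 1 at 0, and its derivative there is
  the negative mean of ln \<open>r\<close>.\<close>

lemma exponential_moment_less_one:
  fixes q r :: "nat \<Rightarrow> real"
  assumes "(\<Sum>a<d. q a) = 1" and r: "\<And>a. r a > 0" and neg: "(\<Sum>a<d. q a * ln (r a)) < 0"
  shows "\<exists>s>0. (\<Sum>a<d. q a * r a powr s) < 1"
proof -
  define f where "f s = (\<Sum>a<d. q a * exp (s * ln (r a)))" for s
  have "DERIV f 0 :> (\<Sum>a<d. q a * (exp (0 * ln (r a)) * (1 * ln (r a))))"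
    unfolding f_def by (intro DERIV_sum DERIV_cmult DERIV_fun_exp DERIV_cmult_right DERIV_ident)
  then have "DERIV f 0 :> (\<Sum>a<d. q a * ln (r a))" by simp
  from DERIV_neg_dec_right[OF this neg] obtain \<delta> where "\<delta> > 0" "\<And>h. h > 0 \<Longrightarrow> h < \<delta> \<Longrightarrow> f (0 + h) < f 0"
    by blast
  then have "f (\<delta> / 2) < f 0" by (metis add_0 half_gt_zero field_sum_of_halves less_add_same_cancel1)
  moreover have "f 0 = 1" unfolding f_def using assms(1) by simp
  moreover have "r a powr (\<delta> / 2) = exp (\<delta> / 2 * ln (r a))" for a
    using r[of a] unfolding powr_def by simp
  ultimately show ?thesis using \<open>\<delta> > 0\<close> unfolding f_def by (intro exI[of _ "\<delta> / 2"]) simp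
qed

text \<open>On the words of \<open>A\<close> that carry weight, the product of \<open>r\<close> to a
  positive power \<open>s\<close> is at least 1; inserting it and extending the sum to all words
  gives the n-th power of the one-letter moment. Words of weight zero are exempt, which leaves
  \<open>r\<close> free on letters of probability zero.\<close>

lemma iid_chernoff:
  fixes q r :: "nat \<Rightarrow> real"
  assumes q: "\<And>a. a < d \<Longrightarrow> q a \<ge> 0" "(\<Sum>a<d. q a) = 1"
    and r: "\<And>a. r a > 0" and neg: "(\<Sum>a<d. q a * ln (r a)) < 0"
  shows "\<exists>\<kappa>\<ge>0. \<kappa> < 1 \<and> (\<forall>n A. A \<subseteq> {..<d ^ n} \<longrightarrow>
    (\<forall>x\<in>A. (\<Prod>k<n. q (digit d k x)) \<noteq> 0 \<longrightarrow> (\<Prod>k<n. r (digit d k x)) \<ge> 1) \<longrightarrow>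
    (\<Sum>x\<in>A. \<Prod>k<n. q (digit d k x)) \<le> \<kappa> ^ n)"
proof -
  obtain s where s: "s > 0" "(\<Sum>a<d. q a * r a powr s) < 1"
    using exponential_moment_less_one[OF q(2) r neg] by blast
  let ?\<kappa> = "\<Sum>a<d. q a * r a powr s"
  have "?\<kappa> \<ge> 0" using q by (intro sum_nonneg) auto
  moreover have "(\<Sum>x\<in>A. \<Prod>k<n. q (digit d k x)) \<le> ?\<kappa> ^ n"
    if A: "A \<subseteq> {..<d ^ n}" "\<forall>x\<in>A. (\<Prod>k<n. q (digit d k x)) \<noteq> 0 \<longrightarrow> (\<Prod>k<n. r (digit d k x)) \<ge> 1" for n A
  proof -
    have nonneg: "(\<Prod>k<n. q (digit d k x)) \<ge> 0" if "x < d ^ n" for x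
      using q(1) digit_less[OF that] by (intro prod_nonneg) auto
    have eq: "(\<Prod>k<n. q (digit d k x) * r (digit d k x) powr s) = (\<Prod>k<n. q (digit d k x)) * (\<Prod>k<n. r (digit d k x)) powr s" for x
      using r by (subst prod_powr_distrib) (auto simp: prod.distrib less_imp_le)
    have "(\<Sum>x\<in>A. \<Prod>k<n. q (digit d k x)) \<le> (\<Sum>x\<in>A. \<Prod>k<n. q (digit d k x) * r (digit d k x) powr s)"
    proof (rule sum_mono)
      fix x assume x: "x \<in> A"
      show "(\<Prod>k<n. q (digit d k x)) \<le> (\<Prod>k<n. q (digit d k x) * r (digit d k x) powr s)"
      proof (cases "(\<Prod>k<n. q (digit d k x)) = 0")
        case True
        show ?thesis unfolding eq True by simp
      next
        case False
        then have "(\<Prod>k<n. r (digit d k x)) powr s \<ge> 1"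
          using A x s by (intro ge_one_powr_ge_zero) auto
        then show ?thesis unfolding eq using nonneg[of x] A x
          by (metis lessThan_iff mult.right_neutral mult_left_mono subsetD)
      qed
    qed
    also have "\<dots> \<le> (\<Sum>x<d ^ n. \<Prod>k<n. q (digit d k x) * r (digit d k x) powr s)"
      using A nonneg unfolding eq by (intro sum_mono2 mult_nonneg_nonneg) auto
    also have "\<dots> = ?\<kappa> ^ n" using sum_prod_digits[where f = "\<lambda>k a. q a * r a powr s" and n = n and d = d] by simp
    finally show ?thesis .
  qed
  ultimately show ?thesis using s(2) by blast
qed

text \<open>\<open>r\<close> is the letterwise ratio between threshold and probability, inverted for
  the second tail. Atypical words of positive weight are those where its product exceeds 1, while
  the mean of ln \<open>r\<close> is - \<open>\<delta>\<close> ln 2.\<close>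

lemma atypical_small:
  fixes q :: "nat \<Rightarrow> real" and d :: nat
  defines "H \<equiv> - (\<Sum>a<d. q a * log 2 (q a))"
  assumes q: "\<And>a. a < d \<Longrightarrow> q a \<ge> 0" "(\<Sum>a<d. q a) = 1" and \<delta>: "\<delta> > 0"
  shows "\<exists>\<kappa>\<ge>0. \<kappa> < 1 \<and> (\<forall>n. (\<Sum>x | x < d ^ n \<and> (\<Prod>k<n. q (digit d k x)) < 2 powr (- (n * (H + \<delta>))).
    \<Prod>k<n. q (digit d k x)) \<le> \<kappa> ^ n)"
    and "\<exists>\<kappa>\<ge>0. \<kappa> < 1 \<and> (\<forall>n. (\<Sum>x | x < d ^ n \<and> (\<Prod>k<n. q (digit d k x)) > 2 powr (- (n * (H - \<delta>))).
    \<Prod>k<n. q (digit d k x)) \<le> \<kappa> ^ n)"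
proof -
  have Hln: "(\<Sum>a<d. q a * ln (q a)) = - H * ln 2"
    unfolding H_def by (simp add: log_def sum_distrib_right)
  \<comment> \<open>The value 1 at letters of probability zero keeps \<open>r\<close> positive;
    words with such a letter have no weight.\<close>
  define r where "r a = (if q a > 0 then 2 powr (- (H + \<delta>)) / q a else 1)" for a
  have "(\<Sum>a<d. q a * ln (r a)) = (\<Sum>a<d. q a * (- (H + \<delta>) * ln 2) - q a * ln (q a))"
  proof (intro sum.cong refl)
    fix a assume "a \<in> {..<d}"
    then have "q a > 0 \<or> q a = 0" using q(1)[of a] by auto
    then show "q a * ln (r a) = q a * (- (H + \<delta>) * ln 2) - q a * ln (q a)"
      unfolding r_def by (auto simp: ln_div ln_powr algebra_simps)
  qed
  also have "\<dots> = - \<delta> * ln 2"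
    unfolding sum_subtractf sum_distrib_right[symmetric] q(2) Hln by (simp add: algebra_simps)
  also have "\<dots> < 0" using \<delta> by simp
  finally have neg: "(\<Sum>a<d. q a * ln (r a)) < 0" .
  have "r a > 0" for a unfolding r_def by simp
  from iid_chernoff[OF q this neg] obtain \<kappa> where \<kappa>: "\<kappa> \<ge> 0" "\<kappa> < 1"
    and bound: "\<And>n A. A \<subseteq> {..<d ^ n} \<Longrightarrow>
      \<forall>x\<in>A. (\<Prod>k<n. q (digit d k x)) \<noteq> 0 \<longrightarrow> (\<Prod>k<n. r (digit d k x)) \<ge> 1 \<Longrightarrow>
      (\<Sum>x\<in>A. \<Prod>k<n. q (digit d k x)) \<le> \<kappa> ^ n" by auto
  have "(\<Sum>x | x < d ^ n \<and> (\<Prod>k<n. q (digit d k x)) < 2 powr (- (n * (H + \<delta>))). \<Prod>k<n. q (digit d k x)) \<le> \<kappa> ^ n" for n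
  proof (rule bound)
    show "\<forall>x\<in>{x. x < d ^ n \<and> (\<Prod>k<n. q (digit d k x)) < 2 powr (- (n * (H + \<delta>)))}.
      (\<Prod>k<n. q (digit d k x)) \<noteq> 0 \<longrightarrow> (\<Prod>k<n. r (digit d k x)) \<ge> 1"
    proof (intro ballI impI)
      fix x assume x: "x \<in> {x. x < d ^ n \<and> (\<Prod>k<n. q (digit d k x)) < 2 powr (- (n * (H + \<delta>)))}"
        and nz: "(\<Prod>k<n. q (digit d k x)) \<noteq> 0"
      have pos: "q (digit d k x) > 0" if "k < n" for k
        using nz that x q(1)[OF digit_less[of x d n k]] by (auto simp: less_le)
      then have "(\<Prod>k<n. r (digit d k x)) = (\<Prod>k<n. 2 powr (- (H + \<delta>)) / q (digit d k x))"
        by (intro prod.cong refl) (simp add: r_def)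
      also have "\<dots> = (2 powr (- (H + \<delta>))) ^ n / (\<Prod>k<n. q (digit d k x))" by (simp add: prod_dividef)
      also have "(2 powr (- (H + \<delta>))) ^ n = 2 powr (- (n * (H + \<delta>)))"
        by (simp add: powr_realpow[symmetric] powr_powr algebra_simps)
      finally have e: "(\<Prod>k<n. r (digit d k x)) = 2 powr (- (n * (H + \<delta>))) / (\<Prod>k<n. q (digit d k x))" .
      have "(\<Prod>k<n. q (digit d k x)) > 0" using pos by (intro prod_pos) auto
      then show "(\<Prod>k<n. r (digit d k x)) \<ge> 1" unfolding e using x by simp
    qed
  qed auto
  then show "\<exists>\<kappa>\<ge>0. \<kappa> < 1 \<and> (\<forall>n. (\<Sum>x | x < d ^ n \<and> (\<Prod>k<n. q (digit d k x)) < 2 powr (- (n * (H + \<delta>))).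
    \<Prod>k<n. q (digit d k x)) \<le> \<kappa> ^ n)" using \<kappa> by blast
next
  have Hln: "(\<Sum>a<d. q a * ln (q a)) = - H * ln 2"
    unfolding H_def by (simp add: log_def sum_distrib_right)
  define r where "r a = (if q a > 0 then q a * 2 powr (H - \<delta>) else 1)" for a
  have "(\<Sum>a<d. q a * ln (r a)) = (\<Sum>a<d. q a * ((H - \<delta>) * ln 2) + q a * ln (q a))"
  proof (intro sum.cong refl)
    fix a assume "a \<in> {..<d}"
    then have "q a > 0 \<or> q a = 0" using q(1)[of a] by auto
    then show "q a * ln (r a) = q a * ((H - \<delta>) * ln 2) + q a * ln (q a)"
      unfolding r_def by (auto simp: ln_mult ln_powr algebra_simps)
  qed
  also have "\<dots> = - \<delta> * ln 2"
    unfolding sum.distrib sum_distrib_right[symmetric] q(2) Hln by (simp add: algebra_simps)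
  also have "\<dots> < 0" using \<delta> by simp
  finally have neg: "(\<Sum>a<d. q a * ln (r a)) < 0" .
  have "r a > 0" for a unfolding r_def by simp
  from iid_chernoff[OF q this neg] obtain \<kappa> where \<kappa>: "\<kappa> \<ge> 0" "\<kappa> < 1"
    and bound: "\<And>n A. A \<subseteq> {..<d ^ n} \<Longrightarrow>
      \<forall>x\<in>A. (\<Prod>k<n. q (digit d k x)) \<noteq> 0 \<longrightarrow> (\<Prod>k<n. r (digit d k x)) \<ge> 1 \<Longrightarrow>
      (\<Sum>x\<in>A. \<Prod>k<n. q (digit d k x)) \<le> \<kappa> ^ n" by auto
  have "(\<Sum>x | x < d ^ n \<and> (\<Prod>k<n. q (digit d k x)) > 2 powr (- (n * (H - \<delta>))). \<Prod>k<n. q (digit d k x)) \<le> \<kappa> ^ n" for n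
  proof (rule bound)
    show "\<forall>x\<in>{x. x < d ^ n \<and> (\<Prod>k<n. q (digit d k x)) > 2 powr (- (n * (H - \<delta>)))}.
      (\<Prod>k<n. q (digit d k x)) \<noteq> 0 \<longrightarrow> (\<Prod>k<n. r (digit d k x)) \<ge> 1"
    proof (intro ballI impI)
      fix x assume x: "x \<in> {x. x < d ^ n \<and> (\<Prod>k<n. q (digit d k x)) > 2 powr (- (n * (H - \<delta>)))}"
        and nz: "(\<Prod>k<n. q (digit d k x)) \<noteq> 0"
      have pos: "q (digit d k x) > 0" if "k < n" for k
        using nz that x q(1)[OF digit_less[of x d n k]] by (auto simp: less_le)
      then have "(\<Prod>k<n. r (digit d k x)) = (\<Prod>k<n. q (digit d k x) * 2 powr (H - \<delta>))"
        by (intro prod.cong refl) (simp add: r_def)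
      also have "\<dots> = (\<Prod>k<n. q (digit d k x)) * (2 powr (H - \<delta>)) ^ n" by (simp add: prod.distrib)
      also have "(2 powr (H - \<delta>)) ^ n = 2 powr (n * (H - \<delta>))"
        by (simp add: powr_realpow[symmetric] powr_powr algebra_simps)
      finally have e: "(\<Prod>k<n. r (digit d k x)) = (\<Prod>k<n. q (digit d k x)) * 2 powr (n * (H - \<delta>))" .
      have "1 = 2 powr (- (n * (H - \<delta>))) * 2 powr (n * (H - \<delta>))"
        unfolding powr_add[symmetric] by simp
      also have "\<dots> \<le> (\<Prod>k<n. q (digit d k x)) * 2 powr (n * (H - \<delta>))"
        using x by (intro mult_right_mono) auto
      finally show "(\<Prod>k<n. r (digit d k x)) \<ge> 1" unfolding e .
    qed
  qed auto
  then show "\<exists>\<kappa>\<ge>0. \<kappa> < 1 \<and> (\<forall>n. (\<Sum>x | x < d ^ n \<and> (\<Prod>k<n. q (digit d k x)) > 2 powr (- (n * (H - \<delta>))).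
    \<Prod>k<n. q (digit d k x)) \<le> \<kappa> ^ n)" using \<kappa> by blast
qed

section \<open>Independent copies\<close>

text \<open>The order on complex numbers forces the quadratic form to be real. Testing it on e_i + c
  e_j with c = 0, 1, -1 and plus or minus the imaginary unit recovers the off-diagonal entries by
  polarization.\<close>

lemma psd_imp_hermitian:
  assumes A: "psd d A" and ij: "i < d" "j < d"
  shows "A $$ (j, i) = cnj (A $$ (i, j))"
proof -
  have pos: "(\<Sum>k<d. \<Sum>l<d. A $$ (k, l) * u l * cnj (u k)) \<ge> 0" for u
    using A[unfolded psd_iff, THEN conjunct2, THEN spec[of _ u]] .
  have quad: "(\<Sum>k<d. \<Sum>l<d. A $$ (k, l) * u l * cnj (u k)) =
      A $$ (i, i) + A $$ (i, j) * c + cnj c * (A $$ (j, i) + A $$ (j, j) * c)"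
    if u: "u = (\<lambda>k. (if k = i then 1 else 0) + (if k = j then c else 0))" for u c
  proof -
    have inner: "(\<Sum>l<d. A $$ (k, l) * u l) = A $$ (k, i) + A $$ (k, j) * c" for k
    proof -
      have "(\<Sum>l<d. A $$ (k, l) * u l) = (\<Sum>l<d. (if l = i then A $$ (k, l) else 0) + (if l = j then A $$ (k, l) * c else 0))"
        unfolding u by (intro sum.cong refl) (auto simp: distrib_left)
      then show ?thesis using ij by (simp add: sum.distrib)
    qed
    have "(\<Sum>k<d. \<Sum>l<d. A $$ (k, l) * u l * cnj (u k)) = (\<Sum>k<d. (A $$ (k, i) + A $$ (k, j) * c) * cnj (u k))"
      unfolding sum_distrib_right[symmetric] inner ..
    also have "\<dots> = (\<Sum>k<d. (if k = i then A $$ (k, i) + A $$ (k, j) * c else 0) +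
        (if k = j then cnj c * (A $$ (k, i) + A $$ (k, j) * c) else 0))"
      unfolding u by (intro sum.cong refl) (auto simp: distrib_left mult.commute)
    finally show ?thesis using ij by (simp add: sum.distrib)
  qed
  have real: "Im (A $$ (i, i) + A $$ (i, j) * c + cnj c * (A $$ (j, i) + A $$ (j, j) * c)) = 0" for c
  proof -
    have "0 \<le> A $$ (i, i) + A $$ (i, j) * c + cnj c * (A $$ (j, i) + A $$ (j, j) * c)"
      using pos[of "\<lambda>k. (if k = i then 1 else 0) + (if k = j then c else 0)"] unfolding quad[OF refl] .
    then show ?thesis by (simp add: less_eq_complex_def)
  qed
  show ?thesis using real[of 0] real[of 1] real[of "-1"] real[of \<i>] real[of "-\<i>"]
    by (simp add: complex_eq_iff)
qed

lemma von_neumann_entropy_diagonalization: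
  assumes U: "unitary n U" and A: "A = U * real_diag n s * mat_adjoint U"
  shows "von_neumann_entropy A = - (\<Sum>k<n. s k * log 2 (s k))"
proof -
  have c: "U \<in> carrier_mat n n" "mat_adjoint U \<in> carrier_mat n n"
    using U mat_adjoint_carrier unfolding unitary_def by auto
  have d: "real_diag n x \<in> carrier_mat n n" for x unfolding real_diag_def by simp
  have "A * hermitian_fun (log 2) A =
      (U * real_diag n s * mat_adjoint U) * (U * real_diag n (log 2 \<circ> s) * mat_adjoint U)"
    unfolding hermitian_fun_eq[OF U A] using A by simp
  also have "\<dots> = U * real_diag n s * (mat_adjoint U * U) * real_diag n (log 2 \<circ> s) * mat_adjoint U"
    using c d[of s] d[of "log 2 \<circ> s"]
    by (simp add: assoc_mult_mat[where n\<^sub>1 = n and n\<^sub>2 = n and n\<^sub>3 = n and n\<^sub>4 = n])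
  also have "\<dots> = U * (real_diag n s * real_diag n (log 2 \<circ> s)) * mat_adjoint U"
    using U c d[of s] d[of "log 2 \<circ> s"] unfolding unitary_def
    by (simp add: assoc_mult_mat[where n\<^sub>1 = n and n\<^sub>2 = n and n\<^sub>3 = n and n\<^sub>4 = n])
  also have "real_diag n s * real_diag n (log 2 \<circ> s) = real_diag n (\<lambda>k. s k * log 2 (s k))"
    unfolding real_diag_def by (simp add: o_def)
  finally have e: "A * hermitian_fun (log 2) A = U * real_diag n (\<lambda>k. s k * log 2 (s k)) * mat_adjoint U" .
  have "mat_trace (A * hermitian_fun (log 2) A) =
    (\<Sum>i<n. \<Sum>k<n. complex_of_real (s k * log 2 (s k)) * (cnj (U $$ (i, k)) * U $$ (i, k)))"
    unfolding e mat_trace_def using c diagonalization_index[OF c(1)]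
    by (simp add: mult_ac)
  also have "\<dots> = (\<Sum>k<n. complex_of_real (s k * log 2 (s k)) * (\<Sum>i<n. cnj (U $$ (i, k)) * U $$ (i, k)))"
    unfolding sum_distrib_left by (rule sum.swap)
  also have "\<dots> = complex_of_real (\<Sum>k<n. s k * log 2 (s k))"
    unfolding of_real_sum using unitary_imp_coeffs[OF U] unfolding unitary_coeffs_def by (intro sum.cong refl) simp
  finally show ?thesis unfolding von_neumann_entropy_def by simp
qed

text \<open>Collects all single-copy data. The last two clauses use Bob's coordinates in the
  eigenbasis \<open>W\<close> of his reduced state: the eigenvectors of \<open>\<rho>\<close> remain
  orthonormal, and their mixture has reduced state diag(\<open>q\<close>). This is exactly the form
  that passes to products over the copies.\<close>

lemma bipartite_spectral_data:
  assumes \<rho>: "density_operator (dA * dB) \<rho>"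
  shows "\<exists>p q U W. unitary_coeffs (dA * dB) U \<and> unitary_coeffs dB W \<and>
    (\<forall>i<dA * dB. \<forall>j<dA * dB. \<rho> $$ (i, j) = (\<Sum>e<dA * dB. complex_of_real (p e) * U i e * cnj (U j e))) \<and>
    (\<forall>e<dA * dB. p e \<ge> 0) \<and> (\<Sum>e<dA * dB. p e) = 1 \<and>
    (\<forall>b<dB. q b \<ge> 0) \<and> (\<Sum>b<dB. q b) = 1 \<and>
    von_neumann_entropy \<rho> = - (\<Sum>e<dA * dB. p e * log 2 (p e)) \<and>
    von_neumann_entropy (partial_trace_A dA dB \<rho>) = - (\<Sum>b<dB. q b * log 2 (q b)) \<and>
    (\<forall>e<dA * dB. \<forall>e'<dA * dB. (\<Sum>a<dA. \<Sum>b<dB. cnj (\<Sum>y<dB. cnj (W y b) * U (a * dB + y) e) *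
       (\<Sum>y<dB. cnj (W y b) * U (a * dB + y) e')) = (if e = e' then 1 else 0)) \<and>
    (\<forall>b<dB. \<forall>b'<dB. (\<Sum>e<dA * dB. complex_of_real (p e) * (\<Sum>a<dA. (\<Sum>y<dB. cnj (W y b) * U (a * dB + y) e) *
       cnj (\<Sum>y<dB. cnj (W y b') * U (a * dB + y) e))) = (if b = b' then complex_of_real (q b) else 0))"
proof -
  define N where "N = dA * dB"
  have psd: "psd N \<rho>" and tr: "mat_trace \<rho> = 1" using \<rho> unfolding density_operator_def N_def by auto
  have c: "\<rho> \<in> carrier_mat N N" using psd unfolding psd_def by simp
  have "\<exists>U s. unitary N U \<and> \<rho> = U * real_diag N s * mat_adjoint U"
    by (rule hermitian_diagonalization[OF c], rule psd_imp_hermitian[OF psd])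
  then obtain V p where V: "unitary N V" and \<rho>V: "\<rho> = V * real_diag N p * mat_adjoint V" by (elim exE conjE)
  define U where "U i e = V $$ (i, e)" for i e
  have cV: "V \<in> carrier_mat N N" using V unfolding unitary_def by simp
  have U: "unitary_coeffs N U" using unitary_imp_coeffs[OF V] unfolding U_def .
  have \<rho>U: "\<rho> $$ (i, j) = (\<Sum>e<N. complex_of_real (p e) * U i e * cnj (U j e))" if "i < N" "j < N" for i j
    unfolding U_def \<rho>V using diagonalization_index[OF cV that] .
  have p0: "p e \<ge> 0" if e: "e < N" for e
  proof -
    have "(\<Sum>i<N. \<Sum>j<N. \<rho> $$ (i, j) * U j e * cnj (U i e)) = complex_of_real (p e)"
      using kernel_eigenvalue[where S = "\<lambda>i j. \<rho> $$ (i, j)", OF U \<rho>U e e] by simp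
    moreover have "(\<Sum>i<N. \<Sum>j<N. \<rho> $$ (i, j) * U j e * cnj (U i e)) \<ge> 0"
      using psd[unfolded psd_iff, THEN conjunct2, THEN spec[of _ "\<lambda>j. U j e"]] .
    ultimately show ?thesis by (simp add: less_eq_complex_def)
  qed
  have p1: "(\<Sum>e<N. p e) = 1"
  proof -
    have "mat_trace \<rho> = (\<Sum>i<N. \<Sum>e<N. complex_of_real (p e) * (cnj (U i e) * U i e))"
      unfolding mat_trace_def using c by (simp add: \<rho>U mult_ac)
    also have "\<dots> = (\<Sum>e<N. complex_of_real (p e) * (\<Sum>i<N. cnj (U i e) * U i e))"
      unfolding sum_distrib_left by (rule sum.swap)
    also have "\<dots> = complex_of_real (\<Sum>e<N. p e)"
      unfolding of_real_sum using U unfolding unitary_coeffs_def by (intro sum.cong refl) simp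
    finally show ?thesis using tr by (metis of_real_eq_1_iff)
  qed
  define \<sigma> where "\<sigma> = partial_trace_A dA dB \<rho>"
  have c\<sigma>: "\<sigma> \<in> carrier_mat dB dB" unfolding \<sigma>_def partial_trace_A_def by simp
  have \<sigma>_index: "\<sigma> $$ (y, y') = (\<Sum>a<dA. \<rho> $$ (a * dB + y, a * dB + y'))" if "y < dB" "y' < dB" for y y'
    unfolding \<sigma>_def partial_trace_A_def using that by simp
  have less: "a * dB + y < N" if "a < dA" "y < dB" for a y
    unfolding N_def using pair_index_less[OF that] .
  have "\<exists>W s. unitary dB W \<and> \<sigma> = W * real_diag dB s * mat_adjoint W"
  proof (rule hermitian_diagonalization[OF c\<sigma>])
    fix y y' assume y: "y < dB" "y' < dB"
    show "\<sigma> $$ (y', y) = cnj (\<sigma> $$ (y, y'))"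
      unfolding \<sigma>_index[OF y] \<sigma>_index[OF y(2,1)] cnj_sum
      by (intro sum.cong refl psd_imp_hermitian[OF psd] less y) auto
  qed
  then obtain W' q where W': "unitary dB W'" and \<sigma>W: "\<sigma> = W' * real_diag dB q * mat_adjoint W'" by (elim exE conjE)
  define W where "W i e = W' $$ (i, e)" for i e
  have cW: "W' \<in> carrier_mat dB dB" using W' unfolding unitary_def by simp
  have W: "unitary_coeffs dB W" using unitary_imp_coeffs[OF W'] unfolding W_def .
  have \<sigma>W_index: "\<sigma> $$ (i, j) = (\<Sum>e<dB. complex_of_real (q e) * W i e * cnj (W j e))" if "i < dB" "j < dB" for i j
    unfolding W_def \<sigma>W using diagonalization_index[OF cW that] .
  define c1 where "c1 e a b = (\<Sum>y<dB. cnj (W y b) * U (a * dB + y) e)" for e a b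
  have orth: "(\<Sum>a<dA. \<Sum>b<dB. cnj (c1 e a b) * c1 e' a b) = (if e = e' then 1 else 0)" if e: "e < N" "e' < N" for e e'
  proof -
    have "(\<Sum>b<dB. cnj (c1 e a b) * c1 e' a b) = (\<Sum>y<dB. cnj (U (a * dB + y) e) * U (a * dB + y) e')" for a
    proof -
      have "(\<Sum>b<dB. cnj (c1 e a b) * c1 e' a b) =
        (\<Sum>b<dB. \<Sum>y<dB. \<Sum>y'<dB. cnj (U (a * dB + y) e) * U (a * dB + y') e' * (W y b * cnj (W y' b)))"
        unfolding c1_def cnj_sum sum_product by (simp add: mult_ac)
      also have "\<dots> = (\<Sum>y<dB. \<Sum>y'<dB. \<Sum>b<dB. cnj (U (a * dB + y) e) * U (a * dB + y') e' * (W y b * cnj (W y' b)))"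
        by (rule sum_rotate[symmetric])
      also have "\<dots> = (\<Sum>y<dB. \<Sum>y'<dB. if y' = y then cnj (U (a * dB + y) e) * U (a * dB + y') e' else 0)"
        using W unfolding unitary_coeffs_def by (intro sum.cong refl) (auto simp: sum_distrib_left[symmetric])
      finally show ?thesis by simp
    qed
    then have "(\<Sum>a<dA. \<Sum>b<dB. cnj (c1 e a b) * c1 e' a b) = (\<Sum>i<N. cnj (U i e) * U i e')"
      unfolding N_def sum_pairs_lessThan by simp
    then show ?thesis using U e unfolding unitary_coeffs_def by simp
  qed
  have marg: "(\<Sum>e<N. complex_of_real (p e) * (\<Sum>a<dA. c1 e a b * cnj (c1 e a b'))) = (if b = b' then complex_of_real (q b) else 0)"
    if b: "b < dB" "b' < dB" for b b'
  proof -
    have "(\<Sum>e<N. complex_of_real (p e) * (\<Sum>a<dA. c1 e a b * cnj (c1 e a b'))) =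
      (\<Sum>e<N. \<Sum>a<dA. \<Sum>y<dB. \<Sum>y'<dB. (complex_of_real (p e) * U (a * dB + y) e * cnj (U (a * dB + y') e)) * (W y' b' * cnj (W y b)))"
      unfolding c1_def cnj_sum sum_product unfolding sum_distrib_left by (simp add: mult_ac)
    also have "\<dots> = (\<Sum>a<dA. \<Sum>y<dB. \<Sum>y'<dB. \<Sum>e<N. (complex_of_real (p e) * U (a * dB + y) e * cnj (U (a * dB + y') e)) * (W y' b' * cnj (W y b)))"
      by (subst sum.swap, rule sum.cong[OF refl], rule sum_rotate[symmetric, THEN trans], rule refl)
    also have "\<dots> = (\<Sum>a<dA. \<Sum>y<dB. \<Sum>y'<dB. \<rho> $$ (a * dB + y, a * dB + y') * (W y' b' * cnj (W y b)))"
      by (intro sum.cong refl) (simp add: \<rho>U less sum_distrib_right)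
    also have "\<dots> = (\<Sum>y<dB. \<Sum>y'<dB. \<Sum>a<dA. \<rho> $$ (a * dB + y, a * dB + y') * (W y' b' * cnj (W y b)))"
      by (rule sum_rotate[symmetric])
    also have "\<dots> = (\<Sum>y<dB. \<Sum>y'<dB. \<sigma> $$ (y, y') * W y' b' * cnj (W y b))"
      by (intro sum.cong refl) (simp add: \<sigma>_index sum_distrib_right mult.assoc)
    also have "\<dots> = (if b = b' then complex_of_real (q b) else 0)"
      using kernel_eigenvalue[where S = "\<lambda>i j. \<sigma> $$ (i, j)", OF W \<sigma>W_index b] .
    finally show ?thesis .
  qed
  have sq: "complex_of_real ((cmod z)\<^sup>2) = z * cnj z" for z by (rule complex_norm_square)
  \<comment> \<open>Nonnegativity and normalization of \<open>q\<close> are read off from this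
    formula instead of from properties of the partial trace.\<close>
  have q: "q b = (\<Sum>e<N. p e * (\<Sum>a<dA. (cmod (c1 e a b))\<^sup>2))" if b: "b < dB" for b
  proof -
    have "complex_of_real (q b) = complex_of_real (\<Sum>e<N. p e * (\<Sum>a<dA. (cmod (c1 e a b))\<^sup>2))"
      unfolding of_real_sum of_real_mult sq using marg[OF b b] by simp
    then show ?thesis unfolding of_real_eq_iff .
  qed
  have q0: "q b \<ge> 0" if "b < dB" for b
    unfolding q[OF that] using p0 by (intro sum_nonneg mult_nonneg_nonneg) auto
  have norm1: "(\<Sum>a<dA. \<Sum>b<dB. (cmod (c1 e a b))\<^sup>2) = 1" if e: "e < N" for e
  proof -
    have "complex_of_real (\<Sum>a<dA. \<Sum>b<dB. (cmod (c1 e a b))\<^sup>2) = complex_of_real 1"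
      unfolding of_real_sum sq using orth[OF e e] by (simp add: mult.commute)
    then show ?thesis unfolding of_real_eq_iff .
  qed
  have q1: "(\<Sum>b<dB. q b) = 1"
  proof -
    have "(\<Sum>b<dB. q b) = (\<Sum>b<dB. \<Sum>e<N. \<Sum>a<dA. p e * (cmod (c1 e a b))\<^sup>2)"
      by (intro sum.cong refl) (simp add: q sum_distrib_left)
    also have "\<dots> = (\<Sum>e<N. \<Sum>a<dA. \<Sum>b<dB. p e * (cmod (c1 e a b))\<^sup>2)"
      by (rule sum_rotate[symmetric])
    also have "\<dots> = (\<Sum>e<N. p e)"
      by (intro sum.cong refl) (simp add: sum_distrib_left[symmetric] norm1)
    finally show ?thesis using p1 by simp
  qed
  show ?thesis
    using U W \<rho>U p0 p1 q0 q1 orth marg von_neumann_entropy_diagonalization[OF V \<rho>V]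
      von_neumann_entropy_diagonalization[OF W' \<sigma>W]
    unfolding c1_def N_def[symmetric] \<sigma>_def
    by (intro exI[of _ p] exI[of _ q] exI[of _ U] exI[of _ W] conjI allI impI)
qed

lemma iid_bipartite_power_index:
  assumes \<rho>: "\<And>i j. i < dA * dB \<Longrightarrow> j < dA * dB \<Longrightarrow>
      \<rho> $$ (i, j) = (\<Sum>e<dA * dB. complex_of_real (p e) * U i e * cnj (U j e))"
    and less: "a < dA ^ n" "a' < dA ^ n" "b < dB ^ n" "b' < dB ^ n"
  shows "bipartite_power dA dB n \<rho> $$ (a * dB ^ n + b, a' * dB ^ n + b') =
    (\<Sum>s<(dA * dB) ^ n. complex_of_real (\<Prod>k<n. p (digit (dA * dB) k s)) *
       (\<Prod>k<n. U (digit dA k a * dB + digit dB k b) (digit (dA * dB) k s)) *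
       cnj (\<Prod>k<n. U (digit dA k a' * dB + digit dB k b') (digit (dA * dB) k s)))"
proof -
  let ?i = "\<lambda>a b k. digit dA k a * dB + digit dB k b"
  have dm: "(x * D + y) div D = x" "(x * D + y) mod D = y" if "y < D" for x y D :: nat
    using that by auto
  have ci: "copy_index dA dB n k (x * dB ^ n + y) = ?i x y k" if "y < dB ^ n" for x y k
    unfolding copy_index_def dm[OF that] ..
  have "bipartite_power dA dB n \<rho> $$ (a * dB ^ n + b, a' * dB ^ n + b') = (\<Prod>k<n. \<rho> $$ (?i a b k, ?i a' b' k))"
    unfolding bipartite_power_def using less pair_index_less by (simp add: ci)
  also have "\<dots> = (\<Prod>k<n. \<Sum>e<dA * dB. complex_of_real (p e) * U (?i a b k) e * cnj (U (?i a' b' k) e))"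
    by (intro prod.cong refl \<rho> pair_index_less digit_less) (use less in auto)
  also have "\<dots> = (\<Sum>s<(dA * dB) ^ n. \<Prod>k<n. complex_of_real (p (digit (dA * dB) k s)) * U (?i a b k) (digit (dA * dB) k s)
      * cnj (U (?i a' b' k) (digit (dA * dB) k s)))"
    by (rule sum_prod_digits[symmetric])
  finally show ?thesis by (simp add: prod.distrib)
qed

lemma unitary_coeffs_iid:
  assumes "unitary_coeffs d W"
  shows "unitary_coeffs (d ^ n) (\<lambda>y b. \<Prod>k<n. W (digit d k y) (digit d k b))"
  unfolding unitary_coeffs_def
proof (intro conjI allI impI)
  fix x y assume xy: "x < d ^ n" "y < d ^ n"
  have "(\<Sum>z<d ^ n. cnj (\<Prod>k<n. W (digit d k z) (digit d k x)) * (\<Prod>k<n. W (digit d k z) (digit d k y))) =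
    (\<Sum>z<d ^ n. \<Prod>k<n. cnj (W (digit d k z) (digit d k x)) * W (digit d k z) (digit d k y))"
    by (simp add: prod.distrib)
  also have "\<dots> = (\<Prod>k<n. \<Sum>a<d. cnj (W a (digit d k x)) * W a (digit d k y))"
    by (rule sum_prod_digits)
  also have "\<dots> = (\<Prod>k<n. if digit d k x = digit d k y then 1 else 0)"
    using assms digit_less xy unfolding unitary_coeffs_def by (intro prod.cong refl) simp
  finally show "(\<Sum>z<d ^ n. cnj (\<Prod>k<n. W (digit d k z) (digit d k x)) * (\<Prod>k<n. W (digit d k z) (digit d k y))) =
    (if x = y then 1 else 0)" using prod_digits_delta[OF xy, of "\<lambda>_. 1"] by simp
  have "(\<Sum>z<d ^ n. (\<Prod>k<n. W (digit d k x) (digit d k z)) * cnj (\<Prod>k<n. W (digit d k y) (digit d k z))) =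
    (\<Sum>z<d ^ n. \<Prod>k<n. W (digit d k x) (digit d k z) * cnj (W (digit d k y) (digit d k z)))"
    by (simp add: prod.distrib)
  also have "\<dots> = (\<Prod>k<n. \<Sum>a<d. W (digit d k x) a * cnj (W (digit d k y) a))"
    by (rule sum_prod_digits)
  also have "\<dots> = (\<Prod>k<n. if digit d k x = digit d k y then 1 else 0)"
    using assms digit_less xy unfolding unitary_coeffs_def by (intro prod.cong refl) simp
  finally show "(\<Sum>z<d ^ n. (\<Prod>k<n. W (digit d k x) (digit d k z)) * cnj (\<Prod>k<n. W (digit d k y) (digit d k z))) =
    (if x = y then 1 else 0)" using prod_digits_delta[OF xy, of "\<lambda>_. 1"] by simp
qed

text \<open>Eigenvectors, weights, orthonormality and marginal all factor over the digits, so the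
  truncation bounds apply to \<open>n\<close> copies with collision parameter \<open>\<mu>\<close>
  times \<open>card TE\<close>.\<close>

lemma iid_protocol:
  fixes dA dB n M :: nat and p q :: "nat \<Rightarrow> real" and U W :: "nat \<Rightarrow> nat \<Rightarrow> complex" and TE TB :: "nat set" and \<mu> :: real
  defines "N \<equiv> dA * dB"
  assumes W: "unitary_coeffs dB W"
    and \<rho>: "\<And>i j. i < N \<Longrightarrow> j < N \<Longrightarrow> \<rho> $$ (i, j) = (\<Sum>e<N. complex_of_real (p e) * U i e * cnj (U j e))"
    and p: "\<And>e. e < N \<Longrightarrow> p e \<ge> 0" "(\<Sum>e<N. p e) = 1"
    and orth: "\<And>e e'. e < N \<Longrightarrow> e' < N \<Longrightarrow>
      (\<Sum>a<dA. \<Sum>b<dB. cnj (\<Sum>y<dB. cnj (W y b) * U (a * dB + y) e) *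
       (\<Sum>y<dB. cnj (W y b) * U (a * dB + y) e')) = (if e = e' then 1 else 0)"
    and marg: "\<And>b b'. b < dB \<Longrightarrow> b' < dB \<Longrightarrow>
      (\<Sum>e<N. complex_of_real (p e) * (\<Sum>a<dA. (\<Sum>y<dB. cnj (W y b) * U (a * dB + y) e) *
       cnj (\<Sum>y<dB. cnj (W y b') * U (a * dB + y) e))) = (if b = b' then complex_of_real (q b) else 0)"
    and M: "M > 0" and TE: "TE \<subseteq> {..<N ^ n}" and TB: "TB \<subseteq> {..<dB ^ n}"
    and \<mu>: "\<mu> \<ge> 0" "\<And>b. b \<in> TB \<Longrightarrow> (\<Prod>k<n. q (digit dB k b)) \<le> \<mu>"
  shows "\<exists>L T R. one_way_protocol dA dB \<rho> n
    (3 * ((\<Sum>s\<in>{..<N ^ n} - TE. \<Prod>k<n. p (digit N k s)) + (\<Sum>b\<in>{..<dB ^ n} - TB. \<Prod>k<n. q (digit dB k b)))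
      + M * (\<mu> * card TE)) M L T R"
proof -
  define c1 where "c1 e a b = (\<Sum>y<dB. cnj (W y b) * U (a * dB + y) e)" for e a b
  define P where "P s = (\<Prod>k<n. p (digit N k s))" for s
  define Q where "Q b = (\<Prod>k<n. q (digit dB k b))" for b
  define \<beta> where "\<beta> y b = (\<Prod>k<n. W (digit dB k y) (digit dB k b))" for y b
  define \<psi> where "\<psi> s a y = (\<Prod>k<n. U (digit dA k a * dB + digit dB k y) (digit N k s))" for s a y
  define c0 where "c0 s a b = (\<Prod>k<n. c1 (digit N k s) (digit dA k a) (digit dB k b))" for s a b
  have c0: "(\<Sum>y<dB ^ n. cnj (\<beta> y b) * \<psi> s a y) = c0 s a b" for s a b
  proof -
    have "(\<Sum>y<dB ^ n. cnj (\<beta> y b) * \<psi> s a y) =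
      (\<Sum>y<dB ^ n. \<Prod>k<n. cnj (W (digit dB k y) (digit dB k b)) * U (digit dA k a * dB + digit dB k y) (digit N k s))"
      unfolding \<beta>_def \<psi>_def by (simp add: prod.distrib)
    also have "\<dots> = (\<Prod>k<n. \<Sum>y<dB. cnj (W y (digit dB k b)) * U (digit dA k a * dB + y) (digit N k s))"
      by (rule sum_prod_digits)
    finally show ?thesis unfolding c0_def c1_def .
  qed
  have P0: "P s \<ge> 0" if "s < N ^ n" for s
    unfolding P_def using p(1) digit_less[OF that] by (intro prod_nonneg) auto
  have P1: "(\<Sum>s<N ^ n. P s) = 1"
    unfolding P_def using sum_prod_digits[where f = "\<lambda>_. p" and n = n and d = N] p(2) by simp
  have orth0: "(\<Sum>a<dA ^ n. \<Sum>b<dB ^ n. cnj (c0 s a b) * c0 s' a b) = (if s = s' then 1 else 0)"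
    if s: "s < N ^ n" "s' < N ^ n" for s s'
  proof -
    have "(\<Sum>a<dA ^ n. \<Sum>b<dB ^ n. cnj (c0 s a b) * c0 s' a b) =
      (\<Sum>a<dA ^ n. \<Sum>b<dB ^ n. \<Prod>k<n. cnj (c1 (digit N k s) (digit dA k a) (digit dB k b)) * c1 (digit N k s') (digit dA k a) (digit dB k b))"
      unfolding c0_def by (simp add: prod.distrib)
    also have "\<dots> = (\<Prod>k<n. \<Sum>a<dA. \<Sum>b<dB. cnj (c1 (digit N k s) a b) * c1 (digit N k s') a b)"
      by (rule sum_prod_digits_pair)
    also have "\<dots> = (\<Prod>k<n. if digit N k s = digit N k s' then 1 else 0)"
      using orth digit_less s unfolding c1_def by (intro prod.cong refl) simp
    finally show ?thesis using prod_digits_delta[OF s, of "\<lambda>_. 1"] by simp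
  qed
  have marg0: "(\<Sum>s<N ^ n. complex_of_real (P s) * (\<Sum>a<dA ^ n. c0 s a b * cnj (c0 s a b'))) =
      (if b = b' then complex_of_real (Q b) else 0)" if b: "b < dB ^ n" "b' < dB ^ n" for b b'
  proof -
    have "(\<Sum>s<N ^ n. complex_of_real (P s) * (\<Sum>a<dA ^ n. c0 s a b * cnj (c0 s a b'))) =
      (\<Sum>s<N ^ n. \<Sum>a<dA ^ n. \<Prod>k<n. complex_of_real (p (digit N k s)) *
        (c1 (digit N k s) (digit dA k a) (digit dB k b) * cnj (c1 (digit N k s) (digit dA k a) (digit dB k b'))))"
      unfolding c0_def P_def sum_distrib_left by (simp add: prod.distrib)
    also have "\<dots> = (\<Prod>k<n. \<Sum>e<N. \<Sum>a<dA. complex_of_real (p e) * (c1 e a (digit dB k b) * cnj (c1 e a (digit dB k b'))))"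
      by (rule sum_prod_digits_pair)
    also have "\<dots> = (\<Prod>k<n. if digit dB k b = digit dB k b' then complex_of_real (q (digit dB k b)) else 0)"
      using marg digit_less b unfolding c1_def sum_distrib_left[symmetric] by (intro prod.cong refl) simp
    finally show ?thesis using prod_digits_delta[OF b, of "\<lambda>k. complex_of_real (q (digit dB k b))"] by (simp add: Q_def)
  qed
  note bounds = truncation_bounds[OF TE TB P0 P1 orth0 marg0 \<mu>(1) \<mu>(2)[folded Q_def]]
  show ?thesis
    unfolding P_def[symmetric] Q_def[symmetric]
  proof (rule one_shot_protocol[where \<psi> = \<psi> and \<beta> = \<beta> and p = P and F = "N ^ n" and TE = TE and TB = TB])
    show "unitary_coeffs (dB ^ n) \<beta>" unfolding \<beta>_def by (rule unitary_coeffs_iid[OF W])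
    show "bipartite_power dA dB n \<rho> $$ (a * dB ^ n + b, a' * dB ^ n + b') =
         (\<Sum>s<N ^ n. complex_of_real (P s) * \<psi> s a b * cnj (\<psi> s a' b'))"
      if "a < dA ^ n" "a' < dA ^ n" "b < dB ^ n" "b' < dB ^ n" for a a' b b'
      unfolding \<psi>_def P_def N_def by (rule iid_bipartite_power_index[OF \<rho>[unfolded N_def] that])
  qed (unfold c0, rule M, erule P0, rule P1, (rule bounds | assumption)+)
qed

text \<open>For output dimension 1 the maximally entangled state is a scalar, and the fidelity is
  the trace of the output. Both parties measure in the standard basis and discard the
  result.\<close>

lemma trivial_protocol:
  assumes U: "unitary_coeffs (dA * dB) U"
    and \<rho>: "\<And>i j. i < dA * dB \<Longrightarrow> j < dA * dB \<Longrightarrow>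
      \<rho> $$ (i, j) = (\<Sum>e<dA * dB. complex_of_real (p e) * U i e * cnj (U j e))"
    and p: "(\<Sum>e<dA * dB. p e) = 1"
  shows "\<exists>L T R. one_way_protocol dA dB \<rho> n 0 1 L T R"
proof -
  let ?N = "dA * dB"
  define P where "P s = (\<Prod>k<n. p (digit ?N k s))" for s
  define \<psi> where "\<psi> s a y = (\<Prod>k<n. U (digit dA k a * dB + digit dB k y) (digit ?N k s))" for s a y
  have P1: "(\<Sum>s<?N ^ n. P s) = 1"
    unfolding P_def using sum_prod_digits[where f = "\<lambda>_. p" and n = n and d = ?N] p by simp
  have norm: "(\<Sum>a<dA ^ n. \<Sum>y<dB ^ n. (cmod (\<psi> s a y))\<^sup>2) = 1" if s: "s < ?N ^ n" for s
  proof -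
    have "complex_of_real (\<Sum>a<dA ^ n. \<Sum>y<dB ^ n. (cmod (\<psi> s a y))\<^sup>2) =
      (\<Sum>a<dA ^ n. \<Sum>y<dB ^ n. \<Prod>k<n. cnj (U (digit dA k a * dB + digit dB k y) (digit ?N k s)) * U (digit dA k a * dB + digit dB k y) (digit ?N k s))"
      unfolding of_real_sum complex_norm_square \<psi>_def by (simp add: prod.distrib mult.commute)
    also have "\<dots> = (\<Prod>k<n. \<Sum>a<dA. \<Sum>y<dB. cnj (U (a * dB + y) (digit ?N k s)) * U (a * dB + y) (digit ?N k s))"
      by (rule sum_prod_digits_pair)
    also have "\<dots> = (\<Prod>k<n. \<Sum>i<?N. cnj (U i (digit ?N k s)) * U i (digit ?N k s))"
      unfolding sum_pairs_lessThan ..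
    also have "\<dots> = (\<Prod>k<n. 1)"
      using U digit_less[OF s] unfolding unitary_coeffs_def by (intro prod.cong refl) simp
    finally show ?thesis by (metis of_real_eq_1_iff prod.neutral_const)
  qed
  \<comment> \<open>The row vector of basis state \<open>l\<close>; it serves as Kraus operator of
    both parties.\<close>
  define K where "K l i a = (if a = l then 1 else 0 :: complex)" for l i a :: nat
  have tp: "(\<Sum>l<d. \<Sum>i<1. cnj (K l i a) * K l i b) = (if a = b then 1 else 0)" if "a < d" for d a b
  proof -
    have "(\<Sum>l<d. \<Sum>i<1. cnj (K l i a) * K l i b) = (\<Sum>l<d. if l = a then (if a = b then 1 else 0) else 0)"
      unfolding K_def by (intro sum.cong refl) auto
    then show ?thesis using that by simp
  qed
  have "fidelity (max_entangled 1) (protocol_output dA dB n 1 (dA ^ n) (\<lambda>l. kraus_map (dA ^ n) 1 {l} K)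
      (\<lambda>l. kraus_map (dB ^ n) 1 {..<dB ^ n} K) \<rho>) =
    (\<Sum>l<dA ^ n. \<Sum>j<dB ^ n. \<Sum>s<?N ^ n. P s *
      (cmod (\<Sum>m<1. \<Sum>a<dA ^ n. \<Sum>b<dB ^ n. K l m a * K j m b * \<psi> s a b))\<^sup>2) / real 1"
    by (rule kraus_protocol_fidelity) (unfold \<psi>_def P_def, rule iid_bipartite_power_index[OF \<rho>])
  also have "\<dots> = (\<Sum>l<dA ^ n. \<Sum>j<dB ^ n. \<Sum>s<?N ^ n. P s * (cmod (\<psi> s l j))\<^sup>2)"
  proof -
    have "(\<Sum>m<1. \<Sum>a<dA ^ n. \<Sum>b<dB ^ n. K l m a * K j m b * \<psi> s a b) = \<psi> s l j"
      if "l < dA ^ n" "j < dB ^ n" for l j s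
    proof -
      have "(\<Sum>m<1. \<Sum>a<dA ^ n. \<Sum>b<dB ^ n. K l m a * K j m b * \<psi> s a b) =
        (\<Sum>a<dA ^ n. \<Sum>b<dB ^ n. K l 0 a * K j 0 b * \<psi> s a b)" by simp
      also have "\<dots> = (\<Sum>a<dA ^ n. \<Sum>b<dB ^ n. if b = j then if a = l then \<psi> s a b else 0 else 0)"
        unfolding K_def by (intro sum.cong refl) auto
      finally have "(\<Sum>m<1. \<Sum>a<dA ^ n. \<Sum>b<dB ^ n. K l m a * K j m b * \<psi> s a b) =
        (\<Sum>a<dA ^ n. \<Sum>b<dB ^ n. if b = j then if a = l then \<psi> s a b else 0 else 0)" .
      then show ?thesis using that by simp
    qed
    then show ?thesis by simp
  qed
  also have "\<dots> = (\<Sum>s<?N ^ n. P s * (\<Sum>l<dA ^ n. \<Sum>j<dB ^ n. (cmod (\<psi> s l j))\<^sup>2))"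
    unfolding sum_distrib_left by (rule sum_rotate)
  also have "\<dots> = 1" using norm P1 by simp
  finally have "fidelity (max_entangled 1) (protocol_output dA dB n 1 (dA ^ n) (\<lambda>l. kraus_map (dA ^ n) 1 {l} K)
      (\<lambda>l. kraus_map (dB ^ n) 1 {..<dB ^ n} K) \<rho>) = 1" .
  moreover have "instrument (dA ^ n) 1 (dA ^ n) (\<lambda>l. kraus_map (dA ^ n) 1 {l} K)"
    by (rule kraus_instrument) (rule tp)
  moreover have "quantum_operation (dB ^ n) 1 (kraus_map (dB ^ n) 1 {..<dB ^ n} K)"
    by (rule kraus_map_quantum_operation) (simp, rule tp)
  ultimately show ?thesis unfolding one_way_protocol_def
    by (intro exI[of _ "dA ^ n"] exI[of _ "\<lambda>l. kraus_map (dA ^ n) 1 {l} K"]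
        exI[of _ "\<lambda>l. kraus_map (dB ^ n) 1 {..<dB ^ n} K"] conjI allI impI) simp_all
qed

section \<open>From error bounds on n copies to achievable rates\<close>

lemma one_way_protocol_mono:
  "one_way_protocol dA dB \<rho> n \<epsilon> M L T R \<Longrightarrow> \<epsilon> \<le> \<epsilon>' \<Longrightarrow> one_way_protocol dA dB \<rho> n \<epsilon>' M L T R"
  unfolding one_way_protocol_def by auto

text \<open>For a nonnegative rate, rounding down loses at most a factor 2, that is one bit out of n
  r, which vanishes after division by n.\<close>

lemma floor_powr_rate:
  fixes r :: real
  assumes r: "r \<ge> 0"
  defines "M \<equiv> \<lambda>n :: nat. nat \<lfloor>2 powr (n * r)\<rfloor>"
  shows "M n \<ge> 1" and "real (M n) \<le> 2 powr (n * r)"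
    and "(\<lambda>n. log 2 (real (M n)) / real n) \<longlonglongrightarrow> r"
proof -
  have ge1: "2 powr (n * r) \<ge> 1" for n :: nat using r by (intro ge_one_powr_ge_zero) auto
  have Mn: "real (M n) = of_int \<lfloor>2 powr (n * r)\<rfloor>" for n
    unfolding M_def using ge1[of n] by simp
  have M1: "M n \<ge> 1" for n unfolding M_def using ge1[of n] by (simp add: nat_le_iff le_nat_iff le_floor_iff)
  have Mle: "real (M n) \<le> 2 powr (n * r)" for n unfolding Mn by (rule of_int_floor_le)
  show "M n \<ge> 1" "real (M n) \<le> 2 powr (n * r)" by (rule M1, rule Mle)
  have lower: "2 powr (n * r - 1) \<le> real (M n)" for n
  proof -
    have "real (M n) > 2 powr (n * r) - 1" unfolding Mn by linarith
    \<comment> \<open>x < M + 1 <= 2 M, because \<open>M\<close> is at least 1.\<close>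
    then have "2 powr (n * r) \<le> 2 * real (M n)" using M1[of n] by linarith
    then show ?thesis by (simp add: powr_diff)
  qed
  show "(\<lambda>n. log 2 (real (M n)) / real n) \<longlonglongrightarrow> r"
  proof (rule tendsto_sandwich)
    show "(\<lambda>n. r - 1 / real n) \<longlonglongrightarrow> r"
      using tendsto_diff[OF tendsto_const lim_1_over_n, of r] by simp
    show "(\<lambda>n. r) \<longlonglongrightarrow> r" by simp
    show "\<forall>\<^sub>F n in sequentially. r - 1 / real n \<le> log 2 (real (M n)) / real n"
    proof (rule eventually_sequentiallyI[of 1])
      fix n :: nat assume n: "n \<ge> 1"
      have "n * r - 1 \<le> log 2 (real (M n))"
        using lower[of n] M1[of n] by (subst le_log_iff) auto
      then have "(n * r - 1) / n \<le> log 2 (real (M n)) / n" by (intro divide_right_mono) auto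
      then show "r - 1 / real n \<le> log 2 (real (M n)) / real n" using n by (simp add: diff_divide_distrib)
    qed
    show "\<forall>\<^sub>F n in sequentially. log 2 (real (M n)) / real n \<le> r"
    proof (rule eventually_sequentiallyI[of 1])
      fix n :: nat assume n: "n \<ge> 1"
      have "log 2 (real (M n)) \<le> n * r"
        using Mle[of n] M1[of n] by (subst log_le_iff) auto
      then have "log 2 (real (M n)) / n \<le> n * r / n" by (intro divide_right_mono) auto
      then show "log 2 (real (M n)) / real n \<le> r" using n by simp
    qed
  qed
qed

text \<open>Every rate strictly between 0 and the coherent information is achieved with
  exponentially small error; the bound itself follows by passing to the supremum.\<close>

theorem theorem10:
  fixes dA dB :: nat and \<rho> :: "complex mat"
  assumes "density_operator (dA * dB) \<rho>"
  shows "distillable_entanglement dA dB \<rho>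
           \<ge> ereal (von_neumann_entropy (partial_trace_A dA dB \<rho>) - von_neumann_entropy \<rho>)"
proof -
  define N where "N = dA * dB"
  obtain p q U W where U: "unitary_coeffs N U" and W: "unitary_coeffs dB W"
    and \<rho>: "\<forall>i<N. \<forall>j<N. \<rho> $$ (i, j) = (\<Sum>e<N. complex_of_real (p e) * U i e * cnj (U j e))"
    and p0: "\<forall>e<N. p e \<ge> 0" and p1: "(\<Sum>e<N. p e) = 1"
    and q0: "\<forall>b<dB. q b \<ge> 0" and q1: "(\<Sum>b<dB. q b) = 1"
    and H\<rho>: "von_neumann_entropy \<rho> = - (\<Sum>e<N. p e * log 2 (p e))"
    and H\<sigma>: "von_neumann_entropy (partial_trace_A dA dB \<rho>) = - (\<Sum>b<dB. q b * log 2 (q b))"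
    and orth: "\<forall>e<N. \<forall>e'<N. (\<Sum>a<dA. \<Sum>b<dB. cnj (\<Sum>y<dB. cnj (W y b) * U (a * dB + y) e) *
       (\<Sum>y<dB. cnj (W y b) * U (a * dB + y) e')) = (if e = e' then 1 else 0)"
    and marg: "\<forall>b<dB. \<forall>b'<dB. (\<Sum>e<N. complex_of_real (p e) * (\<Sum>a<dA. (\<Sum>y<dB. cnj (W y b) * U (a * dB + y) e) *
       cnj (\<Sum>y<dB. cnj (W y b') * U (a * dB + y) e))) = (if b = b' then complex_of_real (q b) else 0)"
    using bipartite_spectral_data[OF assms] unfolding N_def by (elim exE conjE)
  define HAB where "HAB = von_neumann_entropy \<rho>"
  define HB where "HB = von_neumann_entropy (partial_trace_A dA dB \<rho>)"
  have achievable_le: "ereal r \<le> distillable_entanglement dA dB \<rho>" if "achievable_rate dA dB \<rho> r" for r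
    unfolding distillable_entanglement_def using that by (intro SUP_upper) simp
  \<comment> \<open>Settles the case of nonpositive coherent information.\<close>
  have "ereal 0 \<le> distillable_entanglement dA dB \<rho>"
  proof (rule achievable_le)
    have "\<exists>L T R. one_way_protocol dA dB \<rho> n 0 1 L T R" for n
      by (rule trivial_protocol[OF U[unfolded N_def] _ p1[unfolded N_def]]) (use \<rho> in \<open>simp add: N_def\<close>)
    then show "achievable_rate dA dB \<rho> 0"
      unfolding achievable_rate_def by (intro exI[of _ "\<lambda>_. 1"] exI[of _ "\<lambda>_. 0"]) simp
  qed
  moreover have "ereal r \<le> distillable_entanglement dA dB \<rho>" if r: "0 < r" "r < HB - HAB" for r
  proof (rule achievable_le)
    \<comment> \<open>The two typicality bounds cost \<open>\<delta>\<close> each; a quarter of the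
      gap leaves the exponent -2 n \<open>\<delta>\<close> for the collision term.\<close>
    define \<delta> where "\<delta> = (HB - HAB - r) / 4"
    have \<delta>: "\<delta> > 0" using r unfolding \<delta>_def by simp
    define M where "M n = nat \<lfloor>2 powr (n * r)\<rfloor>" for n :: nat
    note M = floor_powr_rate[of r, folded M_def]
    define P where "P n s = (\<Prod>k<n. p (digit N k s))" for n s
    define Q where "Q n b = (\<Prod>k<n. q (digit dB k b))" for n b
    define TE where "TE n = {s. s < N ^ n \<and> P n s \<ge> 2 powr (- (n * (HAB + \<delta>)))}" for n
    define TB where "TB n = {b. b < dB ^ n \<and> Q n b \<le> 2 powr (- (n * (HB - \<delta>)))}" for n
    obtain \<kappa> where \<kappa>: "\<kappa> \<ge> 0" "\<kappa> < 1"
      and TE_small: "\<And>n. (\<Sum>s | s < N ^ n \<and> P n s < 2 powr (- (n * (HAB + \<delta>))). P n s) \<le> \<kappa> ^ n"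
      using atypical_small(1)[of N p \<delta>] p0 p1 \<delta> unfolding P_def HAB_def H\<rho> by auto
    obtain \<kappa>' where \<kappa>': "\<kappa>' \<ge> 0" "\<kappa>' < 1"
      and TB_small: "\<And>n. (\<Sum>b | b < dB ^ n \<and> Q n b > 2 powr (- (n * (HB - \<delta>))). Q n b) \<le> \<kappa>' ^ n"
      using atypical_small(2)[of dB q \<delta>] q0 q1 \<delta> unfolding Q_def HB_def H\<sigma> by auto
    define \<epsilon> where "\<epsilon> n = 3 * (\<kappa> ^ n + \<kappa>' ^ n) + (2 powr (- 2 * \<delta>)) ^ n" for n :: nat
    \<comment> \<open>Counting: the typical weights are bounded below and sum to at most 1.\<close>
    have card: "card (TE n) \<le> 2 powr (n * (HAB + \<delta>))" for n
    proof -
      have P0: "P n s \<ge> 0" if "s < N ^ n" for s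
        unfolding P_def using p0 digit_less[OF that] by (intro prod_nonneg) auto
      have "card (TE n) * 2 powr (- (n * (HAB + \<delta>))) \<le> (\<Sum>s\<in>TE n. P n s)"
        using sum_bounded_below[of "TE n" "2 powr (- (n * (HAB + \<delta>)))" "P n"] unfolding TE_def by simp
      also have "\<dots> \<le> (\<Sum>s<N ^ n. P n s)" using P0 by (intro sum_mono2) (auto simp: TE_def)
      also have "\<dots> = 1"
        unfolding P_def using sum_prod_digits[where f = "\<lambda>_. p" and n = n and d = N] p1 by simp
      finally have le: "card (TE n) * 2 powr (- (n * (HAB + \<delta>))) \<le> 1" .
      have "card (TE n) = card (TE n) * 2 powr (- (n * (HAB + \<delta>))) * 2 powr (n * (HAB + \<delta>))"
        by (simp add: mult.assoc flip: powr_add)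
      also have "\<dots> \<le> 1 * 2 powr (n * (HAB + \<delta>))" by (rule mult_right_mono[OF le]) simp
      finally show ?thesis by simp
    qed
    have "\<exists>L T R. one_way_protocol dA dB \<rho> n (\<epsilon> n) (M n) L T R" for n
    proof -
      have "\<exists>L T R. one_way_protocol dA dB \<rho> n (3 * ((\<Sum>s\<in>{..<N ^ n} - TE n. P n s) + (\<Sum>b\<in>{..<dB ^ n} - TB n. Q n b))
        + M n * (2 powr (- (n * (HB - \<delta>))) * card (TE n))) (M n) L T R"
        unfolding P_def Q_def N_def
        by (rule iid_protocol[where p = p and q = q and U = U and W = W], rule W,
            erule (1) \<rho>[unfolded N_def, rule_format], erule p0[unfolded N_def, rule_format],
            rule p1[unfolded N_def], erule (1) orth[unfolded N_def, rule_format], erule (1) marg[unfolded N_def, rule_format])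
          (use M(1)[of n] r in \<open>auto simp: TE_def TB_def Q_def N_def\<close>)
      moreover have "(\<Sum>s\<in>{..<N ^ n} - TE n. P n s) \<le> \<kappa> ^ n"
      proof -
        have "{..<N ^ n} - TE n = {s. s < N ^ n \<and> P n s < 2 powr (- (n * (HAB + \<delta>)))}" unfolding TE_def by auto
        then show ?thesis using TE_small[of n] by simp
      qed
      moreover have "(\<Sum>b\<in>{..<dB ^ n} - TB n. Q n b) \<le> \<kappa>' ^ n"
      proof -
        have "{..<dB ^ n} - TB n = {b. b < dB ^ n \<and> Q n b > 2 powr (- (n * (HB - \<delta>)))}" unfolding TB_def by auto
        then show ?thesis using TB_small[of n] by simp
      qed
      moreover have "M n * (2 powr (- (n * (HB - \<delta>))) * card (TE n)) \<le> (2 powr (- 2 * \<delta>)) ^ n"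
      proof -
        have "M n * (2 powr (- (n * (HB - \<delta>))) * card (TE n)) \<le>
          2 powr (n * r) * (2 powr (- (n * (HB - \<delta>))) * 2 powr (n * (HAB + \<delta>)))"
          using M(2)[of n] card[of n] r by (intro mult_mono) auto
        also have "\<dots> = 2 powr (n * (- 2 * \<delta>))"
        proof -
          have r_eq: "r = HB - HAB - 4 * \<delta>" unfolding \<delta>_def by (simp add: field_simps)
          have "n * r + (- (n * (HB - \<delta>)) + n * (HAB + \<delta>)) = n * (- 2 * \<delta>)"
            unfolding r_eq by (simp add: algebra_simps)
          then show ?thesis by (simp only: powr_add[symmetric])
        qed
        also have "\<dots> = (2 powr (- 2 * \<delta>)) ^ n" by (simp add: powr_realpow[symmetric] powr_powr mult.commute)
        finally show ?thesis .
      qed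
      ultimately show ?thesis using one_way_protocol_mono unfolding \<epsilon>_def
        by (meson add_mono mult_left_mono zero_le_numeral)
    qed
    moreover have "\<epsilon> \<longlonglongrightarrow> 0"
    proof -
      have "2 powr (- 2 * \<delta>) < 2 powr 0" using \<delta> by (intro powr_less_mono) auto
      then have "(\<lambda>n. (2 powr (- 2 * \<delta>)) ^ n) \<longlonglongrightarrow> 0" by (intro LIMSEQ_realpow_zero) auto
      with LIMSEQ_realpow_zero[OF \<kappa>] LIMSEQ_realpow_zero[OF \<kappa>']
      have "(\<lambda>n. 3 * (\<kappa> ^ n + \<kappa>' ^ n) + (2 powr (- 2 * \<delta>)) ^ n) \<longlonglongrightarrow> 3 * (0 + 0) + 0"
        by (intro tendsto_add tendsto_mult tendsto_const)
      then show ?thesis unfolding \<epsilon>_def by simp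
    qed
    ultimately show "achievable_rate dA dB \<rho> r"
      unfolding achievable_rate_def using M r by (intro exI[of _ M] exI[of _ \<epsilon>]) auto
  qed
  ultimately have "ereal (HB - HAB) \<le> distillable_entanglement dA dB \<rho>"
  proof (cases "HB - HAB \<le> 0")
    case True
    then have "ereal (HB - HAB) \<le> ereal 0" by simp
    also assume "ereal 0 \<le> distillable_entanglement dA dB \<rho>"
    finally show ?thesis .
  next
    case False
    assume le: "\<And>r. 0 < r \<Longrightarrow> r < HB - HAB \<Longrightarrow> ereal r \<le> distillable_entanglement dA dB \<rho>"
    show ?thesis
    \<comment> \<open>Only rates strictly below the bound have been achieved; bounding them below by
      0 also makes every test value a real number.\<close>
    proof (rule dense_le_bounded[of "ereal 0"])
      fix w assume w: "ereal 0 < w" "w < ereal (HB - HAB)"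
      then obtain r where "w = ereal r" by (cases w) auto
      then show "w \<le> distillable_entanglement dA dB \<rho>" using w le by simp
    qed (use False in simp)
  qed
  then show ?thesis unfolding HAB_def HB_def .
qed

end
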